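(* Let $(X,S)$ be a finite nondegenerate symmetric set and let $L$ be a generic flat link. Then the number of $X$-colorings of $L$ equals $|X|^{n(L)}$, where $|X|$ is the size of $X$ and $n(L)$ is the number of components (closed curves) of $L$.
   Context: Let $X$ be a nonempty set and $S:X\times X\to X\times X$ a bijection, $S(x,y)=(S_1(x,y),S_2(x,y))$. $(X,S)$ is nondegenerate if for all fixed $y,z\in X$ the maps $x\mapsto S_2(x,y)$ and $x\mapsto S_1(z,x)$ are bijections $X\to X$. It is a braided set if $S^{12}S^{23}S^{12}=S^{23}S^{12}S^{23}$ on $X^3$, where $S^{12}=S\times \mathrm{id}_X$, $S^{23}=\mathrm{id}_X\times S$. It is involutive if $S^2=\mathrm{id}$. A symmetric set is an involutive braided set. A nondegenerate smooth curve in the plane is a parameterized curve $\gamma(t)=(x(t),y(t))$ with $x,y$ smooth whose derivatives are never simultaneously zero; it is oriented by its tangent vector $\gamma'$. A flat link is a finite collection of closed nondegenerate smooth curves in the plane. It is generic if its only singularities are simple (transversal double) crossings. A generic flat link is viewed as an oriented planar graph whose vertices are the crossings, each vertex having two incoming and two outgoing edges (each of the two strands passes straight through the crossing); closed edges without vertices (curves without crossings) are allowed. An $X$-coloring of a generic flat link $L$ is an assignment of an element of $X$ to every edge of $L$ such that at every vertex the following holds: look at the vertex so that both strands are directed forward (upward); if the left and right incoming edges are colored $i$ and $j$ respectively, and the left and right outgoing edges are colored $l$ and $k$ respectively (so that the strand entering with color $i$ leaves with color $k$ and the strand entering with color $j$ leaves with color $l$), then $S(i,j)=(l,k)$. *)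

theory Defs
  imports "HOL-Analysis.Analysis"
begin

definition nondegenerate :: "'a set \<Rightarrow> ('a \<times> 'a \<Rightarrow> 'a \<times> 'a) \<Rightarrow> bool" where
  "nondegenerate X S \<longleftrightarrow>
     (\<forall>y\<in>X. bij_betw (\<lambda>x. snd (S (x, y))) X X) \<and>
     (\<forall>z\<in>X. bij_betw (\<lambda>x. fst (S (z, x))) X X)"

definition S12 :: "('a \<times> 'a \<Rightarrow> 'a \<times> 'a) \<Rightarrow> 'a \<times> 'a \<times> 'a \<Rightarrow> 'a \<times> 'a \<times> 'a" where
  "S12 S = (\<lambda>(x, y, z). case S (x, y) of (x', y') \<Rightarrow> (x', y', z))"

definition S23 :: "('a \<times> 'a \<Rightarrow> 'a \<times> 'a) \<Rightarrow> 'a \<times> 'a \<times> 'a \<Rightarrow> 'a \<times> 'a \<times> 'a" where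
  "S23 S = (\<lambda>(x, y, z). case S (y, z) of (y', z') \<Rightarrow> (x, y', z'))"

definition braided_set :: "'a set \<Rightarrow> ('a \<times> 'a \<Rightarrow> 'a \<times> 'a) \<Rightarrow> bool" where
  "braided_set X S \<longleftrightarrow>
     X \<noteq> {} \<and> bij_betw S (X \<times> X) (X \<times> X) \<and>
     (\<forall>w \<in> X \<times> X \<times> X. S12 S (S23 S (S12 S w)) = S23 S (S12 S (S23 S w)))"

definition involutive_on :: "'a set \<Rightarrow> ('a \<times> 'a \<Rightarrow> 'a \<times> 'a) \<Rightarrow> bool" where
  "involutive_on X S \<longleftrightarrow> (\<forall>w \<in> X \<times> X. S (S w) = w)"

definition symmetric_set :: "'a set \<Rightarrow> ('a \<times> 'a \<Rightarrow> 'a \<times> 'a) \<Rightarrow> bool" where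
  "symmetric_set X S \<longleftrightarrow> braided_set X S \<and> involutive_on X S"

text \<open>The plane is the type \<^typ>\<open>complex\<close>; a closed curve is a 1-periodic function on the real
  line, so that smoothness also holds where the two ends of a period meet.\<close>

definition velocity :: "(real \<Rightarrow> complex) \<Rightarrow> real \<Rightarrow> complex" where
  "velocity \<gamma> t = vector_derivative \<gamma> (at t)"

definition smooth_curve :: "(real \<Rightarrow> complex) \<Rightarrow> bool" where
  "smooth_curve \<gamma> \<longleftrightarrow> (\<forall>k t. (velocity ^^ k) \<gamma> differentiable (at t))"

definition closed_nondegenerate_curve :: "(real \<Rightarrow> complex) \<Rightarrow> bool" where
  "closed_nondegenerate_curve \<gamma> \<longleftrightarrow>
     smooth_curve \<gamma> \<and> (\<forall>t. \<gamma> (t + 1) = \<gamma> t) \<and> (\<forall>t. velocity \<gamma> t \<noteq> 0)"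

text \<open>A flat link is a list of curves, so its number of components is its length.\<close>

definition flat_link :: "(real \<Rightarrow> complex) list \<Rightarrow> bool" where
  "flat_link L \<longleftrightarrow> (\<forall>\<gamma> \<in> set L. closed_nondegenerate_curve \<gamma>)"

text \<open>The pairs (component, parameter in one period) at which the link passes through \<open>p\<close>.\<close>

definition passages :: "(real \<Rightarrow> complex) list \<Rightarrow> complex \<Rightarrow> (nat \<times> real) set" where
  "passages L p = {(c, t). c < length L \<and> 0 \<le> t \<and> t < 1 \<and> (L ! c) t = p}"

definition crossings :: "(real \<Rightarrow> complex) list \<Rightarrow> complex set" where
  "crossings L = {p. \<exists>a\<in>passages L p. \<exists>b\<in>passages L p. a \<noteq> b}"

text \<open>The determinant of the matrix with columns \<open>v\<close>, \<open>w\<close>; it is positive iff \<open>w\<close> points to the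
  left of \<open>v\<close>.\<close>

definition det2 :: "complex \<Rightarrow> complex \<Rightarrow> real" where
  "det2 v w = Re v * Im w - Im v * Re w"

definition generic_flat_link :: "(real \<Rightarrow> complex) list \<Rightarrow> bool" where
  "generic_flat_link L \<longleftrightarrow> flat_link L \<and>
     (\<forall>p \<in> crossings L. finite (passages L p) \<and> card (passages L p) = 2 \<and>
        (\<forall>(c, s) \<in> passages L p. \<forall>(d, t) \<in> passages L p.
           (c, s) \<noteq> (d, t) \<longrightarrow> det2 (velocity (L ! c) s) (velocity (L ! d) t) \<noteq> 0))"

text \<open>Edges are the open arcs left after deleting the crossings; a curve without crossings is a
  single closed edge.\<close>

definition edges :: "(real \<Rightarrow> complex) list \<Rightarrow> complex set set" where
  "edges L = components ((\<Union>\<gamma>\<in>set L. range \<gamma>) - crossings L)"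

definition incoming_edge :: "(real \<Rightarrow> complex) list \<Rightarrow> nat \<Rightarrow> real \<Rightarrow> complex set \<Rightarrow> bool" where
  "incoming_edge L c t e \<longleftrightarrow> e \<in> edges L \<and> (\<forall>\<^sub>F u in at_left t. (L ! c) u \<in> e)"

definition outgoing_edge :: "(real \<Rightarrow> complex) list \<Rightarrow> nat \<Rightarrow> real \<Rightarrow> complex set \<Rightarrow> bool" where
  "outgoing_edge L c t e \<longleftrightarrow> e \<in> edges L \<and> (\<forall>\<^sub>F u in at_right t. (L ! c) u \<in> e)"

text \<open>Strand \<open>c\<close> at time \<open>s\<close> meets strand \<open>d\<close> at time \<open>t\<close>. When both are directed upward, the
  strand entering from the left leaves on the right. Hence \<open>c\<close> is the left incoming strand iff the
  velocity of \<open>d\<close> points to the left of that of \<open>c\<close>, and then the left outgoing edge belongs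
  to \<open>d\<close>. The determinant vanishes for a strand paired with itself.\<close>

definition is_coloring ::
  "'a set \<Rightarrow> ('a \<times> 'a \<Rightarrow> 'a \<times> 'a) \<Rightarrow> (real \<Rightarrow> complex) list \<Rightarrow> (complex set \<Rightarrow> 'a) \<Rightarrow> bool" where
  "is_coloring X S L f \<longleftrightarrow>
     f \<in> edges L \<rightarrow>\<^sub>E X \<and>
     (\<forall>c d s t in_left in_right out_left out_right.
        c < length L \<and> d < length L \<and> (L ! c) s = (L ! d) t \<and>
        det2 (velocity (L ! c) s) (velocity (L ! d) t) > 0 \<and>
        incoming_edge L c s in_left \<and> incoming_edge L d t in_right \<and>
        outgoing_edge L d t out_left \<and> outgoing_edge L c s out_right \<longrightarrow>
        S (f in_left, f in_right) = (f out_left, f out_right))"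

end

theory Submission
  imports Defs
begin

text \<open>Write \<open>S (x, y) = (g\<^sub>x y, f\<^sub>y x)\<close>. The idea is to find coordinates in which colors do not change at a
crossing. Attach to every region of the complement of the link a permutation \<open>\<sigma>\<close> of \<open>X\<close>, subject to
the rule that crossing an edge of color \<open>x\<close> from its right to its left turns \<open>\<sigma>\<close> into
\<open>f\<^sub>x\<inverse> \<circ> \<sigma>\<close>. The braid relation gives \<open>f\<^sub>j \<circ> f\<^sub>i = f\<^sub>k \<circ> f\<^sub>l\<close> whenever \<open>S (i, j) = (l, k)\<close>, so the
rule is consistent around a crossing. Since the plane is simply connected, there is exactly one such
assignment with a given value in one region. If \<open>\<sigma>\<close> is the permutation on the right of an edge of
color \<open>x\<close>, then the label \<open>\<sigma>\<inverse> x\<close> is the same before and after every crossing, hence it depends on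
the component only (\<open>label_at_crossing\<close>, \<open>label_at_component\<close>).

Conversely, let every component \<open>c\<close> carry an arbitrary label \<open>a\<^sub>c\<close>. Since the color of an edge must be
\<open>\<sigma> a\<^sub>c\<close>, the rule becomes \<open>\<sigma> \<mapsto> f\<^sub>x\<inverse> \<circ> \<sigma>\<close> with \<open>x = \<sigma> a\<^sub>c\<close>, an expression in \<open>\<sigma>\<close> and \<open>a\<^sub>c\<close> alone. These
maps \<open>push a\<^sub>c\<close> commute with each other (\<open>push_commute\<close>) and are bijective (\<open>push_bij\<close>), so the rule is
again consistent around every crossing, an assignment exists, and \<open>\<sigma> a\<^sub>c\<close> is a coloring
(\<open>push_solution\<close>). An assignment that satisfies one of the two rules satisfies the other one, and with
the value fixed in one region it is unique. So the two constructions are inverse to each other, and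
colorings correspond to functions from the components to \<open>X\<close> (\<open>coloring_of_inj\<close>,
\<open>coloring_of_surj\<close>).

The topology is the statement that a locally consistent rule for crossing edges has a unique solution
on a rectangle. It is proved for jumps in any set \<open>Y\<close>, with \<open>left value = J p (right value)\<close> at every
non-crossing point \<open>p\<close> of the link. For uniqueness (\<open>section_unique\<close>) the crossings can be deleted, because
a connected open subset of the plane stays connected without a discrete set, and near the other points
a chart (\<open>strand_chart_exists\<close>) shows one side and the other side of a single strand. For existence,
\<open>crossing_model\<close> writes down solutions in the four sectors at a crossing, and local solutions are glued
over rectangles with connected intersections (\<open>extendable_rect\<close>).\<close>

section \<open>A chart that straightens one strand\<close>

text \<open>The curve is the zero set of \<open>F\<close> in \<open>N\<close>, and the set where \<open>F\<close> is positive lies on its left: this is what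
the sign of \<open>\<kappa>\<close> says. The chart records a defining function and the connectedness of both sides instead
of a homeomorphism, because crossings are described by the signs of two such functions.\<close>

definition strand_chart ::
  "(real \<Rightarrow> complex) \<Rightarrow> real \<Rightarrow> real \<Rightarrow> complex set \<Rightarrow> (complex \<Rightarrow> real) \<Rightarrow> bool" where
  "strand_chart \<gamma> t\<^sub>0 \<tau> N F \<longleftrightarrow>
     open N \<and> \<tau> > 0 \<and> continuous_on N F \<and> \<gamma> ` {t\<^sub>0 - \<tau><..<t\<^sub>0 + \<tau>} \<subseteq> N \<and>
     (\<forall>z\<in>N. F z = 0 \<longleftrightarrow> z \<in> \<gamma> ` {t\<^sub>0 - \<tau><..<t\<^sub>0 + \<tau>}) \<and>
     connected {z \<in> N. F z > 0} \<and> connected {z \<in> N. F z < 0} \<and>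
     (\<forall>t\<in>{t\<^sub>0 - \<tau><..<t\<^sub>0 + \<tau>}.
        \<exists>\<kappa>>0. (F has_derivative (\<lambda>u. \<kappa> * det2 (velocity \<gamma> t) u)) (at (\<gamma> t)))"

lemma closed_curve_has_velocity:
  assumes "closed_nondegenerate_curve \<gamma>"
  shows "(\<gamma> has_vector_derivative velocity \<gamma> t) (at t)"
proof -
  have "(velocity ^^ 0) \<gamma> differentiable (at t)"
    using assms unfolding closed_nondegenerate_curve_def smooth_curve_def by blast
  then show ?thesis
    by (simp add: velocity_def vector_derivative_works)
qed

lemma closed_curve_continuous:
  assumes "closed_nondegenerate_curve \<gamma>"
  shows "isCont \<gamma> t"
  using closed_curve_has_velocity[OF assms, of t] has_vector_derivative_continuous by blast

lemma closed_curve_velocity_continuous: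
  assumes "closed_nondegenerate_curve \<gamma>"
  shows "isCont (velocity \<gamma>) t"
proof -
  have "(velocity ^^ 1) \<gamma> differentiable (at t)"
    using assms unfolding closed_nondegenerate_curve_def smooth_curve_def by blast
  then show ?thesis
    by (simp add: differentiable_imp_continuous_within)
qed

lemma closed_curve_periodic:
  assumes "closed_nondegenerate_curve \<gamma>"
  shows "\<gamma> (t + of_int n) = \<gamma> t"
proof -
  have per: "\<gamma> (t + 1) = \<gamma> t" for t
    using assms by (simp add: closed_nondegenerate_curve_def)
  have nat: "\<gamma> (t + of_nat k) = \<gamma> t" for t k
  proof (induction k)
    case (Suc k)
    then show ?case using per[of "t + of_nat k"] by (simp add: add_ac)
  qed simp
  show ?thesis
  proof (cases n)
    case (nonneg k)
    then show ?thesis using nat by simp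
  next
    case (neg k)
    then have "t = (t + of_int n) + of_nat (Suc k)" by simp
    then show ?thesis using nat by metis
  qed
qed

lemma closed_curve_velocity_periodic:
  assumes "closed_nondegenerate_curve \<gamma>"
  shows "velocity \<gamma> (t + of_int n) = velocity \<gamma> t"
proof -
  have "(\<gamma> has_vector_derivative velocity \<gamma> (t + of_int n)) (at (t + of_int n))"
    by (rule closed_curve_has_velocity[OF assms])
  then have "((\<gamma> \<circ> (\<lambda>s. s + of_int n)) has_vector_derivative 1 *\<^sub>R velocity \<gamma> (t + of_int n)) (at t)"
    by (intro vector_diff_chain_at) (auto intro!: derivative_eq_intros)
  moreover have "\<gamma> \<circ> (\<lambda>s. s + of_int n) = \<gamma>"
    using closed_curve_periodic[OF assms] by auto
  ultimately show ?thesis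
    by (simp add: vector_derivative_at velocity_def)
qed

lemma det2_commute: "det2 v w = - det2 w v"
  by (simp add: det2_def)

lemma det2_self [simp]: "det2 v v = 0"
  by (simp add: det2_def)

lemma det2_left_normal: "det2 v (\<i> * v) = v \<bullet> v"
  by (simp add: det2_def inner_complex_def)

text \<open>The component of \<open>u\<close> along \<open>v\<close> is removed so that the remainder is orthogonal to \<open>v0\<close>. This is the
computation behind the derivative of the defining function in the next proof.\<close>

lemma det2_project:
  assumes "v \<bullet> v0 \<noteq> 0"
  shows "det2 v0 (u - ((u \<bullet> v0) / (v \<bullet> v0)) *\<^sub>R v) = ((v0 \<bullet> v0) / (v \<bullet> v0)) * det2 v u"
proof -
  have "(v \<bullet> v0) * det2 v0 u - (u \<bullet> v0) * det2 v0 v = (v0 \<bullet> v0) * det2 v u"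
    by (simp add: det2_def inner_complex_def algebra_simps)
  moreover have "det2 v0 (u - c *\<^sub>R v) = det2 v0 u - c * det2 v0 v" for c
    by (simp add: det2_def algebra_simps)
  ultimately show ?thesis
    using assms by (simp only:) (simp add: field_simps)
qed

lemma bounded_linear_det2: "bounded_linear (det2 v)"
  unfolding det2_def by (intro bounded_linear_intros bounded_linear_Re bounded_linear_Im)

lemma orthogonal_part:
  assumes "v0 \<noteq> 0" "u \<bullet> v0 = 0"
  shows "u = (det2 v0 u / (v0 \<bullet> v0)) *\<^sub>R (\<i> * v0)"
proof -
  have *: "Re v0 * Re v0 + Im v0 * Im v0 \<noteq> 0"
    using assms(1) by (simp add: complex_eq_iff sum_squares_eq_zero_iff)
  have 0: "Re u * Re v0 = - (Im u * Im v0)"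
    using assms(2) by (simp add: inner_complex_def)
  show ?thesis
  proof (rule complex_eqI)
    have "Re u * (Re v0 * Re v0 + Im v0 * Im v0) = - ((Re v0 * Im u - Im v0 * Re u) * Im v0)"
      using 0 by algebra
    then show "Re u = Re ((det2 v0 u / (v0 \<bullet> v0)) *\<^sub>R (\<i> * v0))"
      using * by (simp add: det2_def inner_complex_def field_simps)
    have "Im u * (Re v0 * Re v0 + Im v0 * Im v0) = ((Re v0 * Im u - Im v0 * Re u) * Re v0)"
      using 0 by algebra
    then show "Im u = Im ((det2 v0 u / (v0 \<bullet> v0)) *\<^sub>R (\<i> * v0))"
      using * by (simp add: det2_def inner_complex_def field_simps)
  qed
qed

text \<open>Let \<open>v0\<close> be the velocity at \<open>t\<^sub>0\<close>. The orthogonal projection \<open>A\<close> of the curve to the direction of \<open>v0\<close>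
is strictly increasing near \<open>t\<^sub>0\<close>, so the curve is a graph over this direction, and \<open>F z\<close> is the height
of \<open>z\<close> over the graph. The radius \<open>\<tau>\<^sub>1\<close> does not depend on \<open>U\<close> and \<open>\<eta>\<close>: it controls
which parameters can enter an arbitrarily small chart.\<close>

lemma strand_chart_exists:
  assumes curve: "closed_nondegenerate_curve \<gamma>"
  shows "\<exists>\<tau>\<^sub>1>0. inj_on \<gamma> {t\<^sub>0 - \<tau>\<^sub>1<..<t\<^sub>0 + \<tau>\<^sub>1} \<and>
    (\<forall>U \<eta>. open U \<and> \<gamma> t\<^sub>0 \<in> U \<and> \<eta> > 0 \<longrightarrow>
      (\<exists>\<tau> N F. strand_chart \<gamma> t\<^sub>0 \<tau> N F \<and> N \<subseteq> U \<and> \<tau> \<le> \<eta> \<and>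
         (\<forall>u. \<bar>u - t\<^sub>0\<bar> < \<tau>\<^sub>1 \<and> \<gamma> u \<in> N \<longrightarrow> \<bar>u - t\<^sub>0\<bar> < \<tau>)))"
proof -
  define v0 where "v0 = velocity \<gamma> t\<^sub>0"
  \<comment> \<open>The normal to \<open>v0\<close>, scaled to \<open>det2 v0 w = 1\<close> so that \<open>F\<close> is the coordinate along \<open>w\<close>.\<close>
  define w where "w = (1 / (v0 \<bullet> v0)) *\<^sub>R (\<i> * v0)"
  define A where "A t = \<gamma> t \<bullet> v0" for t
  have v0: "v0 \<noteq> 0" "v0 \<bullet> v0 > 0"
    using curve by (auto simp: closed_nondegenerate_curve_def v0_def)
  have "det2 v0 w = (1 / (v0 \<bullet> v0)) * det2 v0 (\<i> * v0)"
    unfolding w_def by (simp add: det2_def algebra_simps)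
  then have w: "w \<bullet> v0 = 0" "det2 v0 w = 1"
    using v0 by (auto simp: w_def det2_left_normal inner_complex_def)
  note cont = closed_curve_continuous[OF curve]
  have A_deriv: "DERIV A t :> velocity \<gamma> t \<bullet> v0" for t
    using closed_curve_has_velocity[OF curve, of t] unfolding A_def
    by (auto simp: has_real_derivative_iff_has_vector_derivative has_vector_derivative_def
        intro!: derivative_eq_intros)
  have "isCont (\<lambda>t. velocity \<gamma> t \<bullet> v0) t\<^sub>0"
    by (intro continuous_intros closed_curve_velocity_continuous curve)
  then have "\<forall>\<^sub>F t in nhds t\<^sub>0. velocity \<gamma> t \<bullet> v0 > 0"
    using v0(2) unfolding v0_def isCont_def
    by (intro order_tendstoD(1)[OF tendsto_at_iff_tendsto_nhds[THEN iffD1]])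
  then obtain \<tau>1 where \<tau>1: "\<tau>1 > 0" "\<And>t. \<bar>t - t\<^sub>0\<bar> < \<tau>1 \<Longrightarrow> velocity \<gamma> t \<bullet> v0 > 0"
    by (auto simp: eventually_nhds_metric dist_real_def)
  have A_less: "A s < A t" if "s < t" "\<bar>s - t\<^sub>0\<bar> < \<tau>1" "\<bar>t - t\<^sub>0\<bar> < \<tau>1" for s t
    using that(1)
  proof (rule DERIV_pos_imp_increasing)
    fix x assume "s \<le> x" "x \<le> t"
    then show "\<exists>y. DERIV A x :> y \<and> y > 0"
      using A_deriv[of x] \<tau>1(2)[of x] that by fastforce
  qed
  define I where "I = {t. \<bar>t - t\<^sub>0\<bar> < \<tau>1}"
  have "inj_on A I"
    by (rule linorder_inj_onI') (use A_less in \<open>force simp: I_def\<close>)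
  \<comment> \<open>The inverse of the projection. It recovers the parameter of the point of the graph below \<open>z\<close>.\<close>
  define E where "E = the_inv_into I A"
  have E: "E (A t) = t" if "t \<in> I" for t
    unfolding E_def using that \<open>inj_on A I\<close> by (simp add: the_inv_into_f_f)
  have "open I"
    unfolding I_def by (intro open_Collect_less continuous_intros)
  have E_deriv: "DERIV E (A t) :> inverse (velocity \<gamma> t \<bullet> v0)" if "t \<in> I" for t
    unfolding has_field_derivative_def
  proof (rule has_derivative_inverse_strong[OF \<open>open I\<close> that])
    show "(A has_derivative (*) (velocity \<gamma> t \<bullet> v0)) (at t)"
      using A_deriv[of t] by (simp add: has_field_derivative_def)
    have "velocity \<gamma> t \<bullet> v0 \<noteq> 0" using \<tau>1(2)[of t] that by (simp add: I_def)
    then show "(*) (velocity \<gamma> t \<bullet> v0) \<circ> (*) (inverse (velocity \<gamma> t \<bullet> v0)) = id"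
      by (auto simp: fun_eq_iff)
    show "continuous_on I A"
      by (rule DERIV_continuous_on) (use A_deriv DERIV_subset in blast)
  qed (use E in auto)
  \<comment> \<open>Straightening coordinates: \<open>t\<close> along the curve and \<open>h\<close> along the fixed normal \<open>w\<close>.\<close>
  define \<Phi> where "\<Phi> = (\<lambda>(t, h). \<gamma> t + h *\<^sub>R w)"
  have cont\<Phi>: "continuous_on S \<Phi>" for S
    unfolding \<Phi>_def case_prod_unfold
    by (intro continuous_intros continuous_on_compose2[OF continuous_at_imp_continuous_on[of UNIV \<gamma>]])
       (use cont in auto)
  show ?thesis
  proof (rule exI[of _ \<tau>1], intro conjI allI impI)
    have "inj_on A {t\<^sub>0 - \<tau>1<..<t\<^sub>0 + \<tau>1}"
      by (rule inj_on_subset[OF \<open>inj_on A I\<close>]) (auto simp: I_def)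
    then show "inj_on \<gamma> {t\<^sub>0 - \<tau>1<..<t\<^sub>0 + \<tau>1}"
      unfolding A_def by (auto simp: inj_on_def)
  next
    fix U \<eta> assume "open U \<and> \<gamma> t\<^sub>0 \<in> U \<and> (\<eta>::real) > 0"
    then have U: "open U" "\<gamma> t\<^sub>0 \<in> U" and "\<eta> > 0" by auto
    have "open (\<Phi> -` U)"
      using U(1) cont\<Phi> by (simp add: open_vimage)
    moreover have "(t\<^sub>0, 0) \<in> \<Phi> -` U" using U(2) by (simp add: \<Phi>_def)
    ultimately obtain B C where BC: "open B" "open C" "t\<^sub>0 \<in> B" "0 \<in> C" "B \<times> C \<subseteq> \<Phi> -` U"
      by (rule open_prod_elim) auto
    obtain b where b: "b > 0" "\<And>t. \<bar>t - t\<^sub>0\<bar> < b \<Longrightarrow> t \<in> B"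
      using BC(1,3) by (metis open_real dist_real_def open_dist)
    obtain \<delta> where \<delta>: "\<delta> > 0" "\<And>h. \<bar>h\<bar> < \<delta> \<Longrightarrow> h \<in> C"
      using BC(2,4) by (metis open_dist dist_real_def diff_zero)
    define \<tau> where "\<tau> = Min {\<tau>1 / 2, b, \<eta>}"
    have \<tau>: "\<tau> > 0" "\<tau> < \<tau>1" "\<tau> \<le> b" "\<tau> \<le> \<eta>"
      using \<tau>1(1) b(1) \<open>\<eta> > 0\<close> by (auto simp: \<tau>_def)
    define W where "W = {t\<^sub>0 - \<tau><..<t\<^sub>0 + \<tau>}"
    have "W \<subseteq> I" using \<tau> by (auto simp: W_def I_def)
    define F where "F z = det2 v0 (z - \<gamma> (E (z \<bullet> v0)))" for z
    define strip where "strip = {z. A (t\<^sub>0 - \<tau>) < z \<bullet> v0 \<and> z \<bullet> v0 < A (t\<^sub>0 + \<tau>)}"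
    have strip: "\<exists>t\<in>W. A t = z \<bullet> v0" if "z \<in> strip" for z
    proof -
      have "\<exists>t\<ge>t\<^sub>0 - \<tau>. t \<le> t\<^sub>0 + \<tau> \<and> A t = z \<bullet> v0"
        by (rule IVT) (use that \<tau> A_deriv DERIV_isCont in \<open>auto simp: strip_def intro: less_imp_le\<close>)
      then obtain t where "t\<^sub>0 - \<tau> \<le> t" "t \<le> t\<^sub>0 + \<tau>" "A t = z \<bullet> v0" by blast
      moreover from this have "t \<noteq> t\<^sub>0 - \<tau>" "t \<noteq> t\<^sub>0 + \<tau>" using that by (auto simp: strip_def)
      ultimately show ?thesis unfolding W_def by force
    qed
    have A\<Phi>: "\<Phi> (t, h) \<bullet> v0 = A t" for t h
      using w by (simp add: \<Phi>_def A_def inner_add_left)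
    have F\<Phi>: "F (\<Phi> (t, h)) = h" if "t \<in> W" for t h
      unfolding F_def A\<Phi> using E[of t] that \<open>W \<subseteq> I\<close> w(2) by (auto simp: \<Phi>_def det2_def algebra_simps)
    have \<Phi>_strip: "\<Phi> (t, h) \<in> strip" if "t \<in> W" for t h
      unfolding strip_def using A_less[of "t\<^sub>0 - \<tau>" t] A_less[of t "t\<^sub>0 + \<tau>"] that \<tau>
      by (auto simp: A\<Phi> W_def)
    have strip_\<Phi>: "\<exists>t\<in>W. z = \<Phi> (t, F z)" if zs: "z \<in> strip" for z
    proof -
      obtain t where t: "t \<in> W" "A t = z \<bullet> v0" using strip[OF zs] by blast
      have "E (z \<bullet> v0) = t" using E t \<open>W \<subseteq> I\<close> by (metis subsetD)
      moreover have "(z - \<gamma> t) \<bullet> v0 = 0" using t by (simp add: A_def inner_diff_left)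
      ultimately have "z - \<gamma> t = F z *\<^sub>R w"
        using orthogonal_part[OF v0(1), of "z - \<gamma> t"] by (simp add: F_def w_def)
      then show ?thesis using t(1) by (auto simp: \<Phi>_def algebra_simps)
    qed
    have F_deriv: "(F has_derivative
        (\<lambda>u. ((v0 \<bullet> v0) / (velocity \<gamma> t \<bullet> v0)) * det2 (velocity \<gamma> t) u)) (at z)"
      if "t \<in> W" "z \<bullet> v0 = A t" for z t
    proof -
      have tI: "t \<in> I" using that \<open>W \<subseteq> I\<close> by blast
      have pos: "velocity \<gamma> t \<bullet> v0 \<noteq> 0" using \<tau>1(2)[of t] tI by (simp add: I_def)
      have 1: "((\<lambda>z. E (z \<bullet> v0)) has_derivative (\<lambda>u. inverse (velocity \<gamma> t \<bullet> v0) * (u \<bullet> v0))) (at z)"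
        by (rule has_derivative_compose[of "\<lambda>z. z \<bullet> v0" _ z UNIV E])
           (use E_deriv[OF tI] that in \<open>auto simp: has_field_derivative_def intro!: derivative_eq_intros\<close>)
      have 2: "(\<gamma> has_derivative (\<lambda>h. h *\<^sub>R velocity \<gamma> t)) (at (E (z \<bullet> v0)))"
        using closed_curve_has_velocity[OF curve, of t] E[OF tI] that
        by (simp add: has_vector_derivative_def)
      have "((\<lambda>z. z - \<gamma> (E (z \<bullet> v0))) has_derivative
              (\<lambda>u. u - (inverse (velocity \<gamma> t \<bullet> v0) * (u \<bullet> v0)) *\<^sub>R velocity \<gamma> t)) (at z)"
        by (intro has_derivative_diff has_derivative_ident has_derivative_compose[OF 1 2])
      then have "(F has_derivative
              (\<lambda>u. det2 v0 (u - (inverse (velocity \<gamma> t \<bullet> v0) * (u \<bullet> v0)) *\<^sub>R velocity \<gamma> t))) (at z)"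
        unfolding F_def by (rule bounded_linear.has_derivative[OF bounded_linear_det2])
      moreover have "inverse (velocity \<gamma> t \<bullet> v0) * (u \<bullet> v0) = (u \<bullet> v0) / (velocity \<gamma> t \<bullet> v0)" for u
        by (simp add: field_simps)
      ultimately show ?thesis using det2_project[OF pos] by simp
    qed
    have F_cont: "continuous_on strip F"
      by (rule continuous_at_imp_continuous_on)
         (metis F_deriv strip has_derivative_continuous)
    have "open strip"
      unfolding strip_def by (intro open_Collect_conj open_Collect_less continuous_intros)
    define N where "N = {z \<in> strip. \<bar>F z\<bar> < \<delta>}"
    have N_part: "{z \<in> N. P (F z)} = \<Phi> ` (W \<times> {h. \<bar>h\<bar> < \<delta> \<and> P h})" for P
    proof (intro equalityI subsetI)
      fix z assume "z \<in> {z \<in> N. P (F z)}"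
      then show "z \<in> \<Phi> ` (W \<times> {h. \<bar>h\<bar> < \<delta> \<and> P h})"
        using strip_\<Phi>[of z] by (auto simp: N_def)
    qed (use F\<Phi> \<Phi>_strip in \<open>auto simp: N_def\<close>)
    have conn: "connected {z \<in> N. P (F z)}" if "connected {h. \<bar>h\<bar> < \<delta> \<and> P h}" for P
      unfolding N_part
      by (intro connected_continuous_image cont\<Phi> connected_Times that) (simp add: W_def)
    have \<gamma>\<Phi>: "\<gamma> t = \<Phi> (t, 0)" for t by (simp add: \<Phi>_def)
    have "strand_chart \<gamma> t\<^sub>0 \<tau> N F \<and> N \<subseteq> U \<and> \<tau> \<le> \<eta> \<and>
        (\<forall>u. \<bar>u - t\<^sub>0\<bar> < \<tau>1 \<and> \<gamma> u \<in> N \<longrightarrow> \<bar>u - t\<^sub>0\<bar> < \<tau>)"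
    proof (intro conjI allI impI)
      show "strand_chart \<gamma> t\<^sub>0 \<tau> N F"
        unfolding strand_chart_def W_def[symmetric]
      proof (intro conjI ballI)
        have "N = strip \<inter> F -` {-\<delta><..<\<delta>}" by (auto simp: N_def)
        then show "open N"
          using continuous_open_preimage[OF F_cont \<open>open strip\<close>] by simp
        show "continuous_on N F"
          using F_cont by (rule continuous_on_subset) (auto simp: N_def)
        show "\<gamma> ` W \<subseteq> N" 
          unfolding N_def \<gamma>\<Phi> using \<Phi>_strip F\<Phi> \<delta>(1) by auto
        have "{h. \<bar>h\<bar> < \<delta> \<and> 0 < h} = {0<..<\<delta>}" "{h. \<bar>h\<bar> < \<delta> \<and> h < 0} = {-\<delta><..<0}" by auto
        then show "connected {z \<in> N. 0 < F z}" "connected {z \<in> N. F z < 0}"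
          by (auto intro!: conn)
        fix z assume "z \<in> N"
        then have "z \<in> strip" by (simp add: N_def)
        show "(F z = 0) = (z \<in> \<gamma> ` W)"
        proof
          assume "F z = 0"
          then show "z \<in> \<gamma> ` W" using strip_\<Phi>[OF \<open>z \<in> strip\<close>] \<gamma>\<Phi> by auto
        next
          assume "z \<in> \<gamma> ` W"
          then show "F z = 0" using F\<Phi> \<gamma>\<Phi> by fastforce
        qed
      next
        fix t assume t: "t \<in> W"
        then have "velocity \<gamma> t \<bullet> v0 > 0" using \<tau>1(2)[of t] \<open>W \<subseteq> I\<close> by (auto simp: I_def)
        then show "\<exists>\<kappa>>0. (F has_derivative (\<lambda>u. \<kappa> * det2 (velocity \<gamma> t) u)) (at (\<gamma> t))"
          using F_deriv[OF t, of "\<gamma> t"] v0(2)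
          by (intro exI[of _ "(v0 \<bullet> v0) / (velocity \<gamma> t \<bullet> v0)"]) (auto simp: A_def)
      qed (rule \<tau>(1))
      show "N \<subseteq> U"
      proof
        fix z assume "z \<in> N"
        then obtain t where "t \<in> W" "z = \<Phi> (t, F z)" "\<bar>F z\<bar> < \<delta>"
          using strip_\<Phi> by (auto simp: N_def)
        moreover from this have "t \<in> B" "F z \<in> C" using b(2) \<delta>(2) \<tau>(3) by (auto simp: W_def)
        ultimately show "z \<in> U" using BC(5) by auto
      qed
      show "\<tau> \<le> \<eta>" by (rule \<tau>(4))
      fix u assume u: "\<bar>u - t\<^sub>0\<bar> < \<tau>1 \<and> \<gamma> u \<in> N"
      then have "A (t\<^sub>0 - \<tau>) < A u" "A u < A (t\<^sub>0 + \<tau>)"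
        by (auto simp: N_def strip_def A_def)
      moreover have "A u < A (t\<^sub>0 - \<tau>)" if "u < t\<^sub>0 - \<tau>"
        using that u \<tau> by (intro A_less) auto
      moreover have "A (t\<^sub>0 + \<tau>) < A u" if "t\<^sub>0 + \<tau> < u"
        using that u \<tau> by (intro A_less) auto
      ultimately have "\<not> u < t\<^sub>0 - \<tau>" "u \<noteq> t\<^sub>0 - \<tau>" "\<not> t\<^sub>0 + \<tau> < u" "u \<noteq> t\<^sub>0 + \<tau>"
        by force+
      then show "\<bar>u - t\<^sub>0\<bar> < \<tau>" by linarith
    qed
    then show "\<exists>\<tau> N F. strand_chart \<gamma> t\<^sub>0 \<tau> N F \<and> N \<subseteq> U \<and> \<tau> \<le> \<eta> \<and>
        (\<forall>u. \<bar>u - t\<^sub>0\<bar> < \<tau>1 \<and> \<gamma> u \<in> N \<longrightarrow> \<bar>u - t\<^sub>0\<bar> < \<tau>)"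
      by blast
  qed (rule \<tau>1(1))
qed

text \<open>The derivative of \<open>F \<circ> \<eta>\<close> at \<open>s\<close> is \<open>\<kappa> * det2 v u\<close>, hence its sign tells the side to which a transversal
curve goes.\<close>

lemma strand_chart_crossing_sides:
  assumes chart: "strand_chart \<gamma> t\<^sub>0 \<tau> N F" and t: "t \<in> {t\<^sub>0 - \<tau><..<t\<^sub>0 + \<tau>}"
    and \<eta>: "(\<eta> has_vector_derivative u) (at s)" "\<eta> s = \<gamma> t"
    and pos: "det2 (velocity \<gamma> t) u > 0"
  shows "\<forall>\<^sub>F r in at_right s. F (\<eta> r) > 0" and "\<forall>\<^sub>F r in at_left s. F (\<eta> r) < 0"
proof -
  obtain \<kappa> where \<kappa>: "\<kappa> > 0" "(F has_derivative (\<lambda>u. \<kappa> * det2 (velocity \<gamma> t) u)) (at (\<gamma> t))"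
    using chart t unfolding strand_chart_def by blast
  have "((\<lambda>r. F (\<eta> r)) has_derivative (\<lambda>h. \<kappa> * det2 (velocity \<gamma> t) (h *\<^sub>R u))) (at s)"
    using \<eta> \<kappa>(2) by (intro has_derivative_compose[of \<eta> _ s UNIV F]) (auto simp: has_vector_derivative_def)
  moreover have "\<kappa> * det2 (velocity \<gamma> t) (h *\<^sub>R u) = (\<kappa> * det2 (velocity \<gamma> t) u) * h" for h
    by (simp add: det2_def algebra_simps)
  ultimately have D: "DERIV (\<lambda>r. F (\<eta> r)) s :> \<kappa> * det2 (velocity \<gamma> t) u"
    by (simp add: has_field_derivative_def)
  have 0: "F (\<eta> s) = 0"
    using chart t \<eta>(2) unfolding strand_chart_def by blast
  have d: "\<kappa> * det2 (velocity \<gamma> t) u > 0" using \<kappa>(1) pos by simp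
  obtain e where e: "e > 0" "\<And>h. 0 < h \<Longrightarrow> h < e \<Longrightarrow> F (\<eta> s) < F (\<eta> (s + h))"
    using DERIV_pos_inc_right[OF D d] by blast
  show "\<forall>\<^sub>F r in at_right s. F (\<eta> r) > 0"
    unfolding eventually_at_right_field
    by (rule exI[of _ "s + e"]) (use e(1) e(2)[of "_ - s"] 0 in auto)
  obtain e where e: "e > 0" "\<And>h. 0 < h \<Longrightarrow> h < e \<Longrightarrow> F (\<eta> (s - h)) < F (\<eta> s)"
    using DERIV_pos_inc_left[OF D d] by blast
  show "\<forall>\<^sub>F r in at_left s. F (\<eta> r) < 0"
    unfolding eventually_at_left_field
    by (rule exI[of _ "s - e"]) (use e(1) e(2)[of "s - _"] 0 in auto)
qed

lemma strand_chart_normal_sides: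
  assumes chart: "strand_chart \<gamma> t\<^sub>0 \<tau> N F" and t: "t \<in> {t\<^sub>0 - \<tau><..<t\<^sub>0 + \<tau>}"
    and nz: "velocity \<gamma> t \<noteq> 0"
  shows "\<forall>\<^sub>F h in at_right 0. F (\<gamma> t + of_real h * (\<i> * velocity \<gamma> t)) > 0"
    and "\<forall>\<^sub>F h in at_right 0. F (\<gamma> t - of_real h * (\<i> * velocity \<gamma> t)) < 0"
proof -
  have *: "((\<lambda>h. \<gamma> t + of_real h * (\<i> * velocity \<gamma> t)) has_vector_derivative \<i> * velocity \<gamma> t) (at 0)"
    unfolding has_vector_derivative_def
    by (auto intro!: derivative_eq_intros simp: scaleR_conv_of_real)
  note sides = strand_chart_crossing_sides[OF chart t *]
  show "\<forall>\<^sub>F h in at_right 0. F (\<gamma> t + of_real h * (\<i> * velocity \<gamma> t)) > 0"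
    using sides(1) nz by (simp add: det2_left_normal)
  show "\<forall>\<^sub>F h in at_right 0. F (\<gamma> t - of_real h * (\<i> * velocity \<gamma> t)) < 0"
    using sides(2) nz by (simp add: det2_left_normal eventually_at_left_to_right)
qed

lemma strand_chartD:
  assumes "strand_chart \<gamma> t\<^sub>0 \<tau> N F"
  shows "open N" "\<tau> > 0" "continuous_on N F"
    "\<bar>t - t\<^sub>0\<bar> < \<tau> \<Longrightarrow> \<gamma> t \<in> N" "\<bar>t - t\<^sub>0\<bar> < \<tau> \<Longrightarrow> F (\<gamma> t) = 0"
    "z \<in> N \<Longrightarrow> F z = 0 \<Longrightarrow> z \<in> range \<gamma>"
    "connected {z \<in> N. F z > 0}" "connected {z \<in> N. F z < 0}"
proof -
  show on: "\<gamma> t \<in> N" if "\<bar>t - t\<^sub>0\<bar> < \<tau>" for t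
  proof -
    have "t \<in> {t\<^sub>0 - \<tau><..<t\<^sub>0 + \<tau>}" using that by auto
    then show ?thesis using assms unfolding strand_chart_def by blast
  qed
  show "F (\<gamma> t) = 0" if "\<bar>t - t\<^sub>0\<bar> < \<tau>"
  proof -
    have "t \<in> {t\<^sub>0 - \<tau><..<t\<^sub>0 + \<tau>}" using that by auto
    then show ?thesis using assms on[OF that] unfolding strand_chart_def by blast
  qed
qed (use assms in \<open>auto simp: strand_chart_def\<close>)

section \<open>The trace of a generic flat link\<close>

definition trace :: "(real \<Rightarrow> complex) list \<Rightarrow> complex set" where
  "trace L = (\<Union>\<gamma>\<in>set L. range \<gamma>)"

text \<open>The edges of the link are the components of this set (\<open>edges_eq\<close>).\<close>

definition simple_points :: "(real \<Rightarrow> complex) list \<Rightarrow> complex set" where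
  "simple_points L = trace L - crossings L"

text \<open>At a simple point the strand through it is unique, and its velocity does not depend on the period of the
parameter (\<open>left_normal_eq\<close>).\<close>

definition left_normal :: "(real \<Rightarrow> complex) list \<Rightarrow> complex \<Rightarrow> complex" where
  "left_normal L p =
     (THE n. \<exists>c t. c < length L \<and> (L ! c) t = p \<and> n = \<i> * velocity (L ! c) t)"

definition component_at :: "(real \<Rightarrow> complex) list \<Rightarrow> complex \<Rightarrow> nat" where
  "component_at L p = (THE c. c < length L \<and> p \<in> range (L ! c))"

lemma trace_iff: "p \<in> trace L \<longleftrightarrow> (\<exists>c<length L. \<exists>t. (L ! c) t = p)"
  unfolding trace_def by (fastforce simp: in_set_conv_nth)

locale generic_link =
  fixes L :: "(real \<Rightarrow> complex) list"
  assumes generic: "generic_flat_link L"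
begin

lemma curve: "c < length L \<Longrightarrow> closed_nondegenerate_curve (L ! c)"
  using generic by (auto simp: generic_flat_link_def flat_link_def)

lemma velocity_nonzero: "c < length L \<Longrightarrow> velocity (L ! c) t \<noteq> 0"
  using curve by (auto simp: closed_nondegenerate_curve_def)

lemmas curve_periodic = closed_curve_periodic[OF curve]
lemmas velocity_periodic = closed_curve_velocity_periodic[OF curve]
lemmas curve_continuous = closed_curve_continuous[OF curve]

lemma curve_frac: "c < length L \<Longrightarrow> (L ! c) (frac t) = (L ! c) t"
  using curve_periodic[of c "frac t" "\<lfloor>t\<rfloor>"] by (simp add: frac_def)

lemma velocity_frac: "c < length L \<Longrightarrow> velocity (L ! c) (frac t) = velocity (L ! c) t"
  using velocity_periodic[of c "frac t" "\<lfloor>t\<rfloor>"] by (simp add: frac_def)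

lemma passage_frac: "c < length L \<Longrightarrow> (c, frac t) \<in> passages L ((L ! c) t)"
  by (simp add: passages_def frac_lt_1 curve_frac)

lemma frac_eq_of_shift_eq: "s - of_int n = t - of_int m \<Longrightarrow> frac s = frac t" for s t :: real
proof -
  assume "s - of_int n = t - of_int m"
  then have "s = t + of_int (n - m)" by simp
  then show ?thesis by (simp only: frac_def floor_add_int) simp
qed

lemma frac_eqD: "frac s = frac t \<Longrightarrow> \<exists>n. t = s + of_int n" for s t :: real
  by (metis add.commute diff_add_cancel frac_def add_diff_eq of_int_add of_int_diff)

lemma simple_passage_unique:
  assumes "p \<in> simple_points L" "c < length L" "d < length L" "(L ! c) s = p" "(L ! d) t = p"
  shows "c = d \<and> (\<exists>n. t = s + of_int n)"
proof -
  have "(c, frac s) = (d, frac t)"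
    using assms passage_frac[of c s] passage_frac[of d t]
    by (auto simp: simple_points_def crossings_def)
  then show ?thesis using frac_eqD by blast
qed

lemma left_normal_eq:
  assumes "c < length L" "(L ! c) t \<in> simple_points L"
  shows "left_normal L ((L ! c) t) = \<i> * velocity (L ! c) t"
  unfolding left_normal_def
proof (rule the_equality)
  show "\<exists>d s. d < length L \<and> (L ! d) s = (L ! c) t \<and> \<i> * velocity (L ! c) t = \<i> * velocity (L ! d) s"
    using assms by blast
next
  fix n assume "\<exists>d s. d < length L \<and> (L ! d) s = (L ! c) t \<and> n = \<i> * velocity (L ! d) s"
  then obtain d s where "d < length L" "(L ! d) s = (L ! c) t" "n = \<i> * velocity (L ! d) s" by blast
  then show "n = \<i> * velocity (L ! c) t"
    using simple_passage_unique[OF assms(2,1), of d t s] velocity_periodic by auto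
qed

lemma component_at_eq:
  assumes "c < length L" "(L ! c) t \<in> simple_points L"
  shows "component_at L ((L ! c) t) = c"
  unfolding component_at_def
proof (rule the_equality)
  fix d assume "d < length L \<and> (L ! c) t \<in> range (L ! d)"
  then show "d = c" using simple_passage_unique[OF assms(2,1), of d t] by auto
qed (use assms in auto)

lemma crossing_strands:
  assumes "p \<in> crossings L"
  obtains c s d t where "c < length L" "d < length L" "(L ! c) s = p" "(L ! d) t = p"
    "det2 (velocity (L ! c) s) (velocity (L ! d) t) > 0"
proof -
  obtain c s d t where *: "(c, s) \<in> passages L p" "(d, t) \<in> passages L p" "(c, s) \<noteq> (d, t)"
    using assms unfolding crossings_def by fast
  moreover have "\<forall>(c, s) \<in> passages L p. \<forall>(d, t) \<in> passages L p.
      (c, s) \<noteq> (d, t) \<longrightarrow> det2 (velocity (L ! c) s) (velocity (L ! d) t) \<noteq> 0"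
    using generic assms unfolding generic_flat_link_def by (elim conjE) (drule bspec, assumption, elim conjE)
  ultimately have "det2 (velocity (L ! c) s) (velocity (L ! d) t) \<noteq> 0"
    by fastforce
  then consider "det2 (velocity (L ! c) s) (velocity (L ! d) t) > 0"
    | "det2 (velocity (L ! d) t) (velocity (L ! c) s) > 0"
    using det2_commute[of "velocity (L ! c) s" "velocity (L ! d) t"] by linarith
  then show ?thesis
  proof cases
    case 1
    then show ?thesis using that[of c d s t] * by (simp add: passages_def)
  next
    case 2
    then show ?thesis using that[of d c t s] * by (simp add: passages_def)
  qed
qed

lemma transversal_passages:
  assumes "c < length L" "d < length L" "(L ! c) s = (L ! d) t"
    and "det2 (velocity (L ! c) s) (velocity (L ! d) t) \<noteq> 0"
  shows "(L ! c) s \<in> crossings L"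
    and "b < length L \<Longrightarrow> (L ! b) u = (L ! c) s \<Longrightarrow>
           (b = c \<and> (\<exists>n. u = s + of_int n)) \<or> (b = d \<and> (\<exists>n. u = t + of_int n))"
proof -
  let ?p = "(L ! c) s"
  have ne: "(c, frac s) \<noteq> (d, frac t)"
    using assms velocity_frac by (metis det2_self Pair_inject)
  have mem: "(c, frac s) \<in> passages L ?p" "(d, frac t) \<in> passages L ?p"
    using passage_frac[OF assms(1), of s] passage_frac[OF assms(2), of t] assms(3) by auto
  then show cr: "?p \<in> crossings L"
    using ne unfolding crossings_def by blast
  then have "finite (passages L ?p)" "card (passages L ?p) = 2"
    using generic unfolding generic_flat_link_def by auto
  then have eq: "passages L ?p = {(c, frac s), (d, frac t)}"
    using mem ne card_subset_eq[of "passages L ?p" "{(c, frac s), (d, frac t)}"] by auto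
  assume "b < length L" "(L ! b) u = ?p"
  then have "(b, frac u) \<in> {(c, frac s), (d, frac t)}"
    using passage_frac[of b u] eq by auto
  then show "(b = c \<and> (\<exists>n. u = s + of_int n)) \<or> (b = d \<and> (\<exists>n. u = t + of_int n))"
    using frac_eqD by auto
qed

text \<open>By compactness of a period: the parameters that stay away from all passages through \<open>p\<close> are mapped to a
compact set that does not contain \<open>p\<close>.\<close>

lemma nearby_parameters:
  assumes "\<eta> > 0"
  obtains r where "r > 0"
    "\<And>b u. b < length L \<Longrightarrow> (L ! b) u \<in> ball p r \<Longrightarrow> \<exists>u'. (L ! b) u' = p \<and> \<bar>u - u'\<bar> < \<eta>"
proof -
  define K where "K b = {0..1} - (\<Union>u'\<in>{u'. (L ! b) u' = p}. ball u' \<eta>)" for b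
  have "\<exists>r>0. \<forall>u\<in>K b. r \<le> dist p ((L ! b) u)" if b: "b < length L" for b
  proof -
    have "compact (K b)"
      unfolding K_def by (intro compact_diff compact_Icc open_UN ballI open_ball)
    then have "compact ((L ! b) ` K b)"
      by (intro compact_continuous_image continuous_at_imp_continuous_on ballI curve_continuous b)
    moreover have "p \<notin> (L ! b) ` K b"
      using \<open>\<eta> > 0\<close> by (auto simp: K_def)
    ultimately show ?thesis
      using separate_point_closed[of "(L ! b) ` K b" p] by (auto intro: compact_imp_closed)
  qed
  then obtain R where R: "\<And>b. b < length L \<Longrightarrow> R b > 0 \<and> (\<forall>u\<in>K b. R b \<le> dist p ((L ! b) u))"
    by metis
  define r where "r = Min (insert 1 (R ` {..<length L}))"
  have r: "r > 0" "\<And>b. b < length L \<Longrightarrow> r \<le> R b"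
    using R by (auto simp: r_def)
  show ?thesis
  proof
    fix b u assume b: "b < length L" "(L ! b) u \<in> ball p r"
    then have "frac u \<notin> K b"
      using R[OF b(1)] r(2)[OF b(1)] curve_frac[OF b(1), of u] by force
    then obtain u' where u': "(L ! b) u' = p" "\<bar>frac u - u'\<bar> < \<eta>"
      unfolding K_def by (auto simp: dist_real_def frac_lt_1 less_imp_le abs_minus_commute)
    have "(L ! b) (u' + of_int \<lfloor>u\<rfloor>) = p"
      using curve_periodic[OF b(1)] u'(1) by simp
    moreover have "\<bar>u - (u' + of_int \<lfloor>u\<rfloor>)\<bar> < \<eta>" using u'(2) by (simp add: frac_def algebra_simps)
    ultimately show "\<exists>u'. (L ! b) u' = p \<and> \<bar>u - u'\<bar> < \<eta>" by blast
  qed (rule r(1))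
qed

lemma compact_trace: "compact (trace L)"
proof -
  have period: "range (L ! c) = (L ! c) ` {0..1}" if "c < length L" for c
  proof (intro equalityI subsetI)
    fix z assume "z \<in> range (L ! c)"
    then obtain t where "z = (L ! c) t" by blast
    then show "z \<in> (L ! c) ` {0..1}"
      using curve_frac[OF that, of t] by (intro image_eqI[of _ _ "frac t"]) (auto simp: frac_lt_1 less_imp_le)
  qed auto
  have "trace L = (\<Union>c<length L. range (L ! c))"
    by (intro set_eqI) (auto simp: trace_iff)
  also have "\<dots> = (\<Union>c<length L. (L ! c) ` {0..1})"
    by (intro SUP_cong refl period) simp
  finally have "trace L = (\<Union>c<length L. (L ! c) ` {0..1})" .
  then show ?thesis
    by (auto intro!: compact_UN compact_continuous_image continuous_at_imp_continuous_on curve_continuous)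
qed

lemma closed_trace: "closed (trace L)"
  by (rule compact_imp_closed[OF compact_trace])

text \<open>A small chart around a simple point meets the link in one arc only. The curve cannot come back to \<open>N\<close>
at parameters that are close to \<open>t\<close> but outside the window, nor, by \<open>nearby_parameters\<close>, at others.\<close>

lemma simple_chart:
  assumes c: "c < length L" and p: "(L ! c) t \<in> simple_points L"
    and U: "open U" "(L ! c) t \<in> U" and "\<eta> > 0"
  obtains \<tau> N F where "strand_chart (L ! c) t \<tau> N F" "N \<subseteq> U" "\<tau> \<le> \<eta>"
    "N \<inter> trace L = (L ! c) ` {t - \<tau><..<t + \<tau>}" "N \<inter> crossings L = {}"
proof -
  obtain \<tau>\<^sub>1 where \<tau>\<^sub>1: "\<tau>\<^sub>1 > 0" "inj_on (L ! c) {t - \<tau>\<^sub>1<..<t + \<tau>\<^sub>1}"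
    "\<forall>U \<eta>. open U \<and> (L ! c) t \<in> U \<and> \<eta> > 0 \<longrightarrow>
      (\<exists>\<tau> N F. strand_chart (L ! c) t \<tau> N F \<and> N \<subseteq> U \<and> \<tau> \<le> \<eta> \<and>
         (\<forall>u. \<bar>u - t\<bar> < \<tau>\<^sub>1 \<and> (L ! c) u \<in> N \<longrightarrow> \<bar>u - t\<bar> < \<tau>))"
    using strand_chart_exists[OF curve[OF c], of t] by (elim exE conjE) (rule that)
  obtain r where r: "r > 0" "\<And>b u. b < length L \<Longrightarrow> (L ! b) u \<in> ball ((L ! c) t) r \<Longrightarrow>
      \<exists>u'. (L ! b) u' = (L ! c) t \<and> \<bar>u - u'\<bar> < \<tau>\<^sub>1"
    using nearby_parameters[OF \<tau>\<^sub>1(1), of "(L ! c) t"] by blast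
  obtain \<tau> N F where N: "strand_chart (L ! c) t \<tau> N F" "N \<subseteq> U \<inter> ball ((L ! c) t) r" "\<tau> \<le> \<eta>"
    "\<And>u. \<bar>u - t\<bar> < \<tau>\<^sub>1 \<Longrightarrow> (L ! c) u \<in> N \<Longrightarrow> \<bar>u - t\<bar> < \<tau>"
    using \<tau>\<^sub>1(3)[rule_format, of "U \<inter> ball ((L ! c) t) r" \<eta>] open_Int[OF U(1) open_ball] U(2) \<open>r > 0\<close> \<open>\<eta> > 0\<close>
    by (elim meta_impE exE conjE) (auto intro: that)
  have near: "b = c \<and> (\<exists>n. \<bar>u - of_int n - t\<bar> < \<tau>\<^sub>1)" if b: "b < length L" "(L ! b) u \<in> N" for b u
  proof -
    obtain u' where "(L ! b) u' = (L ! c) t" "\<bar>u - u'\<bar> < \<tau>\<^sub>1"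
      using r(2)[OF b(1), of u] b(2) N(2) by blast
    moreover from this obtain n where "b = c" "u' = t + of_int n"
      using simple_passage_unique[OF p c b(1)] by auto
    ultimately show ?thesis by (intro conjI exI[of _ n]) (auto simp: algebra_simps)
  qed
  show ?thesis
  proof (rule that[of \<tau> N F])
    show "N \<inter> trace L = (L ! c) ` {t - \<tau><..<t + \<tau>}"
    proof (intro equalityI subsetI)
      fix z assume z: "z \<in> N \<inter> trace L"
      then obtain b u where b: "b < length L" "z = (L ! b) u" by (auto simp: trace_iff)
      then obtain n where n: "b = c" "\<bar>u - of_int n - t\<bar> < \<tau>\<^sub>1" using near z by blast
      have "(L ! c) (u - of_int n) = z"
        using curve_periodic[OF c, of "u - of_int n" n] b n by simp
      then show "z \<in> (L ! c) ` {t - \<tau><..<t + \<tau>}"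
        using N(4)[OF n(2)] z by (intro image_eqI[of _ _ "u - of_int n"]) auto
    next
      fix z assume "z \<in> (L ! c) ` {t - \<tau><..<t + \<tau>}"
      then show "z \<in> N \<inter> trace L"
        using strand_chartD(4)[OF N(1)] c by (auto simp: trace_iff abs_less_iff)
    qed
    show "N \<inter> crossings L = {}"
    proof (rule ccontr)
      assume "N \<inter> crossings L \<noteq> {}"
      then obtain z where z: "z \<in> N" "z \<in> crossings L" by blast
      obtain b u d v where *: "(b, u) \<in> passages L z" "(d, v) \<in> passages L z" "(b, u) \<noteq> (d, v)"
        using z(2) unfolding crossings_def by fast
      then have bd: "b < length L" "d < length L" "(L ! b) u = z" "(L ! d) v = z"
        "0 \<le> u" "u < 1" "0 \<le> v" "v < 1"
        by (auto simp: passages_def)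
      have uN: "(L ! b) u \<in> N" and vN: "(L ! d) v \<in> N" using bd(3,4) z(1) by auto
      obtain n m where nm: "b = c" "\<bar>u - of_int n - t\<bar> < \<tau>\<^sub>1" "d = c" "\<bar>v - of_int m - t\<bar> < \<tau>\<^sub>1"
        using near[OF bd(1) uN] near[OF bd(2) vN] by blast
      have "(L ! c) (u - of_int n) = z" "(L ! c) (v - of_int m) = z"
        using curve_periodic[OF c, of "u - of_int n" n] curve_periodic[OF c, of "v - of_int m" m] bd(3,4) nm(1,3)
        by simp_all
      then have eq: "u - of_int n = v - of_int m"
        using nm by (intro inj_onD[OF \<tau>\<^sub>1(2)]) auto
      then have "frac u = frac v"
        by (rule frac_eq_of_shift_eq)
      then have "u = v" using bd by (simp add: frac_eq)
      then show False using * nm by simp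
    qed
  qed (use N(1-3) in simp_all)
qed

text \<open>Near a crossing each of the two strands has its own defining function. As \<open>d\<close> crosses \<open>c\<close> from right to
left, \<open>Fc\<close> is negative on \<open>d\<close> before the crossing and positive after it; for \<open>Fd\<close> on \<open>c\<close> it is the other
way round. So the signs of \<open>Fc\<close> and \<open>Fd\<close> distinguish the four sectors.\<close>

lemma crossing_chart:
  assumes cd: "c < length L" "d < length L" "(L ! c) s = p" "(L ! d) t = p"
    and det: "det2 (velocity (L ! c) s) (velocity (L ! d) t) > 0"
    and U: "open U" "p \<in> U" and "\<eta> > 0"
  obtains N and Fc Fd :: "complex \<Rightarrow> real" and \<epsilon> where "open N" "p \<in> N" "N \<subseteq> U" "0 < \<epsilon>" "\<epsilon> \<le> \<eta>"
    "continuous_on N Fc" "continuous_on N Fd"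
    "\<And>z. z \<in> N \<Longrightarrow> z \<notin> trace L \<Longrightarrow> Fc z \<noteq> 0 \<and> Fd z \<noteq> 0"
    "N \<inter> trace L \<subseteq> (L ! c) ` {s - \<epsilon><..<s + \<epsilon>} \<union> (L ! d) ` {t - \<epsilon><..<t + \<epsilon>}"
    "N \<inter> crossings L = {p}"
    "\<And>u. s < u \<Longrightarrow> u < s + \<epsilon> \<Longrightarrow> Fd ((L ! c) u) < 0"
    "\<And>u. s - \<epsilon> < u \<Longrightarrow> u < s \<Longrightarrow> Fd ((L ! c) u) > 0"
    "\<And>u. t < u \<Longrightarrow> u < t + \<epsilon> \<Longrightarrow> Fc ((L ! d) u) > 0"
    "\<And>u. t - \<epsilon> < u \<Longrightarrow> u < t \<Longrightarrow> Fc ((L ! d) u) < 0"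
    "\<And>u. \<bar>u - s\<bar> < \<epsilon> \<Longrightarrow> \<forall>\<^sub>F h in at_right 0. Fc ((L ! c) u + of_real h * (\<i> * velocity (L ! c) u)) > 0"
    "\<And>u. \<bar>u - s\<bar> < \<epsilon> \<Longrightarrow> \<forall>\<^sub>F h in at_right 0. Fc ((L ! c) u - of_real h * (\<i> * velocity (L ! c) u)) < 0"
    "\<And>u. \<bar>u - t\<bar> < \<epsilon> \<Longrightarrow> \<forall>\<^sub>F h in at_right 0. Fd ((L ! d) u + of_real h * (\<i> * velocity (L ! d) u)) > 0"
    "\<And>u. \<bar>u - t\<bar> < \<epsilon> \<Longrightarrow> \<forall>\<^sub>F h in at_right 0. Fd ((L ! d) u - of_real h * (\<i> * velocity (L ! d) u)) < 0"
proof -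
  obtain \<tau>c where \<tau>c: "\<tau>c > 0" "inj_on (L ! c) {s - \<tau>c<..<s + \<tau>c}"
    "\<forall>U \<eta>. open U \<and> (L ! c) s \<in> U \<and> \<eta> > 0 \<longrightarrow>
      (\<exists>\<tau> N F. strand_chart (L ! c) s \<tau> N F \<and> N \<subseteq> U \<and> \<tau> \<le> \<eta> \<and>
         (\<forall>u. \<bar>u - s\<bar> < \<tau>c \<and> (L ! c) u \<in> N \<longrightarrow> \<bar>u - s\<bar> < \<tau>))"
    using strand_chart_exists[OF curve[OF cd(1)], of s] by (elim exE conjE) (rule that)
  obtain \<tau>d where \<tau>d: "\<tau>d > 0" "inj_on (L ! d) {t - \<tau>d<..<t + \<tau>d}"
    "\<forall>U \<eta>. open U \<and> (L ! d) t \<in> U \<and> \<eta> > 0 \<longrightarrow>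
      (\<exists>\<tau> N F. strand_chart (L ! d) t \<tau> N F \<and> N \<subseteq> U \<and> \<tau> \<le> \<eta> \<and>
         (\<forall>u. \<bar>u - t\<bar> < \<tau>d \<and> (L ! d) u \<in> N \<longrightarrow> \<bar>u - t\<bar> < \<tau>))"
    using strand_chart_exists[OF curve[OF cd(2)], of t] by (elim exE conjE) (rule that)
  obtain \<sigma> Nc Fc where Nc: "strand_chart (L ! c) s \<sigma> Nc Fc" "Nc \<subseteq> U"
    using \<tau>c(3)[rule_format, of U \<eta>] U cd(3) \<open>\<eta> > 0\<close> by auto
  obtain \<rho> Nd Fd where Nd: "strand_chart (L ! d) t \<rho> Nd Fd" "Nd \<subseteq> U"
    using \<tau>d(3)[rule_format, of U \<eta>] U cd(4) \<open>\<eta> > 0\<close> by auto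
  have pos: "\<sigma> > 0" "\<rho> > 0" using Nc Nd by (auto simp: strand_chart_def)
  have vc: "((L ! c) has_vector_derivative velocity (L ! c) s) (at s)"
    and vd: "((L ! d) has_vector_derivative velocity (L ! d) t) (at t)"
    using closed_curve_has_velocity curve cd by auto
  have "\<forall>\<^sub>F u in at_right t. Fc ((L ! d) u) > 0" "\<forall>\<^sub>F u in at_left t. Fc ((L ! d) u) < 0"
    using strand_chart_crossing_sides[OF Nc(1) _ vd _ det] cd pos by auto
  then obtain e1 e2 where e12: "e1 > t" "\<And>u. t < u \<Longrightarrow> u < e1 \<Longrightarrow> Fc ((L ! d) u) > 0"
     "e2 < t" "\<And>u. e2 < u \<Longrightarrow> u < t \<Longrightarrow> Fc ((L ! d) u) < 0"
    by (auto simp: eventually_at_right_field eventually_at_left_field)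
  have "((\<lambda>u. s - u) has_vector_derivative - 1) (at 0)"
    by (rule derivative_eq_intros | simp)+
  then have rev: "((\<lambda>u. (L ! c) (s - u)) has_vector_derivative - velocity (L ! c) s) (at 0)"
    using vector_diff_chain_at[of "\<lambda>u. s - u" "-1" 0 "L ! c" "velocity (L ! c) s"] vc
    by (simp add: o_def)
  \<comment> \<open>Strand \<open>c\<close>, traversed backwards, crosses \<open>d\<close> from right to left.\<close>
  have det': "det2 (velocity (L ! d) t) (- velocity (L ! c) s) > 0"
    using det by (simp add: det2_def algebra_simps)
  have "\<forall>\<^sub>F u in at_right 0. Fd ((L ! c) (s - u)) > 0" "\<forall>\<^sub>F u in at_left 0. Fd ((L ! c) (s - u)) < 0"
    using strand_chart_crossing_sides[OF Nd(1) _ rev _ det'] cd pos by auto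
  then obtain e3 e4 where e34: "e3 > 0" "\<And>u. 0 < u \<Longrightarrow> u < e3 \<Longrightarrow> Fd ((L ! c) (s - u)) > 0"
     "e4 < 0" "\<And>u. e4 < u \<Longrightarrow> u < 0 \<Longrightarrow> Fd ((L ! c) (s - u)) < 0"
    by (auto simp: eventually_at_right_field eventually_at_left_field)
  define E where "E = {\<eta>, \<tau>c, \<tau>d, \<sigma>, \<rho>, e1 - t, t - e2, e3, - e4}"
  define \<epsilon> where "\<epsilon> = Min E"
  have "\<forall>x\<in>E. x > 0"
    unfolding E_def using \<open>\<eta> > 0\<close> \<tau>c(1) \<tau>d(1) pos e12(1,3) e34(1,3) by (intro ballI) (elim insertE; simp)
  moreover have E: "finite E" "E \<noteq> {}" by (simp_all add: E_def)
  ultimately have "\<epsilon> > 0" using Min_in[OF E] unfolding \<epsilon>_def by blast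
  have le: "\<epsilon> \<le> x" if "x \<in> E" for x
    unfolding \<epsilon>_def using that E by (intro Min_le)
  have \<epsilon>: "\<epsilon> > 0" "\<epsilon> \<le> \<eta>" "\<epsilon> \<le> \<tau>c" "\<epsilon> \<le> \<tau>d" "\<epsilon> \<le> \<sigma>" "\<epsilon> \<le> \<rho>" "\<epsilon> \<le> e1 - t" "\<epsilon> \<le> t - e2"
    "\<epsilon> \<le> e3" "\<epsilon> \<le> - e4"
    by (fact \<open>\<epsilon> > 0\<close>) (rule le, simp add: E_def)+
  obtain r where r: "r > 0" "\<And>b u. b < length L \<Longrightarrow> (L ! b) u \<in> ball p r \<Longrightarrow>
      \<exists>u'. (L ! b) u' = p \<and> \<bar>u - u'\<bar> < \<epsilon>"
    using nearby_parameters[OF \<epsilon>(1), of p] by blast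
  define N where "N = Nc \<inter> Nd \<inter> ball p r"
  have near: "(b = c \<and> (\<exists>n. \<bar>u - of_int n - s\<bar> < \<epsilon>)) \<or> (b = d \<and> (\<exists>n. \<bar>u - of_int n - t\<bar> < \<epsilon>))"
    if b: "b < length L" "(L ! b) u \<in> N" for b u
  proof -
    obtain u' where u': "(L ! b) u' = p" "\<bar>u - u'\<bar> < \<epsilon>"
      using r(2)[OF b(1), of u] b(2) by (auto simp: N_def)
    have "(b = c \<and> (\<exists>n. u' = s + of_int n)) \<or> (b = d \<and> (\<exists>n. u' = t + of_int n))"
      using transversal_passages(2)[of c d s t b u'] cd det b(1) u'(1) by auto
    then show ?thesis
    proof (elim disjE conjE exE)
      fix n assume "b = c" "u' = s + of_int n"
      then show ?thesis using u'(2) by (intro disjI1 conjI exI[of _ n]) (auto simp: algebra_simps)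
    next
      fix n assume "b = d" "u' = t + of_int n"
      then show ?thesis using u'(2) by (intro disjI2 conjI exI[of _ n]) (auto simp: algebra_simps)
    qed
  qed
  have Fc_right: "Fc ((L ! d) u) > 0" if "t < u" "u < t + \<epsilon>" for u
    using e12(2)[of u] that \<epsilon> by auto
  have Fc_left: "Fc ((L ! d) u) < 0" if "t - \<epsilon> < u" "u < t" for u
    using e12(4)[of u] that \<epsilon> by auto
  have Fd_right: "Fd ((L ! c) u) < 0" if "s < u" "u < s + \<epsilon>" for u
    using e34(4)[of "s - u"] that \<epsilon> by auto
  have Fd_left: "Fd ((L ! c) u) > 0" if "s - \<epsilon> < u" "u < s" for u
    using e34(2)[of "s - u"] that \<epsilon> by auto
  have Fc0: "Fc ((L ! c) u) = 0" if "\<bar>u - s\<bar> < \<epsilon>" for u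
    using strand_chartD(5)[OF Nc(1)] that \<epsilon>(5) by simp
  have Fd0: "Fd ((L ! d) u) = 0" if "\<bar>u - t\<bar> < \<epsilon>" for u
    using strand_chartD(5)[OF Nd(1)] that \<epsilon>(6) by simp
  have shift: "(L ! b) (u - of_int n) = (L ! b) u" if "b < length L" for b u n
    using curve_periodic[OF that, of "u - of_int n" n] by simp
  have pN: "p \<in> N"
    using strand_chartD(4)[OF Nc(1), of s] strand_chartD(4)[OF Nd(1), of t] r(1) cd pos
    by (simp add: N_def)
  show ?thesis
  proof (rule that[of N \<epsilon> Fc Fd])
    show "open N" using strand_chartD(1)[OF Nc(1)] strand_chartD(1)[OF Nd(1)] by (simp add: N_def open_Int)
    show "continuous_on N Fc" "continuous_on N Fd"
      using strand_chartD(3)[OF Nc(1)] strand_chartD(3)[OF Nd(1)]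
      by (auto simp: N_def elim: continuous_on_subset)
    show "N \<subseteq> U" using Nc(2) by (auto simp: N_def)
    show "Fc z \<noteq> 0 \<and> Fd z \<noteq> 0" if "z \<in> N" "z \<notin> trace L" for z
    proof -
      have "z \<notin> range (L ! c)" "z \<notin> range (L ! d)" using that(2) cd(1,2) by (auto simp: trace_iff)
      then show ?thesis
        using that(1) strand_chartD(6)[OF Nc(1), of z] strand_chartD(6)[OF Nd(1), of z] by (auto simp: N_def)
    qed
    show "N \<inter> trace L \<subseteq> (L ! c) ` {s - \<epsilon><..<s + \<epsilon>} \<union> (L ! d) ` {t - \<epsilon><..<t + \<epsilon>}"
    proof
      fix z assume z: "z \<in> N \<inter> trace L"
      then obtain b u where b: "b < length L" "z = (L ! b) u" by (auto simp: trace_iff)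
      consider n where "b = c" "\<bar>u - of_int n - s\<bar> < \<epsilon>" | n where "b = d" "\<bar>u - of_int n - t\<bar> < \<epsilon>"
        using near[OF b(1)] z b(2) by blast
      then show "z \<in> (L ! c) ` {s - \<epsilon><..<s + \<epsilon>} \<union> (L ! d) ` {t - \<epsilon><..<t + \<epsilon>}"
      proof cases
        case (1 n)
        then show ?thesis using shift[OF b(1), of u n] b(2)
          by (intro UnI1 image_eqI[of _ _ "u - of_int n"]) auto
      next
        case (2 n)
        then show ?thesis using shift[OF b(1), of u n] b(2)
          by (intro UnI2 image_eqI[of _ _ "u - of_int n"]) auto
      qed
    qed
    show "N \<inter> crossings L = {p}"
    proof (intro equalityI subsetI)
      fix z assume z: "z \<in> N \<inter> crossings L"
      then obtain b u a v where *: "(b, u) \<in> passages L z" "(a, v) \<in> passages L z" "(b, u) \<noteq> (a, v)"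
        unfolding crossings_def by fast
      then have ba: "b < length L" "a < length L" "(L ! b) u = z" "(L ! a) v = z"
        "0 \<le> u" "u < 1" "0 \<le> v" "v < 1"
        by (auto simp: passages_def)
      have same: False if "b = e" "a = e" "e < length L" "\<bar>u - of_int n - x\<bar> < \<epsilon>" "\<bar>v - of_int m - x\<bar> < \<epsilon>"
        "inj_on (L ! e) {x - \<tau><..<x + \<tau>}" "\<epsilon> \<le> \<tau>" for e n m x \<tau>
      proof -
        have "u - of_int n = v - of_int m"
          using that ba shift by (intro inj_onD[OF that(6)]) auto
        then have "frac u = frac v" by (rule frac_eq_of_shift_eq)
        then show False using ba * that(1,2) by (simp add: frac_eq)
      qed
      have other: "z = p" if "\<bar>u - s\<bar> < \<epsilon>" "\<bar>v - t\<bar> < \<epsilon>" "(L ! c) u = z" "(L ! d) v = z" for u v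
      proof (rule ccontr)
        assume "z \<noteq> p"
        then have "u \<noteq> s" using that cd by auto
        then have "Fd z \<noteq> 0"
          using Fd_left[of u] Fd_right[of u] that by (cases "u < s") auto
        then show False using Fd0[of v] that by simp
      qed
      have uN: "(L ! b) u \<in> N" and vN: "(L ! a) v \<in> N" using ba(3,4) z by auto
      consider n m where "b = c" "a = c" "\<bar>u - of_int n - s\<bar> < \<epsilon>" "\<bar>v - of_int m - s\<bar> < \<epsilon>"
        | n m where "b = d" "a = d" "\<bar>u - of_int n - t\<bar> < \<epsilon>" "\<bar>v - of_int m - t\<bar> < \<epsilon>"
        | n m where "b = c" "a = d" "\<bar>u - of_int n - s\<bar> < \<epsilon>" "\<bar>v - of_int m - t\<bar> < \<epsilon>"
        | n m where "b = d" "a = c" "\<bar>u - of_int n - t\<bar> < \<epsilon>" "\<bar>v - of_int m - s\<bar> < \<epsilon>"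
        using near[OF ba(1) uN] near[OF ba(2) vN] by blast
      then have "z = p"
      proof cases
        case (1 n m)
        then show ?thesis using same[OF 1(1,2) cd(1) 1(3,4) \<tau>c(2) \<epsilon>(3)] by blast
      next
        case (2 n m)
        then show ?thesis using same[OF 2(1,2) cd(2) 2(3,4) \<tau>d(2) \<epsilon>(4)] by blast
      next
        case (3 n m)
        then show ?thesis
          using shift[OF ba(1), of u n] shift[OF ba(2), of v m] ba(3,4) by (intro other[OF 3(3,4)]) auto
      next
        case (4 n m)
        then show ?thesis
          using shift[OF ba(1), of u n] shift[OF ba(2), of v m] ba(3,4) by (intro other[OF 4(4,3)]) auto
      qed
      then show "z \<in> {p}" by simp
    next
      fix z assume "z \<in> {p}"
      then show "z \<in> N \<inter> crossings L"
        using pN transversal_passages(1)[of c d s t] cd det by auto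
    qed
    have c_param: "u \<in> {s - \<sigma><..<s + \<sigma>}" if "\<bar>u - s\<bar> < \<epsilon>" for u
      using that \<epsilon>(5) by auto
    show "\<forall>\<^sub>F h in at_right 0. Fc ((L ! c) u + of_real h * (\<i> * velocity (L ! c) u)) > 0"
         "\<forall>\<^sub>F h in at_right 0. Fc ((L ! c) u - of_real h * (\<i> * velocity (L ! c) u)) < 0"
      if "\<bar>u - s\<bar> < \<epsilon>" for u
      by (rule strand_chart_normal_sides[OF Nc(1) c_param[OF that] velocity_nonzero[OF cd(1)]])+
    have d_param: "u \<in> {t - \<rho><..<t + \<rho>}" if "\<bar>u - t\<bar> < \<epsilon>" for u
      using that \<epsilon>(6) by auto
    show "\<forall>\<^sub>F h in at_right 0. Fd ((L ! d) u + of_real h * (\<i> * velocity (L ! d) u)) > 0"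
         "\<forall>\<^sub>F h in at_right 0. Fd ((L ! d) u - of_real h * (\<i> * velocity (L ! d) u)) < 0"
      if "\<bar>u - t\<bar> < \<epsilon>" for u
      by (rule strand_chart_normal_sides[OF Nd(1) d_param[OF that] velocity_nonzero[OF cd(2)]])+
  qed (fact pN \<epsilon> Fc_left Fc_right Fd_left Fd_right)+
qed

end

section \<open>Locally constant functions with prescribed jumps\<close>

text \<open>The jump condition compares the two sides only along the normal at each simple point. With local
constancy off the link this determines the behavior near the whole strand (\<open>section_flanks\<close>).\<close>

definition jump_section ::
  "(real \<Rightarrow> complex) list \<Rightarrow> 'y set \<Rightarrow> (complex \<Rightarrow> 'y \<Rightarrow> 'y) \<Rightarrow> complex set \<Rightarrow> (complex \<Rightarrow> 'y) \<Rightarrow> bool" where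
  "jump_section L Y J U \<phi> \<longleftrightarrow>
     (\<forall>z\<in>U - trace L. \<phi> z \<in> Y \<and> (\<forall>\<^sub>F z' in nhds z. \<phi> z' = \<phi> z)) \<and>
     (\<forall>p\<in>U \<inter> simple_points L. \<forall>\<^sub>F h in at_right 0.
        \<phi> (p + of_real h * left_normal L p) = J p (\<phi> (p - of_real h * left_normal L p)))"

definition right_value :: "(real \<Rightarrow> complex) list \<Rightarrow> (complex \<Rightarrow> 'y) \<Rightarrow> complex \<Rightarrow> 'y \<Rightarrow> bool" where
  "right_value L \<phi> p r \<longleftrightarrow> (\<forall>\<^sub>F h in at_right 0. \<phi> (p - of_real h * left_normal L p) = r)"

lemma right_value_unique:
  assumes "right_value L \<phi> p r" "right_value L \<phi> p r'"
  shows "r = r'"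
proof -
  have "\<forall>\<^sub>F h in at_right (0::real). r = r'"
    using assms unfolding right_value_def by eventually_elim simp
  then show ?thesis by simp
qed

lemma strand_chart_off_trace:
  assumes "strand_chart \<gamma> t \<tau> N F" "N \<inter> T = \<gamma> ` {t - \<tau><..<t + \<tau>}" "z \<in> N" "F z \<noteq> 0"
  shows "z \<notin> T"
proof
  assume "z \<in> T"
  then obtain u where "z = \<gamma> u" "u \<in> {t - \<tau><..<t + \<tau>}" using assms(2,3) by blast
  then have "F z = 0" using strand_chartD(5)[OF assms(1), of u] by (auto simp: abs_less_iff)
  then show False using assms(4) by simp
qed

lemma eventually_near_along:
  assumes "eventually P (nhds (p::complex))"
  shows "\<forall>\<^sub>F h in at_right (0::real). P (p + of_real h * n) \<and> P (p - of_real h * n)"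
proof -
  have "((\<lambda>h::real. p + of_real h * n) \<longlongrightarrow> p + of_real 0 * n) (at_right 0)"
    "((\<lambda>h::real. p - of_real h * n) \<longlongrightarrow> p - of_real 0 * n) (at_right 0)"
    by (intro tendsto_intros)+
  then have "filterlim (\<lambda>h::real. p + of_real h * n) (nhds p) (at_right 0)"
    "filterlim (\<lambda>h::real. p - of_real h * n) (nhds p) (at_right 0)"
    by simp_all
  then show ?thesis
    using assms by (auto simp: filterlim_iff eventually_conj_iff)
qed

lemma eventually_same_sign:
  fixes F :: "complex \<Rightarrow> real"
  assumes "continuous_on N F" "open N" "z \<in> N" "F z \<noteq> 0"
  shows "\<forall>\<^sub>F z' in nhds z. (F z' > 0) = (F z > 0)"
proof -
  have "isCont F z" using assms continuous_on_eq_continuous_at by blast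
  then have lim: "(F \<longlongrightarrow> F z) (nhds z)"
    unfolding isCont_def by (rule tendsto_at_iff_tendsto_nhds[THEN iffD1])
  show ?thesis
  proof (cases "F z > 0")
    case True
    show ?thesis using order_tendstoD(1)[OF lim True] by eventually_elim (use True in simp)
  next
    case False
    then have "F z < 0" using assms by simp
    show ?thesis using order_tendstoD(2)[OF lim \<open>F z < 0\<close>] by eventually_elim (use False in simp)
  qed
qed

context generic_link
begin

lemma crossings_subset_trace: "crossings L \<subseteq> trace L"
proof
  fix p assume "p \<in> crossings L"
  then obtain c s where "(c, s) \<in> passages L p" unfolding crossings_def by fast
  then show "p \<in> trace L" by (auto simp: passages_def trace_iff)
qed

lemma trace_cases:
  obtains "z \<notin> trace L" | "z \<in> simple_points L" | "z \<in> crossings L"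
  by (auto simp: simple_points_def)

lemma simple_pointE:
  assumes "p \<in> simple_points L"
  obtains c t where "c < length L" "p = (L ! c) t"
  using assms by (auto simp: simple_points_def trace_iff)

lemma eventually_off_trace: "z \<notin> trace L \<Longrightarrow> \<forall>\<^sub>F z' in nhds z. z' \<notin> trace L"
  using closed_trace eventually_nhds_in_open[of "- trace L" z] by (auto simp: open_Compl)

text \<open>Every point has a neighborhood in which it is the only possible crossing, by the charts of the three
kinds of points.\<close>

lemma crossings_isolated: "\<forall>\<^sub>F q in at p. q \<notin> crossings L"
proof (cases p rule: trace_cases)
  case 1
  then have "\<forall>\<^sub>F q in nhds p. q \<notin> crossings L"
    using eventually_off_trace[of p] crossings_subset_trace by (auto elim!: eventually_mono)
  then show ?thesis by (simp add: eventually_at_filter eventually_mono)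
next
  case 2
  then obtain c t where c: "c < length L" "p = (L ! c) t" by (rule simple_pointE)
  have p: "(L ! c) t \<in> simple_points L" using 2 c by simp
  obtain \<tau> N F where "strand_chart (L ! c) t \<tau> N F" "N \<inter> crossings L = {}"
    by (rule simple_chart[OF c(1) p open_UNIV UNIV_I zero_less_one]) (rule that)
  then have "open N" "p \<in> N" using strand_chartD(1,2,4)[of "L ! c" t \<tau> N F] c by auto
  then have "\<forall>\<^sub>F q in nhds p. q \<in> N" by (rule eventually_nhds_in_open)
  then have "\<forall>\<^sub>F q in nhds p. q \<notin> crossings L"
    by eventually_elim (use \<open>N \<inter> crossings L = {}\<close> in blast)
  then show ?thesis by (simp add: eventually_at_filter eventually_mono)
next
  case 3
  then obtain c s d t where *: "c < length L" "d < length L" "(L ! c) s = p" "(L ! d) t = p"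
    "det2 (velocity (L ! c) s) (velocity (L ! d) t) > 0"
    by (rule crossing_strands)
  obtain N where N: "open N" "p \<in> N" "N \<inter> crossings L = {p}"
    by (rule crossing_chart[OF *, of UNIV 1]) auto
  have "\<forall>\<^sub>F q in nhds p. q \<in> N" by (rule eventually_nhds_in_open[OF N(1,2)])
  then have "\<forall>\<^sub>F q in nhds p. q \<noteq> p \<longrightarrow> q \<notin> crossings L"
    by eventually_elim (use N(3) in blast)
  then show ?thesis by (simp add: eventually_at_filter)
qed

lemma connected_minus_crossings:
  assumes "open U" "connected U"
  shows "connected (U - crossings L)"
  using assms crossings_isolated
  by (intro sparse_imp_connected) (auto simp: sparse_in_eventually_iff)

lemma curve_locally_injective:
  assumes "c < length L"
  shows "\<forall>\<^sub>F u in at s. (L ! c) u \<noteq> (L ! c) s"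
proof -
  obtain \<tau> where \<tau>: "\<tau> > 0" "inj_on (L ! c) {s - \<tau><..<s + \<tau>}"
    using strand_chart_exists[OF curve[OF assms], of s] by (elim exE conjE) (rule that)
  have "(L ! c) u \<noteq> (L ! c) s" if "u \<noteq> s" "dist u s < \<tau>" for u
  proof
    assume "(L ! c) u = (L ! c) s"
    then have "u = s"
      by (rule inj_onD[OF \<tau>(2)]) (use that \<tau>(1) in \<open>auto simp: dist_real_def\<close>)
    then show False using that by simp
  qed
  then show ?thesis
    unfolding eventually_at using \<tau>(1) by blast
qed

lemma eventually_simple:
  assumes "c < length L"
  shows "\<forall>\<^sub>F u in at s. (L ! c) u \<in> simple_points L"
proof -
  have "filterlim (L ! c) (at ((L ! c) s)) (at s)"
    unfolding filterlim_at
    using curve_continuous[OF assms, of s] curve_locally_injective[OF assms, of s]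
    by (auto simp: isCont_def)
  then have "\<forall>\<^sub>F u in at s. (L ! c) u \<notin> crossings L"
    using crossings_isolated by (auto simp: filterlim_iff)
  then show ?thesis
    by eventually_elim (use assms in \<open>auto simp: simple_points_def trace_iff\<close>)
qed

lemma eventually_curve_in:
  assumes "c < length L" "open U" "(L ! c) s \<in> U"
  shows "\<forall>\<^sub>F u in nhds s. (L ! c) u \<in> U"
proof -
  have "filterlim (L ! c) (nhds ((L ! c) s)) (nhds s)"
    using curve_continuous[OF assms(1), of s] unfolding isCont_def
    by (rule tendsto_at_iff_tendsto_nhds[THEN iffD1])
  then show ?thesis
    using eventually_nhds_in_open[OF assms(2,3)] by (auto simp: filterlim_iff)
qed

lemma eventually_normal_off_trace:
  assumes "p \<in> simple_points L"
  shows "\<forall>\<^sub>F h in at_right 0. p + of_real h * left_normal L p \<notin> trace L \<and>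
           p - of_real h * left_normal L p \<notin> trace L"
proof -
  obtain c t where c: "c < length L" "p = (L ! c) t" using assms by (rule simple_pointE)
  have p: "(L ! c) t \<in> simple_points L" using assms c by simp
  obtain \<tau> N F where chart: "strand_chart (L ! c) t \<tau> N F" "N \<inter> trace L = (L ! c) ` {t - \<tau><..<t + \<tau>}"
    by (rule simple_chart[OF c(1) p open_UNIV UNIV_I zero_less_one]) (rule that)
  note D = strand_chartD[OF chart(1)]
  have n: "left_normal L p = \<i> * velocity (L ! c) t"
    using left_normal_eq[of c t] c assms by simp
  have "p \<in> N" using D(2) D(4)[of t] c by simp
  then have "\<forall>\<^sub>F z in nhds p. z \<in> N" using D(1) by (intro eventually_nhds_in_open)
  note in_N = eventually_near_along[OF this, of "left_normal L p"]
  have off: "z \<notin> trace L" if "z \<in> N" "F z \<noteq> 0" for z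
    by (rule strand_chart_off_trace[OF chart that])
  have t: "t \<in> {t - \<tau><..<t + \<tau>}" using D(2) by simp
  show ?thesis
    using in_N strand_chart_normal_sides[OF chart(1) t velocity_nonzero[OF c(1)]]
    unfolding n c(2)[symmetric] by eventually_elim (use off in force)
qed

lemma eventually_normal_near:
  assumes p: "p \<in> simple_points L" and "open U" "p \<in> U"
    and P: "\<And>z. z \<in> U \<Longrightarrow> z \<notin> trace L \<Longrightarrow> P z"
  shows "\<forall>\<^sub>F h in at_right 0. P (p + of_real h * left_normal L p) \<and> P (p - of_real h * left_normal L p)"
  using eventually_near_along[OF eventually_nhds_in_open[OF assms(2,3)], of "left_normal L p"]
    eventually_normal_off_trace[OF p]
  by eventually_elim (use P in blast)

lemma off_trace_dense:
  assumes "open U" "z \<in> U"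
  shows "\<exists>z'\<in>U. z' \<notin> trace L"
proof -
  have simple: "\<exists>z'\<in>U. z' \<notin> trace L" if p: "p \<in> simple_points L" "p \<in> U" for p
  proof -
    obtain h :: real where "p + of_real h * left_normal L p \<in> U" "p + of_real h * left_normal L p \<notin> trace L"
      using eventually_happens[OF eventually_conj[OF
          eventually_near_along[OF eventually_nhds_in_open[OF assms(1) p(2)], of "left_normal L p"]
          eventually_normal_off_trace[OF p(1)]]] by auto
    then show ?thesis by blast
  qed
  show ?thesis
  proof (cases z rule: trace_cases)
    case 3
    then have "z \<in> trace L" using crossings_subset_trace by blast
    then obtain c t where c: "c < length L" "(L ! c) t = z" by (auto simp: trace_iff)
    then have "\<forall>\<^sub>F u in at t. (L ! c) u \<in> U"
      using eventually_curve_in[OF c(1) assms(1), of t] assms(2)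
      by (auto simp: eventually_at_filter elim: eventually_mono)
    then have "\<forall>\<^sub>F u in at t. (L ! c) u \<in> U \<and> (L ! c) u \<in> simple_points L"
      using eventually_simple[OF c(1), of t] by (rule eventually_conj)
    then show ?thesis using simple by (auto dest: eventually_happens)
  qed (use assms simple in auto)
qed

end

lemma jump_section_subset: "jump_section L Y J U \<phi> \<Longrightarrow> V \<subseteq> U \<Longrightarrow> jump_section L Y J V \<phi>"
  unfolding jump_section_def by blast

lemma jump_section_Un:
  "jump_section L Y J U \<phi> \<Longrightarrow> jump_section L Y J V \<phi> \<Longrightarrow> jump_section L Y J (U \<union> V) \<phi>"
  unfolding jump_section_def by blast

text \<open>The conditions under which a rule for crossing edges is locally consistent. In \<open>compatible\<close>,
\<open>A\<close>, \<open>A'\<close> are the jumps of the strand \<open>c\<close> before and after the crossing, and \<open>B\<close>, \<open>B'\<close> those of \<open>d\<close>. From the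
sector to the right of both strands one reaches the sector to the left of both either behind the crossing,
through incoming \<open>d\<close> and incoming \<open>c\<close>, or in front of it, through outgoing \<open>c\<close> and outgoing \<open>d\<close>.\<close>

locale jump_system = generic_link +
  fixes Y :: "'y set" and J :: "complex \<Rightarrow> 'y \<Rightarrow> 'y"
  assumes bij: "p \<in> simple_points L \<Longrightarrow> bij_betw (J p) Y Y"
    and locally_constant: "c < length L \<Longrightarrow> (L ! c) t \<in> simple_points L \<Longrightarrow>
      \<forall>\<^sub>F u in nhds t. J ((L ! c) u) = J ((L ! c) t)"
    and compatible: "c < length L \<Longrightarrow> d < length L \<Longrightarrow> (L ! c) s = (L ! d) t \<Longrightarrow>
      det2 (velocity (L ! c) s) (velocity (L ! d) t) > 0 \<Longrightarrow>
      \<exists>A A' B B'. (\<forall>\<^sub>F u in at_left s. J ((L ! c) u) = A) \<and> (\<forall>\<^sub>F u in at_right s. J ((L ! c) u) = A') \<and>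
        (\<forall>\<^sub>F u in at_left t. J ((L ! d) u) = B) \<and> (\<forall>\<^sub>F u in at_right t. J ((L ! d) u) = B') \<and>
        (\<forall>y\<in>Y. A (B y) = B' (A' y))"
begin

abbreviation "section_on U \<phi> \<equiv> jump_section L Y J U \<phi>"

text \<open>Both conditions look at values off the link, and only near a given point.\<close>

lemma section_cong:
  assumes \<phi>: "section_on U \<phi>" and "open U"
    and eq: "\<And>z. z \<in> U \<Longrightarrow> z \<notin> trace L \<Longrightarrow> \<theta> z = \<phi> z"
  shows "section_on U \<theta>"
  unfolding jump_section_def
proof (intro conjI ballI)
  fix z assume z: "z \<in> U - trace L"
  then show "\<theta> z \<in> Y" using \<phi> eq unfolding jump_section_def by auto
  have "\<forall>\<^sub>F z' in nhds z. \<phi> z' = \<phi> z" using \<phi> z unfolding jump_section_def by blast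
  moreover have "\<forall>\<^sub>F z' in nhds z. z' \<in> U"
    using z \<open>open U\<close> by (intro eventually_nhds_in_open) auto
  moreover have "\<forall>\<^sub>F z' in nhds z. z' \<notin> trace L" using z by (intro eventually_off_trace) auto
  ultimately show "\<forall>\<^sub>F z' in nhds z. \<theta> z' = \<theta> z"
    by eventually_elim (use eq z in auto)
next
  fix p assume p: "p \<in> U \<inter> simple_points L"
  have "\<forall>\<^sub>F h in at_right 0. \<phi> (p + of_real h * left_normal L p) = J p (\<phi> (p - of_real h * left_normal L p))"
    using \<phi> p unfolding jump_section_def by blast
  moreover have "\<forall>\<^sub>F h in at_right 0. \<theta> (p + of_real h * left_normal L p) = \<phi> (p + of_real h * left_normal L p)
      \<and> \<theta> (p - of_real h * left_normal L p) = \<phi> (p - of_real h * left_normal L p)"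
    by (rule eventually_normal_near[where P = "\<lambda>z. \<theta> z = \<phi> z" and U = U]) (use p \<open>open U\<close> eq in auto)
  ultimately show "\<forall>\<^sub>F h in at_right 0.
      \<theta> (p + of_real h * left_normal L p) = J p (\<theta> (p - of_real h * left_normal L p))"
    by eventually_elim simp
qed

text \<open>Both sides of a strand are connected, so a section has one value on each of them, and the jump condition
at the center relates the two values.\<close>

lemma section_flanks:
  assumes \<phi>: "section_on U \<phi>" and c: "c < length L" and p: "(L ! c) t \<in> simple_points L"
    and chart: "strand_chart (L ! c) t \<tau> N F" "N \<subseteq> U" "N \<inter> trace L = (L ! c) ` {t - \<tau><..<t + \<tau>}"
  obtains r where "r \<in> Y" "\<And>z. z \<in> N \<Longrightarrow> F z < 0 \<Longrightarrow> \<phi> z = r"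
    "\<And>z. z \<in> N \<Longrightarrow> F z > 0 \<Longrightarrow> \<phi> z = J ((L ! c) t) r"
proof -
  let ?p = "(L ! c) t"
  note D = strand_chartD[OF chart(1)]
  have t: "t \<in> {t - \<tau><..<t + \<tau>}" using D(2) by simp
  have pN: "?p \<in> N" using D(2) D(4)[of t] by simp
  have off: "z \<notin> trace L" if "z \<in> N" "F z \<noteq> 0" for z
    by (rule strand_chart_off_trace[OF chart(1,3) that])
  have const: "\<phi> x = \<phi> y" if "connected S" "S \<subseteq> N" "\<And>z. z \<in> S \<Longrightarrow> F z \<noteq> 0" "x \<in> S" "y \<in> S" for S x y
  proof (rule connected_induction_simple[OF that(1,4,5), where P = "\<lambda>z. \<phi> x = \<phi> z"])
    fix a assume a: "a \<in> S"
    then have "a \<in> U - trace L" using that off chart(2) by blast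
    then have "\<forall>\<^sub>F z in nhds a. \<phi> z = \<phi> a" using \<phi> unfolding jump_section_def by blast
    then obtain T where T: "open T" "a \<in> T" "\<forall>z\<in>T. \<phi> z = \<phi> a"
      unfolding eventually_nhds by blast
    show "\<exists>T. openin (top_of_set S) T \<and> a \<in> T \<and> (\<forall>y\<in>T. \<forall>z\<in>T. \<phi> x = \<phi> y \<longrightarrow> \<phi> x = \<phi> z)"
    proof (intro exI[of _ "S \<inter> T"] conjI ballI impI)
      show "\<phi> x = \<phi> z" if "y \<in> S \<inter> T" "z \<in> S \<inter> T" "\<phi> x = \<phi> y" for y z
        using that T(3) by (metis IntD2)
    qed (use a T in \<open>auto simp: openin_open_Int\<close>)
  qed simp
  have n: "left_normal L ?p = \<i> * velocity (L ! c) t"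
    by (rule left_normal_eq[OF c p])
  have "\<forall>\<^sub>F z in nhds ?p. z \<in> N" by (rule eventually_nhds_in_open[OF D(1) pN])
  note in_N = eventually_near_along[OF this, of "left_normal L ?p"]
  have jump: "\<forall>\<^sub>F h in at_right 0.
      \<phi> (?p + of_real h * left_normal L ?p) = J ?p (\<phi> (?p - of_real h * left_normal L ?p))"
    using \<phi> pN chart(2) p unfolding jump_section_def by blast
  let ?x = "\<lambda>h::real. ?p - of_real h * left_normal L ?p" and ?y = "\<lambda>h::real. ?p + of_real h * left_normal L ?p"
  have "\<forall>\<^sub>F h in at_right 0. ?x h \<in> N \<and> ?y h \<in> N \<and> F (?x h) < 0 \<and> F (?y h) > 0 \<and> \<phi> (?y h) = J ?p (\<phi> (?x h))"
    using in_N jump strand_chart_normal_sides[OF chart(1) t velocity_nonzero[OF c]]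
    unfolding n by eventually_elim blast
  then obtain x y where xy: "x \<in> N" "y \<in> N" "F x < 0" "F y > 0" "\<phi> y = J ?p (\<phi> x)"
    using eventually_happens[of _ "at_right (0::real)"] by force
  show ?thesis
  proof (rule that)
    have "x \<in> U - trace L" using xy off[of x] chart(2) by auto
    then show "\<phi> x \<in> Y" using \<phi> unfolding jump_section_def by blast
    show "\<phi> z = \<phi> x" if "z \<in> N" "F z < 0" for z
      by (rule const[OF D(8)]) (use that xy in auto)
    show "\<phi> z = J ?p (\<phi> x)" if "z \<in> N" "F z > 0" for z
      unfolding xy(5)[symmetric] by (rule const[OF D(7)]) (use that xy in auto)
  qed
qed

text \<open>Crossings are deleted from \<open>U\<close>, which leaves it connected. Then equality spreads over each chart: inside a
chart a section is determined by its value on either side, because jumps are injective.\<close>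

lemma section_unique:
  assumes U: "open U" "connected U" and \<phi>: "section_on U \<phi>" and \<psi>: "section_on U \<psi>"
    and q: "q \<in> U" "q \<notin> trace L" "\<phi> q = \<psi> q" and z: "z \<in> U" "z \<notin> trace L"
  shows "\<phi> z = \<psi> z"
proof (rule connected_induction[OF connected_minus_crossings[OF U],
      where P = "\<lambda>z. z \<notin> trace L" and Q = "\<lambda>z. \<phi> z = \<psi> z"])
  fix T a assume T: "openin (top_of_set (U - crossings L)) T" and a: "a \<in> T"
  then obtain V where V: "open V" "T = (U - crossings L) \<inter> V" by (auto simp: openin_open)
  then obtain z where "z \<in> U \<inter> V" "z \<notin> trace L"
    using off_trace_dense[of "U \<inter> V" a] a U(1) by auto
  then show "\<exists>z. z \<in> T \<and> z \<notin> trace L" using V crossings_subset_trace by blast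
next
  fix a assume a: "a \<in> U - crossings L"
  show "\<exists>T. openin (top_of_set (U - crossings L)) T \<and> a \<in> T \<and>
      (\<forall>x\<in>T. \<forall>y\<in>T. x \<notin> trace L \<and> y \<notin> trace L \<and> \<phi> x = \<psi> x \<longrightarrow> \<phi> y = \<psi> y)"
  proof (cases "a \<in> trace L")
    case False
    then have "\<forall>\<^sub>F z in nhds a. \<phi> z = \<phi> a" "\<forall>\<^sub>F z in nhds a. \<psi> z = \<psi> a"
      using \<phi> \<psi> a unfolding jump_section_def by blast+
    then have "\<forall>\<^sub>F z in nhds a. \<phi> z = \<phi> a \<and> \<psi> z = \<psi> a" by (rule eventually_conj)
    then obtain T where T: "open T" "a \<in> T" "\<And>z. z \<in> T \<Longrightarrow> \<phi> z = \<phi> a \<and> \<psi> z = \<psi> a"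
      unfolding eventually_nhds by blast
    show ?thesis
    proof (intro exI[of _ "(U - crossings L) \<inter> T"] conjI ballI impI)
      show "\<phi> y = \<psi> y"
        if "x \<in> (U - crossings L) \<inter> T" "y \<in> (U - crossings L) \<inter> T"
          "x \<notin> trace L \<and> y \<notin> trace L \<and> \<phi> x = \<psi> x" for x y
        using that T(3)[of x] T(3)[of y] by simp
    qed (use a T(1,2) in \<open>auto simp: openin_open_Int\<close>)
  next
    case True
    then have s: "a \<in> simple_points L" using a by (simp add: simple_points_def)
    then obtain c t where c: "c < length L" "a = (L ! c) t" by (rule simple_pointE)
    have p: "(L ! c) t \<in> simple_points L" "(L ! c) t \<in> U" using s c a by auto
    obtain \<tau> N F where N: "strand_chart (L ! c) t \<tau> N F" "N \<subseteq> U"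
      "N \<inter> trace L = (L ! c) ` {t - \<tau><..<t + \<tau>}" "N \<inter> crossings L = {}"
      by (rule simple_chart[OF c(1) p(1) U(1) p(2) zero_less_one])
    note D = strand_chartD[OF N(1)]
    obtain r where r: "r \<in> Y" "\<And>z. z \<in> N \<Longrightarrow> F z < 0 \<Longrightarrow> \<phi> z = r"
      "\<And>z. z \<in> N \<Longrightarrow> F z > 0 \<Longrightarrow> \<phi> z = J ((L ! c) t) r"
      by (rule section_flanks[OF \<phi> c(1) p(1) N(1-3)]) (rule that)
    obtain r' where r': "r' \<in> Y" "\<And>z. z \<in> N \<Longrightarrow> F z < 0 \<Longrightarrow> \<psi> z = r'"
      "\<And>z. z \<in> N \<Longrightarrow> F z > 0 \<Longrightarrow> \<psi> z = J ((L ! c) t) r'"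
      by (rule section_flanks[OF \<psi> c(1) p(1) N(1-3)]) (rule that)
    have sides: "F z < 0 \<or> F z > 0" if "z \<in> N" "z \<notin> trace L" for z
      using D(6)[OF that(1)] that(2) c(1) by (force simp: trace_iff)
    have inj: "J ((L ! c) t) r = J ((L ! c) t) r' \<Longrightarrow> r = r'"
      using bij[OF p(1)] r(1) r'(1) by (auto simp: bij_betw_def inj_on_def)
    have step: "\<phi> y = \<psi> y" if x: "x \<in> N" "x \<notin> trace L" "\<phi> x = \<psi> x" and y: "y \<in> N" "y \<notin> trace L" for x y
    proof -
      have "r = r'"
        using sides[OF x(1,2)] r(2,3)[OF x(1)] r'(2,3)[OF x(1)] x(3) inj by metis
      then show ?thesis using sides[OF y] r(2,3)[OF y(1)] r'(2,3)[OF y(1)] by metis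
    qed
    have "N = (U - crossings L) \<inter> N" using N by blast
    then have "openin (top_of_set (U - crossings L)) N"
      using D(1) by (metis openin_open_Int)
    moreover have "a \<in> N" using D(2) D(4)[of t] c by simp
    ultimately show ?thesis using step by blast
  qed
qed (use q z crossings_subset_trace in auto)

text \<open>The right value of a section is a function of the strand that is locally constant away from the
crossings.\<close>

lemma right_value_exists:
  assumes \<phi>: "section_on U \<phi>" and U: "open U" and c: "c < length L"
    and p: "(L ! c) t \<in> simple_points L" "(L ! c) t \<in> U"
  obtains r where "r \<in> Y" "\<forall>\<^sub>F u in nhds t. right_value L \<phi> ((L ! c) u) r"
proof -
  obtain \<tau> N F where N: "strand_chart (L ! c) t \<tau> N F" "N \<subseteq> U"
    "N \<inter> trace L = (L ! c) ` {t - \<tau><..<t + \<tau>}" "N \<inter> crossings L = {}"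
    by (rule simple_chart[OF c p(1) U p(2) zero_less_one])
  note D = strand_chartD[OF N(1)]
  obtain r where r: "r \<in> Y" "\<And>z. z \<in> N \<Longrightarrow> F z < 0 \<Longrightarrow> \<phi> z = r"
    by (rule section_flanks[OF \<phi> c p(1) N(1-3)]) (rule that)
  have "right_value L \<phi> ((L ! c) u) r" if u: "u \<in> {t - \<tau><..<t + \<tau>}" for u
  proof -
    have uN: "(L ! c) u \<in> N" using D(4)[of u] u by auto
    then have s: "(L ! c) u \<in> simple_points L"
      using N(4) c by (auto simp: simple_points_def trace_iff)
    have "\<forall>\<^sub>F z in nhds ((L ! c) u). z \<in> N" by (rule eventually_nhds_in_open[OF D(1) uN])
    note in_N = eventually_near_along[OF this, of "left_normal L ((L ! c) u)"]
    show ?thesis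
      using in_N strand_chart_normal_sides(2)[OF N(1) u velocity_nonzero[OF c]]
      unfolding right_value_def left_normal_eq[OF c s] by eventually_elim (use r(2) in blast)
  qed
  moreover have "\<forall>\<^sub>F u in nhds t. u \<in> {t - \<tau><..<t + \<tau>}"
    using D(2) by (intro eventually_nhds_in_open) auto
  ultimately have "\<forall>\<^sub>F u in nhds t. right_value L \<phi> ((L ! c) u) r"
    by (auto elim: eventually_mono)
  then show ?thesis using r(1) by (rule that[rotated])
qed

end

section \<open>Existence of sections on rectangles\<close>

definition rect :: "real \<Rightarrow> real \<Rightarrow> real \<Rightarrow> real \<Rightarrow> complex set" where
  "rect a b c d = box (Complex a c) (Complex b d)"

lemma rect_iff: "z \<in> rect a b c d \<longleftrightarrow> a < Re z \<and> Re z < b \<and> c < Im z \<and> Im z < d"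
  by (auto simp: rect_def in_box_complex_iff)

context jump_system
begin

text \<open>The limit of the jumps at a crossing is attained at simple points nearby, so it is bijective like them.\<close>

lemma limit_bij:
  assumes c: "c < length L" and J: "\<forall>\<^sub>F u in G. J ((L ! c) u) = A" and G: "G \<le> at s" "G \<noteq> bot"
  shows "bij_betw A Y Y"
proof -
  have "\<forall>\<^sub>F u in G. (L ! c) u \<in> simple_points L"
    using filter_leD[OF G(1) eventually_simple[OF c]] .
  then have "\<forall>\<^sub>F u in G. (L ! c) u \<in> simple_points L \<and> J ((L ! c) u) = A"
    using J by (rule eventually_conj)
  then obtain u where "(L ! c) u \<in> simple_points L" "J ((L ! c) u) = A"
    using eventually_happens'[OF G(2)] by blast
  then show ?thesis using bij by metis
qed

text \<open>One section \<open>\<psi> e\<close> for each value \<open>e\<close> in the sector to the right of both strands. It is given by a table over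
the signs of \<open>Fc\<close> and \<open>Fd\<close>, and the compatibility condition is what makes the entry for the sector to the left
of both strands fit to both neighbors. The last four conclusions read the values to the right of the
four half-strands off the table.\<close>

lemma crossing_model:
  assumes cd: "c < length L" "d < length L" "(L ! c) s = p" "(L ! d) t = p"
    and det: "det2 (velocity (L ! c) s) (velocity (L ! d) t) > 0"
    and U: "open U" "p \<in> U"
    and A: "\<forall>\<^sub>F u in at_left s. J ((L ! c) u) = A" and A': "\<forall>\<^sub>F u in at_right s. J ((L ! c) u) = A'"
    and B: "\<forall>\<^sub>F u in at_left t. J ((L ! d) u) = B" and B': "\<forall>\<^sub>F u in at_right t. J ((L ! d) u) = B'"
    and AB: "\<forall>y\<in>Y. A (B y) = B' (A' y)"
  obtains N \<psi> where "open N" "p \<in> N" "N \<subseteq> U"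
    "\<And>e. e \<in> Y \<Longrightarrow> section_on N (\<psi> e)"
    "\<And>q y. q \<in> N \<Longrightarrow> q \<notin> trace L \<Longrightarrow> y \<in> Y \<Longrightarrow> \<exists>e\<in>Y. \<psi> e q = y"
    "\<And>e. e \<in> Y \<Longrightarrow> \<forall>\<^sub>F u in at_left s. right_value L (\<psi> e) ((L ! c) u) (B e)"
    "\<And>e. e \<in> Y \<Longrightarrow> \<forall>\<^sub>F u in at_right s. right_value L (\<psi> e) ((L ! c) u) e"
    "\<And>e. e \<in> Y \<Longrightarrow> \<forall>\<^sub>F u in at_left t. right_value L (\<psi> e) ((L ! d) u) e"
    "\<And>e. e \<in> Y \<Longrightarrow> \<forall>\<^sub>F u in at_right t. right_value L (\<psi> e) ((L ! d) u) (A' e)"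
proof -
  have bijA: "bij_betw A Y Y" and bijA': "bij_betw A' Y Y" and bijB: "bij_betw B Y Y"
    using limit_bij[OF cd(1) A, of s] limit_bij[OF cd(1) A', of s] limit_bij[OF cd(2) B, of t]
    by (simp_all add: at_le)
  obtain a1 a2 b1 b2 where ab: "a1 < s" "\<forall>u>a1. u < s \<longrightarrow> J ((L ! c) u) = A"
    "a2 > s" "\<forall>u>s. u < a2 \<longrightarrow> J ((L ! c) u) = A'"
    "b1 < t" "\<forall>u>b1. u < t \<longrightarrow> J ((L ! d) u) = B"
    "b2 > t" "\<forall>u>t. u < b2 \<longrightarrow> J ((L ! d) u) = B'"
    using A A' B B' unfolding eventually_at_left_field eventually_at_right_field by blast
  define \<eta> where "\<eta> = min (min (s - a1) (a2 - s)) (min (t - b1) (b2 - t))"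
  have "\<eta> > 0" using ab(1,3,5,7) by (simp add: \<eta>_def)
  obtain N \<epsilon> and Fc Fd :: "complex \<Rightarrow> real" where N: "open N" "p \<in> N" "N \<subseteq> U" "0 < \<epsilon>" "\<epsilon> \<le> \<eta>"
    and F: "continuous_on N Fc" "continuous_on N Fd"
      "\<And>z. z \<in> N \<Longrightarrow> z \<notin> trace L \<Longrightarrow> Fc z \<noteq> 0 \<and> Fd z \<noteq> 0"
    and strands: "N \<inter> trace L \<subseteq> (L ! c) ` {s - \<epsilon><..<s + \<epsilon>} \<union> (L ! d) ` {t - \<epsilon><..<t + \<epsilon>}"
    and cr: "N \<inter> crossings L = {p}"
    and Fd_c: "\<And>u. s < u \<Longrightarrow> u < s + \<epsilon> \<Longrightarrow> Fd ((L ! c) u) < 0"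
      "\<And>u. s - \<epsilon> < u \<Longrightarrow> u < s \<Longrightarrow> Fd ((L ! c) u) > 0"
    and Fc_d: "\<And>u. t < u \<Longrightarrow> u < t + \<epsilon> \<Longrightarrow> Fc ((L ! d) u) > 0"
      "\<And>u. t - \<epsilon> < u \<Longrightarrow> u < t \<Longrightarrow> Fc ((L ! d) u) < 0"
    and normals: "\<And>u. \<bar>u - s\<bar> < \<epsilon> \<Longrightarrow> \<forall>\<^sub>F h in at_right 0. Fc ((L ! c) u + of_real h * (\<i> * velocity (L ! c) u)) > 0"
      "\<And>u. \<bar>u - s\<bar> < \<epsilon> \<Longrightarrow> \<forall>\<^sub>F h in at_right 0. Fc ((L ! c) u - of_real h * (\<i> * velocity (L ! c) u)) < 0"
      "\<And>u. \<bar>u - t\<bar> < \<epsilon> \<Longrightarrow> \<forall>\<^sub>F h in at_right 0. Fd ((L ! d) u + of_real h * (\<i> * velocity (L ! d) u)) > 0"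
      "\<And>u. \<bar>u - t\<bar> < \<epsilon> \<Longrightarrow> \<forall>\<^sub>F h in at_right 0. Fd ((L ! d) u - of_real h * (\<i> * velocity (L ! d) u)) < 0"
    by (rule crossing_chart[OF cd det U \<open>\<eta> > 0\<close>]) (rule that)
  define \<psi> where "\<psi> e z =
    (if Fc z > 0 then if Fd z > 0 then A (B e) else A' e else if Fd z > 0 then B e else e)" for e z
  have JA: "J ((L ! c) u) = A" if "s - \<epsilon> < u" "u < s" for u
    using ab(2) that N(5) by (simp add: \<eta>_def)
  have JA': "J ((L ! c) u) = A'" if "s < u" "u < s + \<epsilon>" for u
    using ab(4) that N(5) by (simp add: \<eta>_def)
  have JB: "J ((L ! d) u) = B" if "t - \<epsilon> < u" "u < t" for u
    using ab(6) that N(5) by (simp add: \<eta>_def)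
  have JB': "J ((L ! d) u) = B'" if "t < u" "u < t + \<epsilon>" for u
    using ab(8) that N(5) by (simp add: \<eta>_def)
  have c_sides: "\<forall>\<^sub>F h in at_right 0. 
      (Fd ((L ! c) u + of_real h * left_normal L ((L ! c) u)) > 0) = (u < s) \<and>
      (Fd ((L ! c) u - of_real h * left_normal L ((L ! c) u)) > 0) = (u < s) \<and>
      Fc ((L ! c) u + of_real h * left_normal L ((L ! c) u)) > 0 \<and>
      Fc ((L ! c) u - of_real h * left_normal L ((L ! c) u)) < 0"
    if u: "\<bar>u - s\<bar> < \<epsilon>" "u \<noteq> s" "(L ! c) u \<in> N" "(L ! c) u \<in> simple_points L" for u
  proof -
    have nz: "Fd ((L ! c) u) \<noteq> 0" "(Fd ((L ! c) u) > 0) = (u < s)"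
      using Fd_c(1)[of u] Fd_c(2)[of u] u(1,2) by (cases "u < s"; simp)+
    note n = left_normal_eq[OF cd(1) u(4)]
    show ?thesis
      using eventually_near_along[OF eventually_same_sign[OF F(2) N(1) u(3) nz(1)],
          of "left_normal L ((L ! c) u)"] normals(1,2)[OF u(1)]
      unfolding nz(2) n by eventually_elim blast
  qed
  have d_sides: "\<forall>\<^sub>F h in at_right 0. 
      (Fc ((L ! d) u + of_real h * left_normal L ((L ! d) u)) > 0) = (t < u) \<and>
      (Fc ((L ! d) u - of_real h * left_normal L ((L ! d) u)) > 0) = (t < u) \<and>
      Fd ((L ! d) u + of_real h * left_normal L ((L ! d) u)) > 0 \<and>
      Fd ((L ! d) u - of_real h * left_normal L ((L ! d) u)) < 0"
    if u: "\<bar>u - t\<bar> < \<epsilon>" "u \<noteq> t" "(L ! d) u \<in> N" "(L ! d) u \<in> simple_points L" for u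
  proof -
    have nz: "Fc ((L ! d) u) \<noteq> 0" "(Fc ((L ! d) u) > 0) = (t < u)"
      using Fc_d(1)[of u] Fc_d(2)[of u] u(1,2) by (cases "t < u"; simp)+
    note n = left_normal_eq[OF cd(2) u(4)]
    show ?thesis
      using eventually_near_along[OF eventually_same_sign[OF F(1) N(1) u(3) nz(1)],
          of "left_normal L ((L ! d) u)"] normals(3,4)[OF u(1)]
      unfolding nz(2) n by eventually_elim blast
  qed
  have near_c: "\<forall>\<^sub>F u in at s. \<bar>u - s\<bar> < \<epsilon> \<and> u \<noteq> s \<and> (L ! c) u \<in> N \<and> (L ! c) u \<in> simple_points L"
  proof -
    have "\<forall>\<^sub>F u in nhds s. u \<in> {s - \<epsilon><..<s + \<epsilon>}" 
      using N(4) by (intro eventually_nhds_in_open) auto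
    moreover have "\<forall>\<^sub>F u in nhds s. (L ! c) u \<in> N"
      using N(1,2) cd by (intro eventually_curve_in) auto
    moreover have "\<forall>\<^sub>F u in nhds s. u \<noteq> s \<longrightarrow> (L ! c) u \<in> simple_points L"
      using eventually_simple[OF cd(1), of s] by (simp add: eventually_at_filter)
    ultimately show ?thesis
      unfolding eventually_at_filter by eventually_elim (auto simp: abs_less_iff)
  qed
  have near_d: "\<forall>\<^sub>F u in at t. \<bar>u - t\<bar> < \<epsilon> \<and> u \<noteq> t \<and> (L ! d) u \<in> N \<and> (L ! d) u \<in> simple_points L"
  proof -
    have "\<forall>\<^sub>F u in nhds t. u \<in> {t - \<epsilon><..<t + \<epsilon>}" 
      using N(4) by (intro eventually_nhds_in_open) auto
    moreover have "\<forall>\<^sub>F u in nhds t. (L ! d) u \<in> N"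
      using N(1,2) cd by (intro eventually_curve_in) auto
    moreover have "\<forall>\<^sub>F u in nhds t. u \<noteq> t \<longrightarrow> (L ! d) u \<in> simple_points L"
      using eventually_simple[OF cd(2), of t] by (simp add: eventually_at_filter)
    ultimately show ?thesis
      unfolding eventually_at_filter by eventually_elim (auto simp: abs_less_iff)
  qed
  have left_right: "at_left x \<le> at x" "at_right x \<le> at x" for x :: real
    by (simp_all add: at_le)
  have strict: "\<forall>\<^sub>F u in at_left x. u < x" "\<forall>\<^sub>F u in at_right x. u > x" for x :: real
    by (auto simp: eventually_at_filter)
  show ?thesis
  proof (rule that[of N \<psi>])
    fix e assume e: "e \<in> Y"
    have "B e \<in> Y" "A' e \<in> Y" using bijB bijA' e by (auto simp: bij_betw_def)
    then have "A (B e) \<in> Y" using bijA by (auto simp: bij_betw_def)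
    show "section_on N (\<psi> e)"
      unfolding jump_section_def
    proof (intro conjI ballI)
      fix z assume z: "z \<in> N - trace L"
      show "\<psi> e z \<in> Y"
        using e \<open>B e \<in> Y\<close> \<open>A' e \<in> Y\<close> \<open>A (B e) \<in> Y\<close> by (simp add: \<psi>_def)
      have "Fc z \<noteq> 0" "Fd z \<noteq> 0" using F(3) z by auto
      then have "\<forall>\<^sub>F z' in nhds z. (Fc z' > 0) = (Fc z > 0)" "\<forall>\<^sub>F z' in nhds z. (Fd z' > 0) = (Fd z > 0)"
        using z N(1) F(1,2) by (auto intro!: eventually_same_sign)
      then show "\<forall>\<^sub>F z' in nhds z. \<psi> e z' = \<psi> e z"
        by eventually_elim (simp add: \<psi>_def)
    next
      fix q assume q: "q \<in> N \<inter> simple_points L"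
      then have "q \<noteq> p" using cr by (auto simp: simple_points_def)
      consider u where "q = (L ! c) u" "\<bar>u - s\<bar> < \<epsilon>" | u where "q = (L ! d) u" "\<bar>u - t\<bar> < \<epsilon>"
        using q strands by (auto simp: simple_points_def abs_less_iff)
      then show "\<forall>\<^sub>F h in at_right 0. \<psi> e (q + of_real h * left_normal L q) =
          J q (\<psi> e (q - of_real h * left_normal L q))"
      proof cases
        case (1 u)
        then have u: "u \<noteq> s" "(L ! c) u \<in> N" "(L ! c) u \<in> simple_points L"
          using q \<open>q \<noteq> p\<close> cd by auto
        have J: "J q = (if u < s then A else A')" using JA[of u] JA'[of u] 1 u(1) by auto
        show ?thesis
          using c_sides[OF 1(2) u] unfolding J 1(1)[symmetric]
          by eventually_elim (auto simp: \<psi>_def)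
      next
        case (2 u)
        then have u: "u \<noteq> t" "(L ! d) u \<in> N" "(L ! d) u \<in> simple_points L"
          using q \<open>q \<noteq> p\<close> cd by auto
        have J: "J q = (if t < u then B' else B)" using JB[of u] JB'[of u] 2 u(1) by auto
        show ?thesis
          using d_sides[OF 2(2) u] unfolding J 2(1)[symmetric]
          by eventually_elim (use AB e in \<open>auto simp: \<psi>_def\<close>)
      qed
    qed
    show "\<forall>\<^sub>F u in at_left s. right_value L (\<psi> e) ((L ! c) u) (B e)"
      using strict(1) filter_leD[OF left_right(1) near_c]
    proof eventually_elim
      case (elim u)
      then have u: "\<bar>u - s\<bar> < \<epsilon>" "u \<noteq> s" "(L ! c) u \<in> N" "(L ! c) u \<in> simple_points L" by auto
      show ?case
        unfolding right_value_def using c_sides[OF u] by eventually_elim (use elim in \<open>auto simp: \<psi>_def\<close>)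
    qed
    show "\<forall>\<^sub>F u in at_right s. right_value L (\<psi> e) ((L ! c) u) e"
      using strict(2) filter_leD[OF left_right(2) near_c]
    proof eventually_elim
      case (elim u)
      then have u: "\<bar>u - s\<bar> < \<epsilon>" "u \<noteq> s" "(L ! c) u \<in> N" "(L ! c) u \<in> simple_points L" by auto
      show ?case
        unfolding right_value_def using c_sides[OF u] by eventually_elim (use elim in \<open>auto simp: \<psi>_def\<close>)
    qed
    show "\<forall>\<^sub>F u in at_left t. right_value L (\<psi> e) ((L ! d) u) e"
      using strict(1) filter_leD[OF left_right(1) near_d]
    proof eventually_elim
      case (elim u)
      then have u: "\<bar>u - t\<bar> < \<epsilon>" "u \<noteq> t" "(L ! d) u \<in> N" "(L ! d) u \<in> simple_points L" by auto
      show ?case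
        unfolding right_value_def using d_sides[OF u] by eventually_elim (use elim in \<open>auto simp: \<psi>_def\<close>)
    qed
    show "\<forall>\<^sub>F u in at_right t. right_value L (\<psi> e) ((L ! d) u) (A' e)"
      using strict(2) filter_leD[OF left_right(2) near_d]
    proof eventually_elim
      case (elim u)
      then have u: "\<bar>u - t\<bar> < \<epsilon>" "u \<noteq> t" "(L ! d) u \<in> N" "(L ! d) u \<in> simple_points L" by auto
      show ?case
        unfolding right_value_def using d_sides[OF u] by eventually_elim (use elim in \<open>auto simp: \<psi>_def\<close>)
    qed
  next
    fix q y assume q: "y \<in> Y"
    have onto: "\<exists>x\<in>Y. G x = y" if "bij_betw G Y Y" "y \<in> Y" for G y
      using that by (metis bij_betw_imp_surj_on imageE)
    obtain x where "x \<in> Y" "A x = y" using onto[OF bijA q] by blast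
    moreover obtain x' where "x' \<in> Y" "B x' = x" using onto[OF bijB \<open>x \<in> Y\<close>] by blast
    moreover obtain w where "w \<in> Y" "A' w = y" using onto[OF bijA' q] by blast
    moreover obtain v where "v \<in> Y" "B v = y" using onto[OF bijB q] by blast
    ultimately show "\<exists>e\<in>Y. \<psi> e q = y"
      using q by (cases "Fc q > 0"; cases "Fd q > 0") (auto simp: \<psi>_def)
  qed (use N in auto)
qed

text \<open>In this form the property is inherited by subsets and can be glued. Connectedness is not built in, so that
the neighborhoods need no particular shape.\<close>

definition extendable :: "complex set \<Rightarrow> bool" where
  "extendable U \<longleftrightarrow> (\<forall>q\<in>U - trace L. \<forall>y\<in>Y. \<exists>\<phi>. section_on U \<phi> \<and> \<phi> q = y)"

lemma extendable_subset: "extendable U \<Longrightarrow> V \<subseteq> U \<Longrightarrow> extendable V"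
  unfolding extendable_def by (meson Diff_mono jump_section_subset order_refl subsetD)

lemma locally_extendable: "\<exists>N. open N \<and> p \<in> N \<and> extendable N"
proof (cases p rule: trace_cases)
  case 1
  have "section_on (- trace L) (\<lambda>_. y)" if "y \<in> Y" for y
    using that by (auto simp: jump_section_def simple_points_def)
  then have "extendable (- trace L)" unfolding extendable_def by blast
  then show ?thesis using 1 closed_trace by (intro exI[of _ "- trace L"]) (auto simp: open_Compl)
next
  case 2
  then obtain c t where c: "c < length L" "p = (L ! c) t" by (rule simple_pointE)
  have p: "(L ! c) t \<in> simple_points L" using 2 c by simp
  obtain \<eta> where \<eta>: "\<eta> > 0" "\<forall>u. dist u t < \<eta> \<longrightarrow> J ((L ! c) u) = J ((L ! c) t)"
    using locally_constant[OF c(1) p] unfolding eventually_nhds_metric by blast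
  obtain \<tau> N F where N: "strand_chart (L ! c) t \<tau> N F" "\<tau> \<le> \<eta>"
    "N \<inter> trace L = (L ! c) ` {t - \<tau><..<t + \<tau>}"
    by (rule simple_chart[OF c(1) p open_UNIV UNIV_I \<eta>(1)]) (rule that)
  note D = strand_chartD[OF N(1)]
  have nz: "F z \<noteq> 0" if "z \<in> N" "z \<notin> trace L" for z
    using D(6)[OF that(1)] that(2) c(1) by (force simp: trace_iff)
  define \<psi> where "\<psi> r z = (if F z > 0 then J p r else r)" for r z
  have sec: "section_on N (\<psi> r)" if r: "r \<in> Y" for r
    unfolding jump_section_def
  proof (intro conjI ballI)
    fix z assume z: "z \<in> N - trace L"
    show "\<psi> r z \<in> Y" using r bij[OF 2] by (auto simp: \<psi>_def bij_betw_def)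
    have "\<forall>\<^sub>F z' in nhds z. (F z' > 0) = (F z > 0)"
      by (rule eventually_same_sign[OF D(3,1)]) (use nz z in auto)
    then show "\<forall>\<^sub>F z' in nhds z. \<psi> r z' = \<psi> r z"
      by eventually_elim (simp add: \<psi>_def)
  next
    fix q assume q: "q \<in> N \<inter> simple_points L"
    then have "q \<in> N \<inter> trace L" by (simp add: simple_points_def)
    then obtain u where u: "q = (L ! c) u" "u \<in> {t - \<tau><..<t + \<tau>}" using N(3) by auto
    have s: "(L ! c) u \<in> simple_points L" using q u(1) by simp
    have "dist u t < \<eta>" using u(2) N(2) by (auto simp: dist_real_def abs_less_iff)
    then have J: "J q = J p" unfolding u(1) c(2) by (rule \<eta>(2)[rule_format])
    show "\<forall>\<^sub>F h in at_right 0. \<psi> r (q + of_real h * left_normal L q) =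
        J q (\<psi> r (q - of_real h * left_normal L q))"
      using strand_chart_normal_sides[OF N(1) u(2) velocity_nonzero[OF c(1)]]
      unfolding J unfolding u(1) left_normal_eq[OF c(1) s] by eventually_elim (simp add: \<psi>_def)
  qed
  have "\<exists>r\<in>Y. \<psi> r q = y" if y: "y \<in> Y" for q y
  proof -
    have "y \<in> J p ` Y" using bij_betw_imp_surj_on[OF bij[OF 2]] y by simp
    then obtain x where "x \<in> Y" "J p x = y" by blast
    then show ?thesis using y by (cases "F q > 0") (auto simp: \<psi>_def)
  qed
  then have "extendable N" unfolding extendable_def using sec by blast
  then show ?thesis using D(1) D(2) D(4)[of t] c(2) by auto
next
  case 3
  then obtain c s d t where cd: "c < length L" "d < length L" "(L ! c) s = p" "(L ! d) t = p"
    and det: "det2 (velocity (L ! c) s) (velocity (L ! d) t) > 0"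
    by (rule crossing_strands)
  have eq: "(L ! c) s = (L ! d) t" using cd by simp
  obtain A A' B B' where lim: "\<forall>\<^sub>F u in at_left s. J ((L ! c) u) = A" "\<forall>\<^sub>F u in at_right s. J ((L ! c) u) = A'"
    "\<forall>\<^sub>F u in at_left t. J ((L ! d) u) = B" "\<forall>\<^sub>F u in at_right t. J ((L ! d) u) = B'"
    "\<forall>y\<in>Y. A (B y) = B' (A' y)"
    using compatible[OF cd(1,2) eq det] by (elim exE conjE) (rule that)
  obtain N \<psi> where N: "open N" "p \<in> N" "\<And>e. e \<in> Y \<Longrightarrow> section_on N (\<psi> e)"
    "\<And>q y. q \<in> N \<Longrightarrow> q \<notin> trace L \<Longrightarrow> y \<in> Y \<Longrightarrow> \<exists>e\<in>Y. \<psi> e q = y"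
    by (rule crossing_model[OF cd det open_UNIV UNIV_I lim]) (rule that)
  have "extendable N"
    unfolding extendable_def
  proof (intro ballI)
    fix q y assume "q \<in> N - trace L" "y \<in> Y"
    then obtain e where "e \<in> Y" "\<psi> e q = y" using N(4)[of q y] by auto
    then show "\<exists>\<phi>. section_on N \<phi> \<and> \<phi> q = y" using N(3) by blast
  qed
  then show ?thesis using N(1,2) by blast
qed

text \<open>Choose the section on \<open>V\<close> that agrees with the one on \<open>U\<close> at a point of the intersection. They agree on
the whole intersection because it is connected. This is where simple connectivity of the plane enters:
rectangles can be assembled from small pieces with connected intersections.\<close>

lemma extendable_Un:
  assumes U: "open U" "extendable U" and V: "open V" "extendable V"
    and UV: "connected (U \<inter> V)" "U \<inter> V \<noteq> {}"
  shows "extendable (U \<union> V)"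
proof -
  obtain q' where q': "q' \<in> U \<inter> V" "q' \<notin> trace L"
    using off_trace_dense[of "U \<inter> V"] UV(2) U(1) V(1) by blast
  have glue: "\<exists>\<phi>. section_on (U' \<union> V') \<phi> \<and> \<phi> q = y"
    if U': "open U'" "extendable U'" and V': "open V'" "extendable V'" and con: "connected (U' \<inter> V')"
      and q: "q \<in> U'" "q \<notin> trace L" "y \<in> Y" and q': "q' \<in> U' \<inter> V'" for U' V' q y
  proof -
    obtain \<phi> where \<phi>: "section_on U' \<phi>" "\<phi> q = y"
      using U'(2) q unfolding extendable_def by blast
    have "\<phi> q' \<in> Y" using \<phi>(1) q' \<open>q' \<notin> trace L\<close> unfolding jump_section_def by blast
    then obtain \<psi> where \<psi>: "section_on V' \<psi>" "\<psi> q' = \<phi> q'"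
      using V'(2) q' \<open>q' \<notin> trace L\<close> unfolding extendable_def by blast
    have agree: "\<phi> z = \<psi> z" if "z \<in> U'" "z \<in> V'" "z \<notin> trace L" for z
      by (rule section_unique[OF open_Int[OF U'(1) V'(1)] con, of \<phi> \<psi> q'])
         (use \<phi> \<psi> q' that \<open>q' \<notin> trace L\<close> in \<open>auto intro: jump_section_subset\<close>)
    define \<theta> where "\<theta> z = (if z \<in> U' then \<phi> z else \<psi> z)" for z
    have "section_on U' \<theta>"
      by (rule section_cong[OF \<phi>(1) U'(1)]) (simp add: \<theta>_def)
    moreover have "section_on V' \<theta>"
      by (rule section_cong[OF \<psi>(1) V'(1)]) (auto simp: \<theta>_def agree)
    ultimately have "section_on (U' \<union> V') \<theta>" by (rule jump_section_Un)
    then show ?thesis using q \<phi>(2) by (intro exI[of _ \<theta>]) (simp add: \<theta>_def)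
  qed
  show ?thesis
    unfolding extendable_def
  proof (intro ballI)
    fix q y assume q: "q \<in> U \<union> V - trace L" "y \<in> Y"
    show "\<exists>\<phi>. section_on (U \<union> V) \<phi> \<and> \<phi> q = y"
    proof (cases "q \<in> U")
      case True
      then show ?thesis using glue[OF U V UV(1)] q q' by blast
    next
      case False
      then have "\<exists>\<phi>. section_on (V \<union> U) \<phi> \<and> \<phi> q = y"
        using glue[OF V U, of q y] UV(1) q q' by (auto simp: Int_commute)
      then show ?thesis by (simp add: Un_commute)
    qed
  qed
qed

lemma extendable_rect_Un:
  assumes "extendable (rect a b c d)" "extendable (rect a' b' c' d')"
    and "rect a b c d \<inter> rect a' b' c' d' = rect a'' b'' c'' d''" "a'' < b''" "c'' < d''"
  shows "extendable (rect a b c d \<union> rect a' b' c' d')"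
proof (rule extendable_Un)
  show "connected (rect a b c d \<inter> rect a' b' c' d')"
    unfolding assms(3) by (simp add: rect_def convex_connected convex_box)
  have "Complex ((a'' + b'') / 2) ((c'' + d'') / 2) \<in> rect a'' b'' c'' d''"
    using assms(4,5) by (simp add: rect_iff)
  then show "rect a b c d \<inter> rect a' b' c' d' \<noteq> {}" unfolding assms(3) by blast
qed (use assms in \<open>auto simp: rect_def open_box\<close>)

text \<open>Glue along a horizontal segment. The margin \<open>\<epsilon>\<close> makes neighboring pieces overlap.\<close>

lemma extendable_strip:
  assumes "a \<le> b"
  shows "\<exists>\<epsilon>>0. extendable (rect (a - \<epsilon>) (b + \<epsilon>) (y - \<epsilon>) (y + \<epsilon>))"
  using assms
proof (induction rule: Bolzano)
  case (trans a b c)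
  then obtain \<epsilon> \<epsilon>' where *: "\<epsilon> > 0" "extendable (rect (a - \<epsilon>) (b + \<epsilon>) (y - \<epsilon>) (y + \<epsilon>))"
    "\<epsilon>' > 0" "extendable (rect (b - \<epsilon>') (c + \<epsilon>') (y - \<epsilon>') (y + \<epsilon>'))" by blast
  define \<delta> where "\<delta> = min \<epsilon> \<epsilon>'"
  have \<delta>: "\<delta> > 0" "\<delta> \<le> \<epsilon>" "\<delta> \<le> \<epsilon>'" using * by (auto simp: \<delta>_def)
  have 1: "extendable (rect (a - \<delta>) (b + \<delta>) (y - \<delta>) (y + \<delta>))"
    by (rule extendable_subset[OF *(2)]) (use \<delta> in \<open>auto simp: rect_iff\<close>)
  have 2: "extendable (rect (b - \<delta>) (c + \<delta>) (y - \<delta>) (y + \<delta>))"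
    by (rule extendable_subset[OF *(4)]) (use \<delta> in \<open>auto simp: rect_iff\<close>)
  have "extendable (rect (a - \<delta>) (b + \<delta>) (y - \<delta>) (y + \<delta>) \<union> rect (b - \<delta>) (c + \<delta>) (y - \<delta>) (y + \<delta>))"
    by (rule extendable_rect_Un[OF 1 2, of "b - \<delta>" "b + \<delta>" "y - \<delta>" "y + \<delta>"])
       (use trans \<delta> in \<open>auto simp: rect_iff\<close>)
  then have "extendable (rect (a - \<delta>) (c + \<delta>) (y - \<delta>) (y + \<delta>))"
    by (rule extendable_subset) (use trans \<delta> in \<open>auto simp: rect_iff\<close>)
  then show ?case using \<delta>(1) by blast
next
  case (local x)
  obtain N where N: "open N" "Complex x y \<in> N" "extendable N" using locally_extendable by blast
  then obtain e where e: "e > 0" "ball (Complex x y) e \<subseteq> N" by (meson open_contains_ball)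
  show ?case
  proof (rule exI[of _ "e / 4"], intro conjI allI impI)
    show "0 < e / 4" using e(1) by simp
    fix a b assume ab: "a \<le> x \<and> x \<le> b \<and> b - a < e / 4"
    have "rect (a - e / 4) (b + e / 4) (y - e / 4) (y + e / 4) \<subseteq> ball (Complex x y) e"
    proof
      fix z assume "z \<in> rect (a - e / 4) (b + e / 4) (y - e / 4) (y + e / 4)"
      then have "\<bar>Re (Complex x y - z)\<bar> < e / 2" "\<bar>Im (Complex x y - z)\<bar> < e / 2"
        using ab e(1) unfolding rect_iff abs_less_iff by (simp_all only: minus_complex.sel complex.sel) linarith+
      then have "norm (Complex x y - z) < e"
        using cmod_le[of "Complex x y - z"] by linarith
      then show "z \<in> ball (Complex x y) e" by (simp add: dist_norm)
    qed
    then have "extendable (rect (a - e / 4) (b + e / 4) (y - e / 4) (y + e / 4))"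
      using e(2) by (intro extendable_subset[OF N(3)]) blast
    then show "\<exists>\<epsilon>>0. extendable (rect (a - \<epsilon>) (b + \<epsilon>) (y - \<epsilon>) (y + \<epsilon>))"
      using e(1) by (intro exI[of _ "e / 4"]) simp
  qed
qed

text \<open>The same gluing in the vertical direction, with strips as the small pieces.\<close>

lemma extendable_rect:
  assumes "a \<le> b" "c \<le> d"
  shows "extendable (rect a b c d)"
proof -
  have "\<exists>\<epsilon>>0. extendable (rect a b (c - \<epsilon>) (d + \<epsilon>))" if "a < b"
    using assms(2)
  proof (induction rule: Bolzano)
    case (trans c d e)
    then obtain \<epsilon> \<epsilon>' where *: "\<epsilon> > 0" "extendable (rect a b (c - \<epsilon>) (d + \<epsilon>))"
      "\<epsilon>' > 0" "extendable (rect a b (d - \<epsilon>') (e + \<epsilon>'))" by blast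
    define \<delta> where "\<delta> = min \<epsilon> \<epsilon>'"
    have \<delta>: "\<delta> > 0" "\<delta> \<le> \<epsilon>" "\<delta> \<le> \<epsilon>'" using * by (auto simp: \<delta>_def)
    have 1: "extendable (rect a b (c - \<delta>) (d + \<delta>))"
      by (rule extendable_subset[OF *(2)]) (use \<delta> in \<open>auto simp: rect_iff\<close>)
    have 2: "extendable (rect a b (d - \<delta>) (e + \<delta>))"
      by (rule extendable_subset[OF *(4)]) (use \<delta> in \<open>auto simp: rect_iff\<close>)
    have "extendable (rect a b (c - \<delta>) (d + \<delta>) \<union> rect a b (d - \<delta>) (e + \<delta>))"
      by (rule extendable_rect_Un[OF 1 2, of a b "d - \<delta>" "d + \<delta>"])
         (use trans \<delta> that in \<open>auto simp: rect_iff\<close>)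
    then have "extendable (rect a b (c - \<delta>) (e + \<delta>))"
      by (rule extendable_subset) (use trans \<delta> in \<open>auto simp: rect_iff\<close>)
    then show ?case using \<delta>(1) by blast
  next
    case (local y)
    obtain \<epsilon> where \<epsilon>: "\<epsilon> > 0" "extendable (rect (a - \<epsilon>) (b + \<epsilon>) (y - \<epsilon>) (y + \<epsilon>))"
      using extendable_strip[OF assms(1)] by blast
    have "extendable (rect a b (c - \<epsilon> / 2) (d + \<epsilon> / 2))" if "c \<le> y" "y \<le> d" "d - c < \<epsilon> / 2" for c d
      by (rule extendable_subset[OF \<epsilon>(2)]) (use \<epsilon>(1) that in \<open>auto simp: rect_iff\<close>)
    then show ?case
      using \<epsilon>(1) by (intro exI[of _ "\<epsilon> / 2"] conjI allI impI) (auto intro!: exI[of _ "\<epsilon> / 2"])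
  qed
  moreover have "extendable (rect a b c d)" if "\<not> a < b"
    using that by (auto simp: extendable_def rect_iff)
  ultimately show ?thesis
    by (cases "a < b") (auto elim!: extendable_subset simp: rect_iff)
qed

text \<open>By uniqueness every section agrees near the crossing with one of the explicit sections of
\<open>crossing_model\<close>, so its right values can be read off from the sector to the right of both strands.\<close>

lemma crossing_right_values:
  assumes \<phi>: "section_on U \<phi>" and U: "open U" "p \<in> U"
    and cd: "c < length L" "d < length L" "(L ! c) s = p" "(L ! d) t = p"
    and det: "det2 (velocity (L ! c) s) (velocity (L ! d) t) > 0"
    and A': "\<forall>\<^sub>F u in at_right s. J ((L ! c) u) = A'" and B: "\<forall>\<^sub>F u in at_left t. J ((L ! d) u) = B"
  obtains e where "e \<in> Y"
    "\<forall>\<^sub>F u in at_left s. right_value L \<phi> ((L ! c) u) (B e)"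
    "\<forall>\<^sub>F u in at_right s. right_value L \<phi> ((L ! c) u) e"
    "\<forall>\<^sub>F u in at_left t. right_value L \<phi> ((L ! d) u) e"
    "\<forall>\<^sub>F u in at_right t. right_value L \<phi> ((L ! d) u) (A' e)"
proof -
  have eq: "(L ! c) s = (L ! d) t" using cd by simp
  obtain A1 A1' B1 B1' where lim: "\<forall>\<^sub>F u in at_left s. J ((L ! c) u) = A1" "\<forall>\<^sub>F u in at_right s. J ((L ! c) u) = A1'"
    "\<forall>\<^sub>F u in at_left t. J ((L ! d) u) = B1" "\<forall>\<^sub>F u in at_right t. J ((L ! d) u) = B1'"
    "\<forall>y\<in>Y. A1 (B1 y) = B1' (A1' y)"
    using compatible[OF cd(1,2) eq det] by (elim exE conjE) (rule that)
  have "A1' = A'"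
    using eventually_happens[OF eventually_conj[OF lim(2) A']] by auto
  have "B1 = B"
    using eventually_happens[OF eventually_conj[OF lim(3) B]] by auto
  obtain N \<psi> where N: "open N" "p \<in> N" "N \<subseteq> U" "\<And>e. e \<in> Y \<Longrightarrow> section_on N (\<psi> e)"
    "\<And>q y. q \<in> N \<Longrightarrow> q \<notin> trace L \<Longrightarrow> y \<in> Y \<Longrightarrow> \<exists>e\<in>Y. \<psi> e q = y"
    and rv: "\<And>e. e \<in> Y \<Longrightarrow> \<forall>\<^sub>F u in at_left s. right_value L (\<psi> e) ((L ! c) u) (B1 e)"
    "\<And>e. e \<in> Y \<Longrightarrow> \<forall>\<^sub>F u in at_right s. right_value L (\<psi> e) ((L ! c) u) e"
    "\<And>e. e \<in> Y \<Longrightarrow> \<forall>\<^sub>F u in at_left t. right_value L (\<psi> e) ((L ! d) u) e"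
    "\<And>e. e \<in> Y \<Longrightarrow> \<forall>\<^sub>F u in at_right t. right_value L (\<psi> e) ((L ! d) u) (A1' e)"
    by (rule crossing_model[OF cd det U lim]) (rule that)
  obtain \<rho> where \<rho>: "\<rho> > 0" "ball p \<rho> \<subseteq> N" using N(1,2) by (meson open_contains_ball)
  have pb: "p \<in> ball p \<rho>" using \<rho>(1) by simp
  obtain q where q: "q \<in> ball p \<rho>" "q \<notin> trace L" using off_trace_dense[OF open_ball pb] by blast
  have "q \<in> U - trace L" using q \<rho>(2) N(3) by blast
  then have "\<phi> q \<in> Y" using \<phi> unfolding jump_section_def by blast
  then obtain e where e: "e \<in> Y" "\<psi> e q = \<phi> q" using N(5)[of q "\<phi> q"] q \<rho>(2) by blast
  have "section_on (ball p \<rho>) \<phi>" by (rule jump_section_subset[OF \<phi>]) (use \<rho>(2) N(3) in blast)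
  moreover have "section_on (ball p \<rho>) (\<psi> e)" by (rule jump_section_subset[OF N(4)[OF e(1)] \<rho>(2)])
  ultimately have agree: "\<phi> z = \<psi> e z" if "z \<in> ball p \<rho>" "z \<notin> trace L" for z
    using section_unique[OF open_ball, of p \<rho> \<phi> "\<psi> e" q z] q e(2) that by simp
  have transfer: "\<forall>\<^sub>F u in G. right_value L \<phi> ((L ! b) u) r"
    if b: "b < length L" "(L ! b) x = p" and G: "G \<le> at x"
      and r: "\<forall>\<^sub>F u in G. right_value L (\<psi> e) ((L ! b) u) r" for b x G r
  proof -
    have "(L ! b) x \<in> ball p \<rho>" using b(2) \<rho>(1) by simp
    then have "\<forall>\<^sub>F u in at x. (L ! b) u \<in> ball p \<rho>"
      using eventually_curve_in[OF b(1) open_ball, of x p \<rho>]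
      by (auto simp: eventually_at_filter elim: eventually_mono)
    from r filter_leD[OF G this] filter_leD[OF G eventually_simple[OF b(1)]]
    show ?thesis
    proof eventually_elim
      case (elim u)
      have "\<forall>\<^sub>F h in at_right 0.
          \<phi> ((L ! b) u + of_real h * left_normal L ((L ! b) u)) = \<psi> e ((L ! b) u + of_real h * left_normal L ((L ! b) u)) \<and>
          \<phi> ((L ! b) u - of_real h * left_normal L ((L ! b) u)) = \<psi> e ((L ! b) u - of_real h * left_normal L ((L ! b) u))"
        by (rule eventually_normal_near[OF elim(3) open_ball elim(2), where P = "\<lambda>z. \<phi> z = \<psi> e z"])
           (rule agree)
      then show ?case
        using elim(1) unfolding right_value_def by eventually_elim simp
    qed
  qed
  show ?thesis
    by (rule that[OF e(1)])
       (use transfer[OF cd(1,3)] transfer[OF cd(2,4)] rv[OF e(1)] \<open>A1' = A'\<close> \<open>B1 = B\<close>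
         in \<open>simp_all add: at_le\<close>)
qed

end

section \<open>The permutation cocycle of a finite symmetric set\<close>

locale finite_symmetric_set =
  fixes X :: "'a set" and S :: "'a \<times> 'a \<Rightarrow> 'a \<times> 'a"
  assumes finite_X: "finite X" and nondeg: "nondegenerate X S" and symmetric: "symmetric_set X S"
begin

text \<open>This is \<open>f\<^sub>y\<close>. It is the identity outside \<open>X\<close>, so that it is a permutation of \<open>X\<close> in the sense of
\<open>permutes\<close> and permutations can be compared as functions.\<close>

definition twist :: "'a \<Rightarrow> 'a \<Rightarrow> 'a" where
  "twist y x = (if x \<in> X then snd (S (x, y)) else x)"

lemma S_in: "x \<in> X \<Longrightarrow> y \<in> X \<Longrightarrow> S (x, y) \<in> X \<times> X"
  using symmetric unfolding symmetric_set_def braided_set_def bij_betw_def by blast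

lemma S_S: "x \<in> X \<Longrightarrow> y \<in> X \<Longrightarrow> S (S (x, y)) = (x, y)"
  using symmetric unfolding symmetric_set_def involutive_on_def by blast

lemma twist_permutes: "y \<in> X \<Longrightarrow> twist y permutes X"
proof (rule bij_imp_permutes)
  assume "y \<in> X"
  then have "bij_betw (\<lambda>x. snd (S (x, y))) X X"
    using nondeg by (simp add: nondegenerate_def)
  then show "bij_betw (twist y) X X"
    by (rule bij_betw_cong[THEN iffD1, rotated]) (simp add: twist_def)
qed (simp add: twist_def)

lemma twist_inj: "y \<in> X \<Longrightarrow> twist y x = twist y x' \<Longrightarrow> x = x'"
  using twist_permutes permutes_inj injD by metis

lemma S_eqD:
  assumes "i \<in> X" "j \<in> X" "S (i, j) = (l, k)"
  shows "l \<in> X" "k \<in> X" "twist j i = k" "twist k l = j"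
proof -
  show lk: "l \<in> X" "k \<in> X" using S_in[OF assms(1,2)] assms(3) by auto
  show "twist j i = k" using assms by (simp add: twist_def)
  show "twist k l = j" using S_S[OF assms(1,2)] assms(3) lk by (simp add: twist_def)
qed

text \<open>By involutivity the left output is recovered from the right output \<open>k\<close> and the right input \<open>j\<close>, as
\<open>f\<^sub>k l = j\<close>. So a crossing can be checked with the maps \<open>f\<close> alone.\<close>

lemma S_eqI:
  assumes "i \<in> X" "j \<in> X" "l \<in> X" "twist j i = k" "twist k l = j"
  shows "S (i, j) = (l, k)"
proof -
  obtain l' k' where S: "S (i, j) = (l', k')" by (cases "S (i, j)")
  note D = S_eqD[OF assms(1,2) S]
  have "k' = k" using D(3) assms(4) by simp
  then have "l' = l" using D(2,4) assms(5) twist_inj[of k l' l] by simp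
  then show ?thesis using S \<open>k' = k\<close> by simp
qed

text \<open>Compare the last components of the two sides of the braid relation at \<open>(x, i, j)\<close>.\<close>

lemma twist_comp:
  assumes "i \<in> X" "j \<in> X" "S (i, j) = (l, k)"
  shows "twist j \<circ> twist i = twist k \<circ> twist l"
proof
  fix x
  note lk = S_eqD(1,2)[OF assms]
  show "(twist j \<circ> twist i) x = (twist k \<circ> twist l) x"
  proof (cases "x \<in> X")
    case True
    have "S12 S (S23 S (S12 S (x, i, j))) = S23 S (S12 S (S23 S (x, i, j)))"
      using symmetric True assms(1,2) unfolding symmetric_set_def braided_set_def by blast
    then have "snd (snd (S12 S (S23 S (S12 S (x, i, j))))) = snd (snd (S23 S (S12 S (S23 S (x, i, j)))))"
      by simp
    moreover have "snd (S (x, i)) \<in> X" "snd (S (x, l)) \<in> X"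
      using S_in[OF True assms(1)] S_in[OF True lk(1)] by auto
    ultimately show ?thesis
      using True assms(3) by (simp add: S12_def S23_def twist_def case_prod_beta)
  qed (simp add: twist_def)
qed

text \<open>If \<open>f\<^sub>x y = x\<close>, then involutivity forces \<open>S (y, x) = (y, x)\<close>, so \<open>x\<close> is the unique point with \<open>g\<^sub>y x = y\<close>.
Here the nondegeneracy of \<open>g\<close> enters.\<close>

lemma twist_fixed_unique:
  assumes "x \<in> X" "x' \<in> X" "y \<in> X" "twist x y = x" "twist x' y = x'"
  shows "x = x'"
proof -
  have fst_S: "fst (S (y, z)) = y" if z: "z \<in> X" "twist z y = z" for z
  proof -
    obtain u k where S: "S (y, z) = (u, k)" by (cases "S (y, z)")
    note D = S_eqD[OF assms(3) z(1) S]
    have "k = z" using D(3) z(2) by simp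
    then have "twist z u = twist z y" using D(4) z(2) by simp
    then show ?thesis using twist_inj[OF z(1)] S by simp
  qed
  have "inj_on (\<lambda>z. fst (S (y, z))) X"
    using nondeg assms(3) by (auto simp: nondegenerate_def bij_betw_def)
  then show ?thesis
    using fst_S[OF assms(1,4)] fst_S[OF assms(2,5)] assms(1,2) by (metis inj_onD)
qed

abbreviation "Sym \<equiv> {\<sigma>. \<sigma> permutes X}"

text \<open>The change of the permutation when an edge of a component with label \<open>b\<close> is crossed from right to left;
\<open>\<sigma> b\<close> is the color of the edge.\<close>

definition push :: "'a \<Rightarrow> ('a \<Rightarrow> 'a) \<Rightarrow> 'a \<Rightarrow> 'a" where
  "push b \<sigma> = inv (twist (\<sigma> b)) \<circ> \<sigma>"

text \<open>Finiteness of \<open>X\<close> enters here: injective self-maps of the set of permutations are bijective.\<close>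

lemma self_map_bij:
  assumes "\<And>\<sigma>. \<sigma> permutes X \<Longrightarrow> T \<sigma> permutes X" "inj_on T Sym"
  shows "bij_betw T Sym Sym"
  unfolding bij_betw_def
  by (intro conjI assms(2) endo_inj_surj finite_permutations finite_X) (use assms(1) in auto)

lemma permutes_in: "\<sigma> permutes X \<Longrightarrow> b \<in> X \<Longrightarrow> \<sigma> b \<in> X"
  by (simp add: permutes_in_image)

lemma push_permutes: "b \<in> X \<Longrightarrow> \<sigma> permutes X \<Longrightarrow> push b \<sigma> permutes X"
  unfolding push_def
  by (rule permutes_compose[OF _ permutes_inv[OF twist_permutes[OF permutes_in]]])

lemma twist_push: "b \<in> X \<Longrightarrow> \<sigma> permutes X \<Longrightarrow> twist (\<sigma> b) (push b \<sigma> x) = \<sigma> x"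
  by (simp add: push_def permutes_inverses(1)[OF twist_permutes] permutes_in)

text \<open>From \<open>\<tau> = push b \<sigma>\<close> one recovers the color \<open>x = \<sigma> b\<close> as the unique solution of \<open>f\<^sub>x (\<tau> b) = x\<close>, and then
\<open>\<sigma> = f\<^sub>x \<circ> \<tau>\<close>.\<close>

lemma push_bij:
  assumes b: "b \<in> X"
  shows "bij_betw (push b) Sym Sym"
proof (rule self_map_bij)
  show "inj_on (push b) Sym"
  proof (rule inj_onI; simp)
    fix \<sigma> \<sigma>' assume \<sigma>: "\<sigma> permutes X" "\<sigma>' permutes X" "push b \<sigma> = push b \<sigma>'"
    have "\<sigma> b = \<sigma>' b"
      by (rule twist_fixed_unique[of _ _ "push b \<sigma> b"])
         (use \<sigma>(3) twist_push[OF b \<sigma>(1), of b] twist_push[OF b \<sigma>(2), of b] permutes_in[OF \<sigma>(1) b]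
            permutes_in[OF \<sigma>(2) b] permutes_in[OF push_permutes[OF b \<sigma>(1)] b] in simp_all)
    then show "\<sigma> = \<sigma>'"
      using twist_push[OF b \<sigma>(1)] twist_push[OF b \<sigma>(2)] \<sigma>(3) by (intro ext) metis
  qed
qed (rule push_permutes[OF b])

text \<open>The crossing rule for strands with labels \<open>a\<close> (entering from the left) and \<open>b\<close> (entering from the right), where
\<open>\<sigma>\<close> belongs to the sector to the right of both strands.\<close>

lemma push_solution:
  assumes "a \<in> X" "b \<in> X" "\<sigma> permutes X"
  shows "S (push b \<sigma> a, \<sigma> b) = (push a \<sigma> b, \<sigma> a)"
proof (rule S_eqI)
  show "push b \<sigma> a \<in> X" "push a \<sigma> b \<in> X"
    using assms permutes_in[OF push_permutes] by blast+
  show "\<sigma> b \<in> X" using assms permutes_in by blast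
qed (rule twist_push assms)+

text \<open>Both sides are \<open>\<sigma>\<close> followed by inverses of two maps \<open>f\<close>, whose colors are the inputs and the outputs
of the crossing in \<open>push_solution\<close>.\<close>

lemma push_commute:
  assumes "a \<in> X" "b \<in> X" "\<sigma> permutes X"
  shows "push a (push b \<sigma>) = push b (push a \<sigma>)"
proof -
  let ?i = "push b \<sigma> a" and ?j = "\<sigma> b" and ?l = "push a \<sigma> b" and ?k = "\<sigma> a"
  have in_X: "?i \<in> X" "?j \<in> X" "?l \<in> X" "?k \<in> X"
    using assms permutes_in[OF push_permutes[OF assms(2,3)]] permutes_in[OF push_permutes[OF assms(1,3)]]
      permutes_in[OF assms(3)] by simp_all
  have bij: "bij (twist x)" if "x \<in> X" for x using twist_permutes[OF that] by (rule permutes_bij)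
  have "push a (push b \<sigma>) = (inv (twist ?i) \<circ> inv (twist ?j)) \<circ> \<sigma>"
    by (simp add: push_def comp_assoc)
  also have "inv (twist ?i) \<circ> inv (twist ?j) = inv (twist ?j \<circ> twist ?i)"
    using bij in_X by (simp add: o_inv_distrib)
  also have "twist ?j \<circ> twist ?i = twist ?k \<circ> twist ?l"
    by (rule twist_comp[OF in_X(1,2) push_solution[OF assms]])
  also have "inv (twist ?k \<circ> twist ?l) = inv (twist ?l) \<circ> inv (twist ?k)"
    using bij in_X by (simp add: o_inv_distrib)
  also have "\<dots> \<circ> \<sigma> = push b (push a \<sigma>)"
    by (simp add: push_def comp_assoc)
  finally show ?thesis .
qed

lemma relation_inverse:
  assumes "i \<in> X" "j \<in> X" "S (i, j) = (l, k)"
  shows "inv (twist i) \<circ> (inv (twist j) \<circ> \<sigma>) = inv (twist l) \<circ> (inv (twist k) \<circ> \<sigma>)"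
proof -
  have bij: "bij (twist x)" if "x \<in> X" for x using twist_permutes[OF that] by (rule permutes_bij)
  have "inv (twist i) \<circ> inv (twist j) = inv (twist l) \<circ> inv (twist k)"
    using twist_comp[OF assms] bij assms(1,2) S_eqD(1,2)[OF assms] by (metis o_inv_distrib)
  then show ?thesis by (metis comp_assoc)
qed

lemma left_mult_bij:
  assumes "x \<in> X"
  shows "bij_betw (\<lambda>\<sigma>. inv (twist x) \<circ> \<sigma>) Sym Sym"
proof (rule self_map_bij)
  show "inj_on (\<lambda>\<sigma>. inv (twist x) \<circ> \<sigma>) Sym"
  proof (rule inj_onI)
    fix \<sigma> \<sigma>' assume "inv (twist x) \<circ> \<sigma> = inv (twist x) \<circ> \<sigma>'"
    then have "twist x \<circ> (inv (twist x) \<circ> \<sigma>) = twist x \<circ> (inv (twist x) \<circ> \<sigma>')" by simp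
    then show "\<sigma> = \<sigma>'"
      using permutes_inv_o(1)[OF twist_permutes[OF assms]] by (simp add: comp_assoc[symmetric])
  qed
qed (use assms in \<open>intro permutes_compose permutes_inv twist_permutes\<close>)

end

section \<open>Edges\<close>

definition arc_at :: "(real \<Rightarrow> complex) list \<Rightarrow> complex \<Rightarrow> complex set" where
  "arc_at L p = connected_component_set (simple_points L) p"

lemma edges_eq: "edges L = components (simple_points L)"
  by (simp add: edges_def simple_points_def trace_def)

lemma arc_at_in_edges: "p \<in> simple_points L \<Longrightarrow> arc_at L p \<in> edges L"
  by (simp add: edges_eq arc_at_def componentsI)

lemma in_arc_at: "p \<in> simple_points L \<Longrightarrow> p \<in> arc_at L p"
  by (simp add: arc_at_def)

lemma edge_simple: "e \<in> edges L \<Longrightarrow> p \<in> e \<Longrightarrow> p \<in> simple_points L"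
  using in_components_subset by (auto simp: edges_eq)

lemma arc_at_eq: "e \<in> edges L \<Longrightarrow> p \<in> e \<Longrightarrow> arc_at L p = e"
  unfolding edges_eq arc_at_def components_iff by (metis connected_component_eq)

lemma arc_at_eq_connected:
  assumes "connected T" "T \<subseteq> simple_points L" "p \<in> T" "q \<in> T"
  shows "arc_at L p = arc_at L q"
proof -
  have "q \<in> connected_component_set (simple_points L) p"
    using connected_component_maximal[OF assms(3,1,2)] assms(4) by blast
  then show ?thesis unfolding arc_at_def by (rule connected_component_eq[symmetric])
qed

context generic_link
begin

lemma eventually_simple_nhds:
  assumes "c < length L" "(L ! c) t \<in> simple_points L"
  shows "\<forall>\<^sub>F u in nhds t. (L ! c) u \<in> simple_points L"
proof -
  have "\<forall>\<^sub>F u in nhds t. u \<noteq> t \<longrightarrow> (L ! c) u \<in> simple_points L"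
    using eventually_simple[OF assms(1), of t] by (simp add: eventually_at_filter)
  then show ?thesis by eventually_elim (use assms(2) in auto)
qed

lemma arc_at_strand:
  assumes c: "c < length L" and I: "connected I" "\<And>u. u \<in> I \<Longrightarrow> (L ! c) u \<in> simple_points L"
    and uv: "u \<in> I" "v \<in> I"
  shows "arc_at L ((L ! c) u) = arc_at L ((L ! c) v)"
proof (rule arc_at_eq_connected[of "(L ! c) ` I"])
  show "connected ((L ! c) ` I)"
    by (intro connected_continuous_image I(1) continuous_at_imp_continuous_on ballI curve_continuous c)
qed (use I(2) uv in auto)

lemma arc_at_locally_constant:
  assumes c: "c < length L" and t: "(L ! c) t \<in> simple_points L"
  shows "\<forall>\<^sub>F u in nhds t. arc_at L ((L ! c) u) = arc_at L ((L ! c) t)"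
proof -
  obtain \<tau> where \<tau>: "\<tau> > 0" "\<And>u. dist u t < \<tau> \<Longrightarrow> (L ! c) u \<in> simple_points L"
    using eventually_simple_nhds[OF assms] unfolding eventually_nhds_metric by blast
  have "arc_at L ((L ! c) u) = arc_at L ((L ! c) t)" if "dist u t < \<tau>" for u
    by (rule arc_at_strand[OF c, of "ball t \<tau>"]) (use \<tau> that in \<open>auto simp: dist_commute\<close>)
  then show ?thesis using \<tau>(1) unfolding eventually_nhds_metric by blast
qed

lemma incoming_edge_exists:
  assumes c: "c < length L"
  obtains e where "incoming_edge L c s e" "\<forall>\<^sub>F u in at_left s. arc_at L ((L ! c) u) = e"
proof -
  have "\<forall>\<^sub>F u in at_left s. (L ! c) u \<in> simple_points L"
    by (rule filter_leD[OF _ eventually_simple[OF c, of s]]) (simp add: at_le)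
  then obtain b where b: "b < s" "\<And>u. b < u \<Longrightarrow> u < s \<Longrightarrow> (L ! c) u \<in> simple_points L"
    unfolding eventually_at_left_field by blast
  obtain m where m: "b < m" "m < s" using dense b(1) by blast
  let ?e = "arc_at L ((L ! c) m)"
  have eq: "arc_at L ((L ! c) u) = ?e" if "b < u" "u < s" for u
    by (rule arc_at_strand[OF c, of "{b<..<s}"]) (use b(2) m that in auto)
  have ev: "\<forall>\<^sub>F u in at_left s. b < u \<and> u < s"
    unfolding eventually_at_left_field using b(1) by blast
  have "\<forall>\<^sub>F u in at_left s. (L ! c) u \<in> ?e"
    using ev by eventually_elim (metis eq b(2) in_arc_at)
  moreover have "\<forall>\<^sub>F u in at_left s. arc_at L ((L ! c) u) = ?e"
    using ev by eventually_elim (simp add: eq)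
  ultimately show ?thesis
    using that[of ?e] arc_at_in_edges[OF b(2)[OF m]] by (simp add: incoming_edge_def)
qed

lemma outgoing_edge_exists:
  assumes c: "c < length L"
  obtains e where "outgoing_edge L c s e" "\<forall>\<^sub>F u in at_right s. arc_at L ((L ! c) u) = e"
proof -
  have "\<forall>\<^sub>F u in at_right s. (L ! c) u \<in> simple_points L"
    by (rule filter_leD[OF _ eventually_simple[OF c, of s]]) (simp add: at_le)
  then obtain b where b: "b > s" "\<And>u. s < u \<Longrightarrow> u < b \<Longrightarrow> (L ! c) u \<in> simple_points L"
    unfolding eventually_at_right_field by blast
  obtain m where m: "s < m" "m < b" using dense b(1) by blast
  let ?e = "arc_at L ((L ! c) m)"
  have eq: "arc_at L ((L ! c) u) = ?e" if "s < u" "u < b" for u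
    by (rule arc_at_strand[OF c, of "{s<..<b}"]) (use b(2) m that in auto)
  have ev: "\<forall>\<^sub>F u in at_right s. s < u \<and> u < b"
    unfolding eventually_at_right_field using b(1) by blast
  have "\<forall>\<^sub>F u in at_right s. (L ! c) u \<in> ?e"
    using ev by eventually_elim (metis eq b(2) in_arc_at)
  moreover have "\<forall>\<^sub>F u in at_right s. arc_at L ((L ! c) u) = ?e"
    using ev by eventually_elim (simp add: eq)
  ultimately show ?thesis
    using that[of ?e] arc_at_in_edges[OF b(2)[OF m]] by (simp add: outgoing_edge_def)
qed

text \<open>At a crossing a given passage, with its actual parameter, takes one of the two roles.\<close>

lemma crossing_partner:
  assumes c: "c < length L" "(L ! c) t \<in> crossings L"
  obtains d u where "d < length L" "(L ! d) u = (L ! c) t"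
    "det2 (velocity (L ! c) t) (velocity (L ! d) u) > 0 \<or> det2 (velocity (L ! d) u) (velocity (L ! c) t) > 0"
proof -
  obtain a x b y where *: "a < length L" "b < length L" "(L ! a) x = (L ! c) t" "(L ! b) y = (L ! c) t"
    "det2 (velocity (L ! a) x) (velocity (L ! b) y) > 0"
    using c(2) by (rule crossing_strands)
  have "(c = a \<and> (\<exists>n. t = x + of_int n)) \<or> (c = b \<and> (\<exists>n. t = y + of_int n))"
  proof (rule transversal_passages(2)[OF *(1,2) _ _ c(1)])
    show "(L ! a) x = (L ! b) y" by (simp only: *(3,4))
    show "det2 (velocity (L ! a) x) (velocity (L ! b) y) \<noteq> 0" using *(5) by linarith
    show "(L ! c) t = (L ! a) x" by (rule *(3)[symmetric])
  qed
  then show ?thesis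
  proof (elim disjE conjE exE)
    fix n assume n: "c = a" "t = x + of_int n"
    then have "velocity (L ! c) t = velocity (L ! a) x" using velocity_periodic[OF *(1)] by simp
    then show ?thesis by (intro that[OF *(2,4)]) (simp only: *(5) simp_thms)
  next
    fix n assume n: "c = b" "t = y + of_int n"
    then have "velocity (L ! c) t = velocity (L ! b) y" using velocity_periodic[OF *(2)] by simp
    then show ?thesis by (intro that[OF *(1,3)]) (simp only: *(5) simp_thms)
  qed
qed

end

definition right_val :: "(real \<Rightarrow> complex) list \<Rightarrow> (complex \<Rightarrow> 'y) \<Rightarrow> complex \<Rightarrow> 'y" where
  "right_val L \<phi> p = (THE r. right_value L \<phi> p r)"

lemma right_val_eq:
  assumes "right_value L \<phi> p r"
  shows "right_val L \<phi> p = r"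
  unfolding right_val_def
proof (rule the_equality)
  show "right_value L \<phi> p r" by (rule assms)
  show "r' = r" if "right_value L \<phi> p r'" for r' using that assms by (rule right_value_unique)
qed

context generic_link
begin

text \<open>Only the jump of the actual right value matters. This turns potentials for labels into potentials for
colors and back.\<close>

lemma jump_section_transfer:
  assumes \<phi>: "jump_section L Y J U \<phi>"
    and eq: "\<And>p. p \<in> U \<Longrightarrow> p \<in> simple_points L \<Longrightarrow>
      \<exists>r. right_value L \<phi> p r \<and> J p r = J' p r"
  shows "jump_section L Y J' U \<phi>"
  unfolding jump_section_def
proof (intro conjI ballI)
  fix p assume p: "p \<in> U \<inter> simple_points L"
  obtain r where r: "right_value L \<phi> p r" "J p r = J' p r" using eq p by blast
  have "\<forall>\<^sub>F h in at_right 0. \<phi> (p + of_real h * left_normal L p) = J p (\<phi> (p - of_real h * left_normal L p))"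
    using \<phi> p unfolding jump_section_def by blast
  then show "\<forall>\<^sub>F h in at_right 0.
      \<phi> (p + of_real h * left_normal L p) = J' p (\<phi> (p - of_real h * left_normal L p))"
    using r(1) unfolding right_value_def by eventually_elim (simp add: r(2))
qed (use \<phi> in \<open>auto simp: jump_section_def\<close>)

lemma right_value_cong:
  assumes p: "p \<in> simple_points L" "open U" "p \<in> U"
    and eq: "\<And>z. z \<in> U \<Longrightarrow> z \<notin> trace L \<Longrightarrow> \<phi> z = \<psi> z" and r: "right_value L \<phi> p r"
  shows "right_value L \<psi> p r"
proof -
  have "\<forall>\<^sub>F h in at_right 0. \<phi> (p + of_real h * left_normal L p) = \<psi> (p + of_real h * left_normal L p) \<and>
      \<phi> (p - of_real h * left_normal L p) = \<psi> (p - of_real h * left_normal L p)"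
    by (rule eventually_normal_near[OF p, where P = "\<lambda>z. \<phi> z = \<psi> z"]) (rule eq)
  then show ?thesis
    using r unfolding right_value_def by eventually_elim simp
qed

end

section \<open>Colorings and labels of components\<close>

locale link_coloring = generic_link L + finite_symmetric_set X S
  for L :: "(real \<Rightarrow> complex) list" and X :: "'a set" and S :: "'a \<times> 'a \<Rightarrow> 'a \<times> 'a"
begin

text \<open>The two rules for crossing an edge: \<open>label_jump\<close> depends on the labels of the components, \<open>color_jump\<close> on a
coloring.\<close>

definition label_jump :: "(nat \<Rightarrow> 'a) \<Rightarrow> complex \<Rightarrow> ('a \<Rightarrow> 'a) \<Rightarrow> 'a \<Rightarrow> 'a" where
  "label_jump a p = push (a (component_at L p))"

definition color_jump :: "(complex set \<Rightarrow> 'a) \<Rightarrow> complex \<Rightarrow> ('a \<Rightarrow> 'a) \<Rightarrow> 'a \<Rightarrow> 'a" where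
  "color_jump f p \<sigma> = inv (twist (f (arc_at L p))) \<circ> \<sigma>"

abbreviation "labelings \<equiv> {..<length L} \<rightarrow>\<^sub>E X"

lemma component_at_less: "p \<in> simple_points L \<Longrightarrow> component_at L p < length L"
  using component_at_eq by (metis simple_pointE)

lemma label_in: "a \<in> labelings \<Longrightarrow> c < length L \<Longrightarrow> a c \<in> X"
  by auto

lemma label_jump_along:
  assumes c: "c < length L"
  shows "\<forall>\<^sub>F u in at s. label_jump a ((L ! c) u) = push (a c)"
  using eventually_simple[OF c] by eventually_elim (simp add: label_jump_def component_at_eq[OF c])

lemma label_jump_sides:
  assumes c: "c < length L"
  shows "\<forall>\<^sub>F u in at_left s. label_jump a ((L ! c) u) = push (a c)"
    and "\<forall>\<^sub>F u in at_right s. label_jump a ((L ! c) u) = push (a c)"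
  by (rule filter_leD[OF _ label_jump_along[OF c, where s = s]], simp add: at_le)+

lemma label_system:
  assumes a: "a \<in> labelings"
  shows "jump_system L Sym (label_jump a)"
proof unfold_locales
  fix p assume "p \<in> simple_points L"
  then show "bij_betw (label_jump a p) Sym Sym"
    unfolding label_jump_def using a component_at_less by (intro push_bij) auto
next
  fix c t assume c: "c < length L" "(L ! c) t \<in> simple_points L"
  show "\<forall>\<^sub>F u in nhds t. label_jump a ((L ! c) u) = label_jump a ((L ! c) t)"
    using eventually_simple_nhds[OF c]
    by eventually_elim (simp add: label_jump_def component_at_eq[OF c] component_at_eq[OF c(1)])
next
  fix c d s t assume cd: "c < length L" "d < length L"
  have "push (a c) (push (a d) \<sigma>) = push (a d) (push (a c) \<sigma>)" if "\<sigma> \<in> Sym" for \<sigma>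
    using that push_commute label_in[OF a] cd by simp
  then show "\<exists>A A' B B'.
      (\<forall>\<^sub>F u in at_left s. label_jump a ((L ! c) u) = A) \<and>
      (\<forall>\<^sub>F u in at_right s. label_jump a ((L ! c) u) = A') \<and>
      (\<forall>\<^sub>F u in at_left t. label_jump a ((L ! d) u) = B) \<and>
      (\<forall>\<^sub>F u in at_right t. label_jump a ((L ! d) u) = B') \<and>
      (\<forall>y\<in>Sym. A (B y) = B' (A' y))"
    using label_jump_sides[OF cd(1), where s = s and a = a] label_jump_sides[OF cd(2), where s = t and a = a]
    by (intro exI[of _ "push (a c)"] exI[of _ "push (a d)"]) simp
qed

lemma coloring_in:
  assumes "is_coloring X S L f"
  shows "e \<in> edges L \<Longrightarrow> f e \<in> X"
  using assms unfolding is_coloring_def by blast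

lemma coloring_crossing:
  assumes "is_coloring X S L f" and "c < length L" "d < length L" "(L ! c) s = (L ! d) t"
    "det2 (velocity (L ! c) s) (velocity (L ! d) t) > 0"
    "incoming_edge L c s i" "incoming_edge L d t j" "outgoing_edge L d t l" "outgoing_edge L c s k"
  shows "S (f i, f j) = (f l, f k)"
  using assms unfolding is_coloring_def by blast

text \<open>Each half-strand at a crossing starts inside one edge, so the crossing condition of a coloring applies to
colors near the crossing on the four half-strands.\<close>

lemma crossing_colors:
  assumes f: "is_coloring X S L f" and cd: "c < length L" "d < length L" "(L ! c) s = (L ! d) t"
    and det: "det2 (velocity (L ! c) s) (velocity (L ! d) t) > 0"
  obtains i j k l where "i \<in> X" "j \<in> X" "S (i, j) = (l, k)"
    "\<forall>\<^sub>F u in at_left s. f (arc_at L ((L ! c) u)) = i" "\<forall>\<^sub>F u in at_right s. f (arc_at L ((L ! c) u)) = k"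
    "\<forall>\<^sub>F u in at_left t. f (arc_at L ((L ! d) u)) = j" "\<forall>\<^sub>F u in at_right t. f (arc_at L ((L ! d) u)) = l"
proof -
  obtain ei where i: "incoming_edge L c s ei" "\<forall>\<^sub>F u in at_left s. arc_at L ((L ! c) u) = ei"
    by (rule incoming_edge_exists[OF cd(1)])
  obtain ej where j: "incoming_edge L d t ej" "\<forall>\<^sub>F u in at_left t. arc_at L ((L ! d) u) = ej"
    by (rule incoming_edge_exists[OF cd(2)])
  obtain ek where k: "outgoing_edge L c s ek" "\<forall>\<^sub>F u in at_right s. arc_at L ((L ! c) u) = ek"
    by (rule outgoing_edge_exists[OF cd(1)])
  obtain el where l: "outgoing_edge L d t el" "\<forall>\<^sub>F u in at_right t. arc_at L ((L ! d) u) = el"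
    by (rule outgoing_edge_exists[OF cd(2)])
  show ?thesis
  proof (rule that[of "f ei" "f ej" "f el" "f ek"])
    show "f ei \<in> X" "f ej \<in> X"
      using i(1) j(1) coloring_in[OF f] by (auto simp: incoming_edge_def)
    show "S (f ei, f ej) = (f el, f ek)"
      by (rule coloring_crossing[OF f cd det i(1) j(1) l(1) k(1)])
  qed (use i(2) j(2) k(2) l(2) in \<open>auto elim: eventually_mono\<close>)
qed

lemma color_system:
  assumes f: "is_coloring X S L f"
  shows "jump_system L Sym (color_jump f)"
proof unfold_locales
  fix p assume "p \<in> simple_points L"
  then show "bij_betw (color_jump f p) Sym Sym"
    unfolding color_jump_def using coloring_in[OF f arc_at_in_edges] by (intro left_mult_bij) auto
next
  fix c t assume c: "c < length L" "(L ! c) t \<in> simple_points L"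
  show "\<forall>\<^sub>F u in nhds t. color_jump f ((L ! c) u) = color_jump f ((L ! c) t)"
    using arc_at_locally_constant[OF c] by eventually_elim (auto simp: color_jump_def)
next
  fix c d s t assume cd: "c < length L" "d < length L" "(L ! c) s = (L ! d) t"
    and det: "det2 (velocity (L ! c) s) (velocity (L ! d) t) > 0"
  obtain i j k l where *: "i \<in> X" "j \<in> X" "S (i, j) = (l, k)"
    "\<forall>\<^sub>F u in at_left s. f (arc_at L ((L ! c) u)) = i" "\<forall>\<^sub>F u in at_right s. f (arc_at L ((L ! c) u)) = k"
    "\<forall>\<^sub>F u in at_left t. f (arc_at L ((L ! d) u)) = j" "\<forall>\<^sub>F u in at_right t. f (arc_at L ((L ! d) u)) = l"
    by (rule crossing_colors[OF f cd det])
  let ?M = "\<lambda>x \<sigma>. inv (twist x) \<circ> \<sigma>"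
  have jump: "\<forall>\<^sub>F u in G. color_jump f ((L ! b) u) = ?M x" if "\<forall>\<^sub>F u in G. f (arc_at L ((L ! b) u)) = x" for G b x
    using that by eventually_elim (auto simp: color_jump_def)
  have "\<forall>\<sigma>\<in>Sym. ?M i (?M j \<sigma>) = ?M l (?M k \<sigma>)"
    using relation_inverse[OF *(1-3)] by blast
  then show "\<exists>A A' B B'.
      (\<forall>\<^sub>F u in at_left s. color_jump f ((L ! c) u) = A) \<and>
      (\<forall>\<^sub>F u in at_right s. color_jump f ((L ! c) u) = A') \<and>
      (\<forall>\<^sub>F u in at_left t. color_jump f ((L ! d) u) = B) \<and>
      (\<forall>\<^sub>F u in at_right t. color_jump f ((L ! d) u) = B') \<and>
      (\<forall>y\<in>Sym. A (B y) = B' (A' y))"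
    using jump[OF *(4)] jump[OF *(5)] jump[OF *(6)] jump[OF *(7)]
    by (intro exI[of _ "?M i"] exI[of _ "?M k"] exI[of _ "?M j"] exI[of _ "?M l"] conjI)
qed

end

section \<open>The bijection between labelings and colorings\<close>

text \<open>A rectangle around the link and a base point off the link at which potentials are normalized.\<close>

locale framed_link_coloring = link_coloring +
  fixes R :: real and q :: complex
  assumes R: "R > 0" and frame: "trace L \<subseteq> rect (- R) R (- R) R"
    and base: "q \<in> rect (- R) R (- R) R" "q \<notin> trace L"
begin

abbreviation "W \<equiv> rect (- R) R (- R) R"

lemma open_W: "open W" and connected_W: "connected W"
  by (simp_all add: rect_def open_box convex_connected convex_box)

lemma simple_in_W: "p \<in> simple_points L \<Longrightarrow> p \<in> W"
  using frame by (auto simp: simple_points_def)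

lemma strand_in_W: "d < length L \<Longrightarrow> (L ! d) t \<in> W"
  using frame trace_iff[of "(L ! d) t" L] by blast

definition potential :: "(complex \<Rightarrow> ('a \<Rightarrow> 'a) \<Rightarrow> 'a \<Rightarrow> 'a) \<Rightarrow> complex \<Rightarrow> 'a \<Rightarrow> 'a" where
  "potential J = (SOME \<phi>. jump_section L Sym J W \<phi> \<and> \<phi> q = id)"

lemma potential:
  assumes "jump_system L Sym J"
  shows "jump_section L Sym J W (potential J)" "potential J q = id"
proof -
  interpret jump_system L Sym J by (rule assms)
  have "extendable W" using R by (intro extendable_rect) auto
  then have "\<exists>\<phi>. jump_section L Sym J W \<phi> \<and> \<phi> q = id"
    using base permutes_id unfolding extendable_def by blast
  then have "jump_section L Sym J W (potential J) \<and> potential J q = id"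
    unfolding potential_def by (rule someI_ex)
  then show "jump_section L Sym J W (potential J)" "potential J q = id" by auto
qed

lemma potential_unique:
  assumes J: "jump_system L Sym J" and \<phi>: "jump_section L Sym J W \<phi>" "\<phi> q = id"
    and z: "z \<in> W" "z \<notin> trace L"
  shows "\<phi> z = potential J z"
proof -
  interpret jump_system L Sym J by (rule J)
  show ?thesis
    by (rule section_unique[OF open_W connected_W \<phi>(1) potential(1)[OF J] base _ z])
       (simp add: \<phi>(2) potential(2)[OF J])
qed

lemma right_val_locally_constant:
  assumes J: "jump_system L Sym J" and \<phi>: "jump_section L Sym J W \<phi>"
    and c: "c < length L" and t: "(L ! c) t \<in> simple_points L"
  obtains r where "r permutes X" "right_value L \<phi> ((L ! c) t) r"
    "\<forall>\<^sub>F u in nhds t. right_val L \<phi> ((L ! c) u) = r"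
proof -
  interpret jump_system L Sym J by (rule J)
  obtain r where r: "r \<in> Sym" "\<forall>\<^sub>F u in nhds t. right_value L \<phi> ((L ! c) u) r"
    by (rule right_value_exists[OF \<phi> open_W c t simple_in_W[OF t]])
  have "right_value L \<phi> ((L ! c) t) r" using r(2) by (rule eventually_nhds_x_imp_x)
  moreover have "\<forall>\<^sub>F u in nhds t. right_val L \<phi> ((L ! c) u) = r"
    using r(2) by eventually_elim (rule right_val_eq)
  ultimately show ?thesis using that r(1) by simp
qed

lemma right_val:
  assumes "jump_system L Sym J" "jump_section L Sym J W \<phi>" "p \<in> simple_points L"
  shows "right_value L \<phi> p (right_val L \<phi> p)" "right_val L \<phi> p permutes X"
proof -
  obtain c t where c: "c < length L" "p = (L ! c) t" using assms(3) by (rule simple_pointE)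
  obtain r where "r permutes X" "right_value L \<phi> ((L ! c) t) r"
    by (rule right_val_locally_constant[OF assms(1,2) c(1)]) (use assms(3) c(2) in auto)
  then show "right_value L \<phi> p (right_val L \<phi> p)" "right_val L \<phi> p permutes X"
    using right_val_eq c(2) by metis+
qed

lemma right_val_cong:
  assumes J: "jump_system L Sym J" and \<phi>: "jump_section L Sym J W \<phi>" and p: "p \<in> simple_points L"
    and eq: "\<And>z. z \<in> W \<Longrightarrow> z \<notin> trace L \<Longrightarrow> \<phi> z = \<psi> z"
  shows "right_val L \<psi> p = right_val L \<phi> p"
  by (rule right_val_eq, rule right_value_cong[OF p open_W simple_in_W[OF p] eq right_val(1)[OF J \<phi> p]])

definition label_color :: "(nat \<Rightarrow> 'a) \<Rightarrow> complex \<Rightarrow> 'a" where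
  "label_color a p = right_val L (potential (label_jump a)) p (a (component_at L p))"

definition coloring_of :: "(nat \<Rightarrow> 'a) \<Rightarrow> complex set \<Rightarrow> 'a" where
  "coloring_of a = (\<lambda>e\<in>edges L. label_color a (SOME p. p \<in> e))"

lemma label_potential:
  assumes "a \<in> labelings"
  shows "jump_section L Sym (label_jump a) W (potential (label_jump a))"
  by (rule potential(1)[OF label_system[OF assms]])

lemma label_color_in:
  assumes a: "a \<in> labelings" and p: "p \<in> simple_points L"
  shows "label_color a p \<in> X"
  unfolding label_color_def
  by (rule permutes_in[OF right_val(2)[OF label_system[OF a] label_potential[OF a] p]
        label_in[OF a component_at_less[OF p]]])

text \<open>Along an edge neither the component nor, locally, the right value of the potential changes.\<close>

lemma label_color_edge:
  assumes a: "a \<in> labelings" and e: "e \<in> edges L" and p: "p \<in> e" "p' \<in> e"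
  shows "label_color a p = label_color a p'"
proof (rule connected_induction_simple[OF _ p, where P = "\<lambda>z. label_color a p = label_color a z"])
  show "connected e" using e in_components_connected by (auto simp: edges_eq)
  fix z assume z: "z \<in> e"
  then have s: "z \<in> simple_points L" by (rule edge_simple[OF e])
  then obtain c t where c: "c < length L" "z = (L ! c) t" by (rule simple_pointE)
  have t: "(L ! c) t \<in> simple_points L" using s c by simp
  obtain r where r: "\<forall>\<^sub>F u in nhds t. right_val L (potential (label_jump a)) ((L ! c) u) = r"
    by (rule right_val_locally_constant[OF label_system[OF a] label_potential[OF a] c(1) t])
  then obtain \<eta> where \<eta>: "\<eta> > 0"
    "\<And>u. dist u t < \<eta> \<Longrightarrow> right_val L (potential (label_jump a)) ((L ! c) u) = r"
    unfolding eventually_nhds_metric by blast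
  obtain \<tau> N G where N: "strand_chart (L ! c) t \<tau> N G" "\<tau> \<le> \<eta>"
    "N \<inter> trace L = (L ! c) ` {t - \<tau><..<t + \<tau>}"
    by (rule simple_chart[OF c(1) t open_UNIV UNIV_I \<eta>(1)]) (rule that)
  note D = strand_chartD[OF N(1)]
  have color: "label_color a x = r (a c)" if x: "x \<in> e \<inter> N" for x
  proof -
    have xs: "x \<in> simple_points L" using edge_simple[OF e] x by blast
    then have "x \<in> N \<inter> trace L" using x by (simp add: simple_points_def)
    then obtain u where u: "x = (L ! c) u" "u \<in> {t - \<tau><..<t + \<tau>}" using N(3) by auto
    have "dist u t < \<eta>" using u(2) N(2) by (auto simp: dist_real_def abs_less_iff)
    then have "right_val L (potential (label_jump a)) x = r" unfolding u(1) by (rule \<eta>(2))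
    moreover have "component_at L x = c" using component_at_eq[OF c(1), of u] xs u(1) by simp
    ultimately show ?thesis by (simp add: label_color_def)
  qed
  show "\<exists>T. openin (top_of_set e) T \<and> z \<in> T \<and>
      (\<forall>x\<in>T. \<forall>y\<in>T. label_color a p = label_color a x \<longrightarrow> label_color a p = label_color a y)"
  proof (intro exI[of _ "e \<inter> N"] conjI ballI impI)
    show "openin (top_of_set e) (e \<inter> N)" using D(1) by (rule openin_open_Int)
    show "z \<in> e \<inter> N" using z D(2) D(4)[of t] c(2) by simp
    show "label_color a p = label_color a y"
      if "x \<in> e \<inter> N" "y \<in> e \<inter> N" "label_color a p = label_color a x" for x y
      using that(3) by (simp only: color[OF that(1)] color[OF that(2)])
  qed
qed simp

lemma coloring_of_edge:
  assumes a: "a \<in> labelings" and e: "e \<in> edges L" and p: "p \<in> e"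
  shows "coloring_of a e = label_color a p"
proof -
  have "(SOME p. p \<in> e) \<in> e" using p by (rule someI)
  then show ?thesis
    using label_color_edge[OF a e _ p] e by (simp add: coloring_of_def)
qed

lemma coloring_of_arc:
  assumes "a \<in> labelings" "p \<in> simple_points L"
  shows "coloring_of a (arc_at L p) = label_color a p"
  using coloring_of_edge[OF assms(1) arc_at_in_edges in_arc_at] assms(2) by blast

lemma coloring_of_is_coloring:
  assumes a: "a \<in> labelings"
  shows "is_coloring X S L (coloring_of a)"
  unfolding is_coloring_def
proof (intro conjI allI impI)
  show "coloring_of a \<in> edges L \<rightarrow>\<^sub>E X"
  proof
    fix e assume e: "e \<in> edges L"
    then obtain p where "p \<in> e" using in_components_nonempty by (fastforce simp: edges_eq)
    then show "coloring_of a e \<in> X"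
      using coloring_of_edge[OF a e] label_color_in[OF a edge_simple[OF e]] by simp
  qed (simp add: coloring_of_def)
next
  fix c d s t il ir ol or
  assume *: "c < length L \<and> d < length L \<and> (L ! c) s = (L ! d) t \<and>
        det2 (velocity (L ! c) s) (velocity (L ! d) t) > 0 \<and>
        incoming_edge L c s il \<and> incoming_edge L d t ir \<and>
        outgoing_edge L d t ol \<and> outgoing_edge L c s or"
  then have cd: "c < length L" "d < length L" and st: "(L ! c) s = (L ! d) t"
    and det: "det2 (velocity (L ! c) s) (velocity (L ! d) t) > 0"
    and il: "incoming_edge L c s il" and ir: "incoming_edge L d t ir"
    and ol: "outgoing_edge L d t ol" and or: "outgoing_edge L c s or" by auto
  interpret jump_system L Sym "label_jump a" by (rule label_system[OF a])
  let ?\<phi> = "potential (label_jump a)"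
  have pW: "(L ! d) t \<in> W" using cd(2) by (rule strand_in_W)
  obtain e where e: "e \<in> Sym"
    "\<forall>\<^sub>F u in at_left s. right_value L ?\<phi> ((L ! c) u) (push (a d) e)"
    "\<forall>\<^sub>F u in at_right s. right_value L ?\<phi> ((L ! c) u) e"
    "\<forall>\<^sub>F u in at_left t. right_value L ?\<phi> ((L ! d) u) e"
    "\<forall>\<^sub>F u in at_right t. right_value L ?\<phi> ((L ! d) u) (push (a c) e)"
    by (rule crossing_right_values[OF label_potential[OF a] open_W pW cd st refl det
          label_jump_sides(2)[OF cd(1)] label_jump_sides(1)[OF cd(2)]])
  have read_off: "coloring_of a g = r (a b)"
    if b: "b < length L" and g: "g \<in> edges L" "\<forall>\<^sub>F u in G. (L ! b) u \<in> g"
      and r: "\<forall>\<^sub>F u in G. right_value L ?\<phi> ((L ! b) u) r" and G: "G \<noteq> bot" for b g G r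
  proof -
    obtain u where u: "(L ! b) u \<in> g" "right_value L ?\<phi> ((L ! b) u) r"
      using eventually_happens'[OF G eventually_conj[OF g(2) r]] by blast
    have "(L ! b) u \<in> simple_points L" by (rule edge_simple[OF g(1) u(1)])
    then show ?thesis
      using coloring_of_edge[OF a g(1) u(1)] right_val_eq[OF u(2)] component_at_eq[OF b]
      by (simp add: label_color_def)
  qed
  have "coloring_of a il = push (a d) e (a c)" "coloring_of a or = e (a c)"
    "coloring_of a ir = e (a d)" "coloring_of a ol = push (a c) e (a d)"
    using il ir ol or e cd unfolding incoming_edge_def outgoing_edge_def
    by (auto intro!: read_off)
  then show "S (coloring_of a il, coloring_of a ir) = (coloring_of a ol, coloring_of a or)"
    using push_solution[of "a c" "a d" e] label_in[OF a] cd e(1) by simp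
qed

lemma label_section_is_color_section:
  assumes a: "a \<in> labelings"
  shows "jump_section L Sym (color_jump (coloring_of a)) W (potential (label_jump a))"
proof (rule jump_section_transfer[OF label_potential[OF a]])
  fix p assume p: "p \<in> simple_points L"
  let ?r = "right_val L (potential (label_jump a)) p"
  have "label_jump a p ?r = color_jump (coloring_of a) p ?r"
    by (simp add: label_jump_def color_jump_def push_def coloring_of_arc[OF a p] label_color_def)
  then show "\<exists>r. right_value L (potential (label_jump a)) p r \<and>
      label_jump a p r = color_jump (coloring_of a) p r"
    using right_val(1)[OF label_system[OF a] label_potential[OF a] p] by blast
qed

lemma simple_point_on_component:
  assumes "c < length L"
  obtains t where "(L ! c) t \<in> simple_points L"
  using eventually_happens[OF eventually_simple[OF assms, of 0]] by auto

text \<open>The potentials of two labelings with the same coloring both solve the rule of that coloring, so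
they agree. The labels are then the preimages of the colors under the same permutations.\<close>

lemma coloring_of_inj: "inj_on coloring_of labelings"
proof (rule inj_onI)
  fix a b assume a: "a \<in> labelings" and b: "b \<in> labelings" and eq: "coloring_of a = coloring_of b"
  let ?J = "color_jump (coloring_of a)"
  have J: "jump_system L Sym ?J" by (rule color_system[OF coloring_of_is_coloring[OF a]])
  have sec_a: "jump_section L Sym ?J W (potential (label_jump a))"
    by (rule label_section_is_color_section[OF a])
  have sec_b: "jump_section L Sym ?J W (potential (label_jump b))"
    using label_section_is_color_section[OF b] eq by simp
  have agree: "potential (label_jump a) z = potential (label_jump b) z" if "z \<in> W" "z \<notin> trace L" for z
    using potential_unique[OF J sec_a _ that] potential_unique[OF J sec_b _ that]
      potential(2)[OF label_system[OF a]] potential(2)[OF label_system[OF b]] by simp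
  show "a = b"
  proof (rule PiE_ext[OF a b])
    fix c assume "c \<in> {..<length L}"
    then have c: "c < length L" by simp
    obtain t where t: "(L ! c) t \<in> simple_points L" by (rule simple_point_on_component[OF c])
    have "right_val L (potential (label_jump b)) ((L ! c) t) = right_val L (potential (label_jump a)) ((L ! c) t)"
      by (rule right_val_cong[OF J sec_a t agree])
    moreover have "label_color a ((L ! c) t) = label_color b ((L ! c) t)"
      using coloring_of_arc[OF a t] coloring_of_arc[OF b t] eq by simp
    ultimately have "right_val L (potential (label_jump a)) ((L ! c) t) (a c) =
        right_val L (potential (label_jump a)) ((L ! c) t) (b c)"
      by (simp add: label_color_def component_at_eq[OF c t])
    then show "a c = b c"
      using permutes_inj[OF right_val(2)[OF J sec_a t]] by (auto dest: injD)
  qed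
qed

context
  fixes f assumes f: "is_coloring X S L f"
begin

text \<open>Inverse to \<open>label_color\<close>: from the color of an edge and the permutation on its right to the label.\<close>

definition label_at :: "complex \<Rightarrow> 'a" where
  "label_at p = inv (right_val L (potential (color_jump f)) p) (f (arc_at L p))"

lemma label_at_eqI:
  assumes "right_value L (potential (color_jump f)) p r" "f (arc_at L p) = x"
  shows "label_at p = inv r x"
  using assms by (simp add: label_at_def right_val_eq)

text \<open>Let \<open>e\<close> be the permutation in the sector to the right of both strands. On strand \<open>c\<close> the label is
\<open>(f\<^sub>j\<inverse> \<circ> e)\<inverse> i = e\<inverse> (f\<^sub>j i) = e\<inverse> k\<close> before the crossing and \<open>e\<inverse> k\<close> after it. On strand \<open>d\<close> it is \<open>e\<inverse> j\<close>
before and \<open>(f\<^sub>k\<inverse> \<circ> e)\<inverse> l = e\<inverse> (f\<^sub>k l) = e\<inverse> j\<close> after the crossing.\<close>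

lemma label_at_crossing:
  assumes cd: "c < length L" "d < length L" and st: "(L ! c) s = (L ! d) t"
    and det: "det2 (velocity (L ! c) s) (velocity (L ! d) t) > 0"
  shows "\<exists>x. \<forall>\<^sub>F u in at s. label_at ((L ! c) u) = x" "\<exists>x. \<forall>\<^sub>F u in at t. label_at ((L ! d) u) = x"
proof -
  let ?\<phi> = "potential (color_jump f)"
  interpret jump_system L Sym "color_jump f" by (rule color_system[OF f])
  obtain i j k l where ij: "i \<in> X" "j \<in> X" "S (i, j) = (l, k)"
    and col: "\<forall>\<^sub>F u in at_left s. f (arc_at L ((L ! c) u)) = i"
      "\<forall>\<^sub>F u in at_right s. f (arc_at L ((L ! c) u)) = k"
      "\<forall>\<^sub>F u in at_left t. f (arc_at L ((L ! d) u)) = j"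
      "\<forall>\<^sub>F u in at_right t. f (arc_at L ((L ! d) u)) = l"
    by (rule crossing_colors[OF f cd st det])
  note lk = S_eqD[OF ij]
  have pW: "(L ! d) t \<in> W" using cd(2) by (rule strand_in_W)
  let ?M = "\<lambda>x \<sigma>. inv (twist x) \<circ> \<sigma>"
  have jumps: "\<forall>\<^sub>F u in at_right s. color_jump f ((L ! c) u) = ?M k"
    "\<forall>\<^sub>F u in at_left t. color_jump f ((L ! d) u) = ?M j"
    using col(2,3) by (auto elim!: eventually_mono simp: color_jump_def)
  obtain e where e: "e \<in> Sym"
    "\<forall>\<^sub>F u in at_left s. right_value L ?\<phi> ((L ! c) u) (?M j e)"
    "\<forall>\<^sub>F u in at_right s. right_value L ?\<phi> ((L ! c) u) e"
    "\<forall>\<^sub>F u in at_left t. right_value L ?\<phi> ((L ! d) u) e"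
    "\<forall>\<^sub>F u in at_right t. right_value L ?\<phi> ((L ! d) u) (?M k e)"
    by (rule crossing_right_values[OF potential(1)[OF color_system[OF f]] open_W pW cd st refl det jumps])
  have inv_M: "inv (?M y e) x = inv e (twist y x)" if "y \<in> X" for x y
  proof -
    have "bij e" "bij (twist y)" using e(1) twist_permutes[OF that] permutes_bij by auto
    then show ?thesis by (simp add: o_inv_distrib bij_imp_bij_inv inv_inv_eq)
  qed
  have "\<forall>\<^sub>F u in at_left s. label_at ((L ! c) u) = inv e k"
    using e(2) col(1)
  proof eventually_elim
    case (elim u)
    then show ?case using label_at_eqI[OF elim] inv_M[OF ij(2)] lk(3) by simp
  qed
  moreover have "\<forall>\<^sub>F u in at_right s. label_at ((L ! c) u) = inv e k"
    using e(3) col(2) by eventually_elim (rule label_at_eqI)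
  ultimately show "\<exists>x. \<forall>\<^sub>F u in at s. label_at ((L ! c) u) = x"
    unfolding eventually_at_split by blast
  have "\<forall>\<^sub>F u in at_left t. label_at ((L ! d) u) = inv e j"
    using e(4) col(3) by eventually_elim (rule label_at_eqI)
  moreover have "\<forall>\<^sub>F u in at_right t. label_at ((L ! d) u) = inv e j"
    using e(5) col(4)
  proof eventually_elim
    case (elim u)
    then show ?case using label_at_eqI[OF elim] inv_M[OF lk(2)] lk(4) by simp
  qed
  ultimately show "\<exists>x. \<forall>\<^sub>F u in at t. label_at ((L ! d) u) = x"
    unfolding eventually_at_split by blast
qed

lemma label_at_locally_constant:
  assumes c: "c < length L"
  shows "\<exists>x. \<forall>\<^sub>F u in nhds t. (L ! c) u \<in> simple_points L \<longrightarrow> label_at ((L ! c) u) = x"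
proof (cases "(L ! c) t \<in> simple_points L")
  case True
  obtain r where "\<forall>\<^sub>F u in nhds t. right_val L (potential (color_jump f)) ((L ! c) u) = r"
    by (rule right_val_locally_constant[OF color_system[OF f] potential(1)[OF color_system[OF f]] c True])
  then have "\<forall>\<^sub>F u in nhds t. label_at ((L ! c) u) = inv r (f (arc_at L ((L ! c) t)))"
    using arc_at_locally_constant[OF c True] by eventually_elim (simp add: label_at_def)
  then show ?thesis by (auto elim: eventually_mono)
next
  case False
  then have "(L ! c) t \<in> crossings L" using c by (auto simp: simple_points_def trace_iff)
  then obtain d u where d: "d < length L" "(L ! d) u = (L ! c) t"
    "det2 (velocity (L ! c) t) (velocity (L ! d) u) > 0 \<or> det2 (velocity (L ! d) u) (velocity (L ! c) t) > 0"
    using crossing_partner[OF c] by blast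
  then have "\<exists>x. \<forall>\<^sub>F u in at t. label_at ((L ! c) u) = x"
    using label_at_crossing(1)[OF c d(1) d(2)[symmetric]] label_at_crossing(2)[OF d(1) c d(2)] by blast
  then obtain x where "\<forall>\<^sub>F u in at t. label_at ((L ! c) u) = x" by blast
  then have "\<forall>\<^sub>F u in nhds t. (L ! c) u \<in> simple_points L \<longrightarrow> label_at ((L ! c) u) = x"
    unfolding eventually_at_filter by eventually_elim (use False in auto)
  then show ?thesis by blast
qed

text \<open>The parameters of crossings are isolated and the label has the same limit on both sides of each of
them, so local constancy extends over the whole line.\<close>

lemma label_at_component:
  assumes c: "c < length L" and tu: "(L ! c) t \<in> simple_points L" "(L ! c) u \<in> simple_points L"
  shows "label_at ((L ! c) u) = label_at ((L ! c) t)"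
proof (rule connected_induction[of "UNIV :: real set" "\<lambda>t. (L ! c) t \<in> simple_points L"
      "\<lambda>u. label_at ((L ! c) u) = label_at ((L ! c) t)"])
  fix T and v :: real assume T: "openin (top_of_set UNIV) T" "v \<in> T"
  then have "\<forall>\<^sub>F w in nhds v. w \<in> T" by (intro eventually_nhds_in_open) auto
  then have "\<forall>\<^sub>F w in at v. w \<in> T" by (simp add: eventually_at_filter eventually_mono)
  then show "\<exists>w. w \<in> T \<and> (L ! c) w \<in> simple_points L"
    using eventually_happens[OF eventually_conj[OF _ eventually_simple[OF c, of v]]] by auto
next
  fix v :: real
  obtain x where "\<forall>\<^sub>F w in nhds v. (L ! c) w \<in> simple_points L \<longrightarrow> label_at ((L ! c) w) = x"
    using label_at_locally_constant[OF c] by blast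
  then obtain T where T: "open T" "v \<in> T"
    "\<And>w. w \<in> T \<Longrightarrow> (L ! c) w \<in> simple_points L \<Longrightarrow> label_at ((L ! c) w) = x"
    unfolding eventually_nhds by blast
  show "\<exists>T. openin (top_of_set UNIV) T \<and> v \<in> T \<and> (\<forall>x\<in>T. \<forall>y\<in>T.
      (L ! c) x \<in> simple_points L \<and> (L ! c) y \<in> simple_points L \<and>
      label_at ((L ! c) x) = label_at ((L ! c) t) \<longrightarrow> label_at ((L ! c) y) = label_at ((L ! c) t))"
  proof (intro exI[of _ T] conjI ballI impI)
    fix w w' assume w: "w \<in> T" "w' \<in> T" "(L ! c) w \<in> simple_points L \<and> (L ! c) w' \<in> simple_points L \<and>
      label_at ((L ! c) w) = label_at ((L ! c) t)"
    then show "label_at ((L ! c) w') = label_at ((L ! c) t)"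
      using T(3)[OF w(1)] T(3)[OF w(2)] by simp
  qed (use T in auto)
qed (use tu in auto)

text \<open>The labels of \<open>f\<close> are constant on components. With them, the potential of \<open>f\<close> also
solves the rule of the labeling, so it is the potential of the labeling and gives back \<open>f\<close>.\<close>

lemma coloring_of_surj: "\<exists>a\<in>labelings. coloring_of a = f"
proof -
  let ?\<phi> = "potential (color_jump f)"
  note sys = color_system[OF f]
  note sec = potential(1)[OF sys]
  define a where "a = (\<lambda>c\<in>{..<length L}. label_at ((L ! c) (SOME t. (L ! c) t \<in> simple_points L)))"
  have a_eq: "a (component_at L p) = label_at p" if p: "p \<in> simple_points L" for p
  proof -
    obtain c t where c: "c < length L" "p = (L ! c) t" using p by (rule simple_pointE)
    have "(L ! c) (SOME t. (L ! c) t \<in> simple_points L) \<in> simple_points L"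
      by (rule someI[of _ t]) (use p c(2) in simp)
    then show ?thesis
      using label_at_component[OF c(1) _ , of t "SOME t. (L ! c) t \<in> simple_points L"] p c
      by (simp add: a_def component_at_eq)
  qed
  have right: "right_val L ?\<phi> p (label_at p) = f (arc_at L p)" if p: "p \<in> simple_points L" for p
    using permutes_inverses(1)[OF right_val(2)[OF sys sec p]] by (simp add: label_at_def)
  have label_X: "label_at p \<in> X" if p: "p \<in> simple_points L" for p
    unfolding label_at_def
    by (rule permutes_in[OF permutes_inv[OF right_val(2)[OF sys sec p]] coloring_in[OF f arc_at_in_edges[OF p]]])
  have a: "a \<in> labelings"
  proof
    fix c assume "c \<in> {..<length L}"
    then have c: "c < length L" by simp
    obtain t where t: "(L ! c) t \<in> simple_points L" by (rule simple_point_on_component[OF c])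
    show "a c \<in> X" using a_eq[OF t] label_X[OF t] component_at_eq[OF c t] by simp
  qed (simp add: a_def)
  have sec_a: "jump_section L Sym (label_jump a) W ?\<phi>"
  proof (rule jump_section_transfer[OF sec])
    fix p assume p: "p \<in> simple_points L"
    let ?r = "right_val L ?\<phi> p"
    have "color_jump f p ?r = label_jump a p ?r"
      by (simp add: label_jump_def color_jump_def push_def a_eq[OF p] right[OF p])
    then show "\<exists>r. right_value L ?\<phi> p r \<and> color_jump f p r = label_jump a p r"
      using right_val(1)[OF sys sec p] by blast
  qed
  have agree: "?\<phi> z = potential (label_jump a) z" if "z \<in> W" "z \<notin> trace L" for z
    by (rule potential_unique[OF label_system[OF a] sec_a potential(2)[OF sys] that])
  have color: "label_color a p = f (arc_at L p)" if p: "p \<in> simple_points L" for p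
    using right_val_cong[OF sys sec p agree] right[OF p] a_eq[OF p] by (simp add: label_color_def)
  have "coloring_of a = f"
  proof (rule PiE_ext)
    show "coloring_of a \<in> edges L \<rightarrow>\<^sub>E X" "f \<in> edges L \<rightarrow>\<^sub>E X"
      using coloring_of_is_coloring[OF a] f by (auto simp: is_coloring_def)
    fix e assume e: "e \<in> edges L"
    then obtain p where p: "p \<in> e" using in_components_nonempty by (fastforce simp: edges_eq)
    show "coloring_of a e = f e"
      using coloring_of_edge[OF a e p] color[OF edge_simple[OF e p]] arc_at_eq[OF e p] by simp
  qed
  then show ?thesis using a by blast
qed

end

lemma card_colorings: "card {f. is_coloring X S L f} = card X ^ length L"
proof -
  have "bij_betw coloring_of labelings {f. is_coloring X S L f}"
    unfolding bij_betw_def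
  proof (intro conjI coloring_of_inj equalityI subsetI)
    fix f assume "f \<in> {f. is_coloring X S L f}"
    then show "f \<in> coloring_of ` labelings" using coloring_of_surj[of f] by auto
  qed (use coloring_of_is_coloring in auto)
  then have "card {f. is_coloring X S L f} = card labelings"
    by (simp add: bij_betw_same_card)
  then show ?thesis by (simp add: card_PiE)
qed

end

theorem proposition1p4:
  fixes X :: "'a set" and S :: "'a \<times> 'a \<Rightarrow> 'a \<times> 'a" and L :: "(real \<Rightarrow> complex) list"
  assumes "finite X" and "nondegenerate X S" and "symmetric_set X S"
    and "generic_flat_link L"
  shows "card {f. is_coloring X S L f} = card X ^ length L"
proof -
  interpret link_coloring L X S
    by unfold_locales (use assms in auto)
  obtain M where M: "M > 0" "\<And>z. z \<in> trace L \<Longrightarrow> norm z \<le> M"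
    using compact_imp_bounded[OF compact_trace] by (auto simp: bounded_pos)
  define q where "q = complex_of_real (M + 1)"
  interpret framed_link_coloring L X S "M + 2" q
  proof unfold_locales
    show "trace L \<subseteq> rect (- (M + 2)) (M + 2) (- (M + 2)) (M + 2)"
    proof
      fix z assume "z \<in> trace L"
      then show "z \<in> rect (- (M + 2)) (M + 2) (- (M + 2)) (M + 2)"
        using M(2)[of z] abs_Re_le_cmod[of z] abs_Im_le_cmod[of z] by (auto simp: rect_iff)
    qed
    have "norm q = M + 1" using M(1) by (simp add: q_def norm_of_real del: of_real_add)
    then show "q \<notin> trace L" using M(2)[of q] by auto
  qed (use M(1) in \<open>auto simp: rect_iff q_def\<close>)
  show ?thesis by (rule card_colorings)
qed

end
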